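(* For every $\beta\ge0$, $$\gamma_*(0)+\frac{\pi^2}{\gamma_*(\beta)}\beta^2\ \le\ \gamma_*(\beta)\ \le\ \gamma_*(0)+\frac{3\gamma_*(0)}{2}\beta^2.$$
   Context: $H^1=H^1(\mathbb{R}^2;\mathbb{C})$. For $\varrho\in L^1(\mathbb{R}^2)$ set $$\mathbf{A}[\varrho](\mathbf{x}):=\int_{\mathbb{R}^2}\frac{(\mathbf{x}-\mathbf{y})^\perp}{|\mathbf{x}-\mathbf{y}|^2}\varrho(\mathbf{y})\,\mathrm{d}\mathbf{y}$$ (principal value), $(x_1,x_2)^\perp=(-x_2,x_1)$. For $\beta\in\mathbb{R}$, $$\gamma_*(\beta):=\inf\left\{\frac{\int_{\mathbb{R}^2}|(\nabla+\mathrm{i}\beta\mathbf{A}[|u|^2])u|^2}{\int_{\mathbb{R}^2}|u|^4}: u\in H^1,\ \int_{\mathbb{R}^2}|u|^2=1\right\}.$$ *)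

theory Defs
  imports "HOL-Analysis.Analysis"
begin

fun times_differentiable :: "nat \<Rightarrow> (real^2 \<Rightarrow> real) \<Rightarrow> bool" where
  "times_differentiable 0 f \<longleftrightarrow> continuous_on UNIV f"
| "times_differentiable (Suc k) f \<longleftrightarrow>
     (\<forall>x. f differentiable (at x)) \<and>
     (\<forall>v. times_differentiable k (\<lambda>x. frechet_derivative f (at x) v))"

definition test_function :: "(real^2 \<Rightarrow> real) \<Rightarrow> bool" where
  "test_function \<phi> \<longleftrightarrow>
     (\<forall>k. times_differentiable k \<phi>) \<and> compact (closure {x. \<phi> x \<noteq> 0})"

definition partial_deriv :: "(real^2 \<Rightarrow> real) \<Rightarrow> 2 \<Rightarrow> real^2 \<Rightarrow> real" where
  "partial_deriv \<phi> j x = frechet_derivative \<phi> (at x) (axis j 1)"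

definition square_integrable :: "(real^2 \<Rightarrow> 'a::euclidean_space) \<Rightarrow> bool" where
  "square_integrable f \<longleftrightarrow>
     f \<in> borel_measurable lebesgue \<and> integrable lebesgue (\<lambda>x. (norm (f x))\<^sup>2)"

text \<open>Real-valued test functions suffice, by linearity.\<close>

definition has_weak_gradient :: "(real^2 \<Rightarrow> complex) \<Rightarrow> (real^2 \<Rightarrow> complex^2) \<Rightarrow> bool" where
  "has_weak_gradient u G \<longleftrightarrow>
     (\<forall>\<phi> j. test_function \<phi> \<longrightarrow>
        (LINT x|lebesgue. partial_deriv \<phi> j x *\<^sub>R u x)
          = - (LINT x|lebesgue. \<phi> x *\<^sub>R (G x $ j)))"

definition H1 :: "(real^2 \<Rightarrow> complex) set" where
  "H1 = {u. square_integrable u \<and> (\<exists>G. square_integrable G \<and> has_weak_gradient u G)}"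

text \<open>A square-integrable weak gradient is unique up to null sets; a representative is chosen.
  Elements of \<^const>\<open>H1\<close> are likewise functions rather than classes modulo null sets.\<close>

definition weak_gradient :: "(real^2 \<Rightarrow> complex) \<Rightarrow> real^2 \<Rightarrow> complex^2" where
  "weak_gradient u = (SOME G. square_integrable G \<and> has_weak_gradient u G)"

definition perp :: "real^2 \<Rightarrow> real^2" where
  "perp x = vector [- (x $ 2), x $ 1]"

text \<open>The principal value integral. For integrable \<open>\<rho>\<close> the limit exists at almost every
  \<open>x\<close>.\<close>

definition magnetic_potential :: "(real^2 \<Rightarrow> real) \<Rightarrow> real^2 \<Rightarrow> real^2" where
  "magnetic_potential \<rho> x =
     Lim (at_right 0) (\<lambda>\<epsilon>. LINT y:{y. \<epsilon> < norm (x - y)}|lebesgue.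
       (\<rho> y / (norm (x - y))\<^sup>2) *\<^sub>R perp (x - y))"

definition magnetic_gradient :: "real \<Rightarrow> (real^2 \<Rightarrow> complex) \<Rightarrow> real^2 \<Rightarrow> complex^2" where
  "magnetic_gradient \<beta> u x =
     (\<chi> j. weak_gradient u x $ j
        + \<i> * of_real (\<beta> * magnetic_potential (\<lambda>y. (norm (u y))\<^sup>2) x $ j) * u x)"

text \<open>The integrals and the infimum are formed in the extended nonnegative reals, so that no
  integral is silently replaced by 0; the infimum is finite.\<close>

definition gamma_star :: "real \<Rightarrow> real" where
  "gamma_star \<beta> = enn2real (INF u \<in> {u \<in> H1. (LINT x|lebesgue. (norm (u x))\<^sup>2) = 1}.
     (\<integral>\<^sup>+x. ennreal ((norm (magnetic_gradient \<beta> u x))\<^sup>2) \<partial>lebesgue)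
       / (\<integral>\<^sup>+x. ennreal ((norm (u x))^4) \<partial>lebesgue))"

end

theory Submission
  imports Defs
begin

text \<open>Write \<open>\<rho> = |u|^2\<close> and \<open>D = \<integral> |grad |u||^2\<close>. Up to a unit phase, \<open>(grad + i \<beta> A) u\<close> has real part
  \<open>grad |u|\<close> and an imaginary part \<open>b\<close>, so its energy is \<open>D + R\<close> with \<open>R = \<integral> |b|^2\<close>. The cross product of
  the two parts is the Jacobian of \<open>u\<close>, a null Lagrangian, plus \<open>\<beta> / 2\<close> times \<open>grad \<rho> \<bullet> V\<close>, where
  \<open>V = z / |z|^2 * \<rho>\<close> (convolution) satisfies \<open>div V = 2 \<pi> \<rho>\<close>. By Cauchy--Schwarz
  \<open>D R \<ge> (\<pi> \<beta> \<integral> \<rho>^2)^2\<close>; with the diamagnetic bound \<open>D \<ge> \<gamma>(0) \<integral> \<rho>^2\<close> this gives the lower bound.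

  For the upper bound \<open>|u|\<close> is used as a trial function, whose energy is \<open>D + \<beta>^2 \<integral> |A|^2 \<rho>\<close>. After
  symmetrisation, \<open>\<integral> |A|^2 \<rho>\<close> is a three-body integral of the inverse squared circumradius. Schur's
  inequality bounds this by the inverse sum of the squared sides, and a Hardy inequality for the
  product of three copies of \<open>u\<close> then yields \<open>\<integral> |A|^2 \<rho> \<le> 3/2 D\<close>.\<close>

section \<open>Continuity of translations\<close>

text \<open>The infimum is never assumed to be attained. Each trial function has a quotient
  \<open>e\<close> with \<open>e * (e - gamma_star 0) \<ge> (pi * \<beta>)^2\<close>, so
  \<open>e\<close> lies above the positive root of a fixed quadratic, and this root passes to the
  infimum.

  The obstacle is regularity: \<open>u\<close> has only weak derivatives and the kernel
  \<open>z / |z|^2\<close> is singular. All fields are therefore regularised by a small parameter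
  and integrated by parts against \<open>rho\<close>, whose gradient is merely in \<open>L1\<close>;
  the parameter is removed by Fatou or dominated convergence. What makes these limits possible is
  that the convolution of \<open>rho\<close> with \<open>1 / |z|\<close> is bounded, uniformly in
  the point, by the \<open>L1\<close> norm of the gradient of \<open>rho\<close>. No Sobolev
  embedding enters; finiteness of the \<open>L4\<close> norm comes out of the flux estimate.

  The constant 3/2 is \<open>1/3 * 9/2\<close>: three equal integrals after symmetrisation, and 9/2
  from the circumradius. The Hardy constant is 1, since the relative positions of three points of
  the plane form a space of dimension 4 and \<open>((4 - 2) / 2)^2 = 1\<close>.\<close>

lemma lborel_integral_translate:
  fixes f :: "'a::euclidean_space \<Rightarrow> 'b::{banach, second_countable_topology}"
  assumes [measurable]: "f \<in> borel_measurable borel"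
  shows "(LINT x|lborel. f (c + x)) = (LINT x|lborel. f x)"
  by (subst (2) lborel_distr_plus[of c, symmetric]) (simp add: integral_distr)

lemma lborel_integrable_translate_iff:
  fixes f :: "'a::euclidean_space \<Rightarrow> 'b::{banach, second_countable_topology}"
  assumes [measurable]: "f \<in> borel_measurable borel"
  shows "integrable lborel (\<lambda>x. f (c + x)) \<longleftrightarrow> integrable lborel f"
  by (subst (2) lborel_distr_plus[of c, symmetric]) (simp add: integrable_distr_eq)

lemma lborel_nn_integral_translate:
  fixes f :: "'a::euclidean_space \<Rightarrow> ennreal"
  assumes [measurable]: "f \<in> borel_measurable borel"
  shows "(\<integral>\<^sup>+x. f (c + x) \<partial>lborel) = (\<integral>\<^sup>+x. f x \<partial>lborel)"
  by (subst (2) lborel_distr_plus[of c, symmetric]) (simp add: nn_integral_distr)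

text \<open>The integrand marks the points that leave \<open>A\<close> under the shift. An open
  superset \<open>U\<close> of nearly the same measure helps: a point of \<open>A\<close> stays in
  \<open>U\<close> under small shifts, so dominated convergence disposes of \<open>U\<close>, and
  the part inside \<open>U - A\<close> costs at most its measure, by translation invariance.\<close>

lemma translation_diff_set_tendsto_zero:
  fixes A :: "'a::euclidean_space set" and z :: "nat \<Rightarrow> 'a"
  assumes A[measurable]: "A \<in> sets borel" and fin: "emeasure lborel A < \<infinity>" and z: "z \<longlonglongrightarrow> 0"
  shows "(\<lambda>n. LINT x|lborel. indicator A x * (1 - indicator A (z n + x) :: real)) \<longlonglongrightarrow> 0"
proof (rule LIMSEQ_I)
  fix e :: real assume "0 < e"
  obtain U where U: "open U" "A \<subseteq> U" "emeasure lborel (U - A) < e / 2"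
    using outer_regular_lborel[OF A, of "e / 2"] \<open>0 < e\<close> by auto
  have [measurable]: "U \<in> sets borel" using U(1) by simp
  have finD: "emeasure lborel (U - A) < \<infinity>" using order.strict_trans[OF U(3)] by (simp add: ennreal_less_top)
  have intA: "integrable lborel (indicator A :: _ \<Rightarrow> real)"
    using fin by simp
  have intD: "integrable lborel (indicator (U - A) :: _ \<Rightarrow> real)"
    using finD by simp
  have mD: "measure lborel (U - A) < e / 2"
    using U(3) finD \<open>0 < e\<close> by (simp add: emeasure_eq_ennreal_measure top.not_eq_extremum ennreal_less_iff)
  have lim: "(\<lambda>n. LINT x|lborel. indicator A x * (1 - indicator U (z n + x) :: real)) \<longlonglongrightarrow>
      (LINT x|(lborel :: 'a measure). 0)"
  proof (rule integral_dominated_convergence[where w = "indicator A"])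
    show "AE x in lborel. (\<lambda>n. indicator A x * (1 - indicator U (z n + x) :: real)) \<longlonglongrightarrow> 0"
    proof (rule AE_I2)
      fix x
      show "(\<lambda>n. indicator A x * (1 - indicator U (z n + x) :: real)) \<longlonglongrightarrow> 0"
      proof (cases "x \<in> A")
        case True
        have "(\<lambda>n. z n + x) \<longlonglongrightarrow> 0 + x" by (intro tendsto_intros z)
        then have "eventually (\<lambda>n. z n + x \<in> U) sequentially"
          using U True by (intro topological_tendstoD[where l = x]) auto
        then have "eventually (\<lambda>n. indicator A x * (1 - indicator U (z n + x) :: real) = 0) sequentially"
          by eventually_elim simp
        then show ?thesis by (rule tendsto_eventually)
      qed simp
    qed
    show "AE x in lborel. norm (indicator A x * (1 - indicator U (z n + x) :: real)) \<le> indicator A x" for n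
      by (auto split: split_indicator)
  qed (use intA in simp_all)
  then have "\<forall>\<^sub>F n in sequentially. (LINT x|lborel. indicator A x * (1 - indicator U (z n + x) :: real)) < e / 2"
    using \<open>0 < e\<close> by (auto dest!: order_tendstoD(2)[of _ _ _ "e / 2"])
  then obtain N where N: "\<And>n. n \<ge> N \<Longrightarrow> (LINT x|lborel. indicator A x * (1 - indicator U (z n + x) :: real)) < e / 2"
    by (auto simp: eventually_sequentially)
  show "\<exists>no. \<forall>n\<ge>no. norm ((LINT x|lborel. indicator A x * (1 - indicator A (z n + x) :: real)) - 0) < e"
  proof (intro exI allI impI)
    fix n assume "N \<le> n"
    let ?I = "\<lambda>S x. indicator A x * (1 - indicator S (z n + x) :: real)"
    have i1: "integrable lborel (?I U)"
      by (rule Bochner_Integration.integrable_bound[OF intA]) (auto simp: indicator_def)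
    have i2: "integrable lborel (\<lambda>x. indicator (U - A) (z n + x) :: real)"
      using intD by (subst lborel_integrable_translate_iff) auto
    have iA: "integrable lborel (?I A)"
      by (rule Bochner_Integration.integrable_bound[OF intA]) (auto simp: indicator_def)
    have "(LINT x|lborel. ?I A x) \<le> (LINT x|lborel. ?I U x + indicator (U - A) (z n + x))"
      by (intro integral_mono iA Bochner_Integration.integrable_add i1 i2) (auto simp: indicator_def)
    also have "\<dots> = (LINT x|lborel. ?I U x) + (LINT x|lborel. indicator (U - A) (z n + x))"
      by (rule Bochner_Integration.integral_add[OF i1 i2])
    also have "(LINT x|lborel. indicator (U - A) (z n + x)) = measure lborel (U - A)"
      by (subst lborel_integral_translate) auto
    also have "(LINT x|lborel. ?I U x) + measure lborel (U - A) < e"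
      using N[OF \<open>N \<le> n\<close>] mD by simp
    finally have "(LINT x|lborel. ?I A x) < e" .
    moreover have "0 \<le> (LINT x|lborel. ?I A x)"
      by (intro integral_nonneg_AE) (auto simp: indicator_def)
    ultimately show "norm ((LINT x|lborel. ?I A x) - 0) < e" by simp
  qed
qed

text \<open>Density argument over simple functions. For an indicator, the symmetric difference of a
  set and its translate splits into two one-sided differences; the second becomes an instance of the
  first after translating back, with \<open>- z n\<close> in place of \<open>z n\<close>.\<close>

lemma translation_continuous_L1:
  fixes f :: "'a::euclidean_space \<Rightarrow> 'b::{banach, second_countable_topology}"
  assumes "integrable lborel f" and z: "z \<longlonglongrightarrow> 0"
  shows "(\<lambda>n. LINT x|lborel. norm (f (z n + x) - f x)) \<longlonglongrightarrow> 0"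
  using assms(1)
proof (induction rule: integrable_induct)
  case (base A c)
  then have [measurable]: "A \<in> sets borel" and fin: "emeasure lborel A < \<infinity>" by auto
  have zm: "(\<lambda>n. - z n) \<longlonglongrightarrow> 0" using tendsto_minus[OF z] by simp
  have intA: "integrable lborel (indicator A :: _ \<Rightarrow> real)"
    using fin by simp
  have i1: "integrable lborel (\<lambda>x. indicator A x * (1 - indicator A (y + x) :: real))" for y
    by (rule Bochner_Integration.integrable_bound[OF intA]) (auto simp: indicator_def)
  have sw: "(\<lambda>x. indicator A (y + x) * (1 - indicator A x :: real)) =
      (\<lambda>x. (\<lambda>x. indicator A x * (1 - indicator A (- y + x) :: real)) (y + x))" for y
    by (simp add: algebra_simps)
  have i2: "integrable lborel (\<lambda>x. indicator A (y + x) * (1 - indicator A x :: real))" for y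
    unfolding sw using i1[of "- y"] by (subst lborel_integrable_translate_iff) simp_all
  have e2: "(LINT x|lborel. indicator A (y + x) * (1 - indicator A x :: real)) =
      (LINT x|lborel. indicator A x * (1 - indicator A (- y + x) :: real))" for y
    unfolding sw by (subst lborel_integral_translate) auto
  have "(LINT x|lborel. norm (indicator A (z n + x) *\<^sub>R c - indicator A x *\<^sub>R c)) =
      ((LINT x|lborel. indicator A x * (1 - indicator A (z n + x) :: real))
       + (LINT x|lborel. indicator A x * (1 - indicator A (- z n + x) :: real))) * norm c" for n
  proof -
    have "(LINT x|lborel. norm (indicator A (z n + x) *\<^sub>R c - indicator A x *\<^sub>R c)) =
       (LINT x|lborel. (indicator A x * (1 - indicator A (z n + x) :: real)
          + indicator A (z n + x) * (1 - indicator A x :: real)) * norm c)"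
      by (intro Bochner_Integration.integral_cong) (auto simp: indicator_def)
    also have "\<dots> = (LINT x|lborel. indicator A x * (1 - indicator A (z n + x) :: real)
          + indicator A (z n + x) * (1 - indicator A x :: real)) * norm c"
      by simp
    also have "(LINT x|lborel. indicator A x * (1 - indicator A (z n + x) :: real)
          + indicator A (z n + x) * (1 - indicator A x :: real)) =
       (LINT x|lborel. indicator A x * (1 - indicator A (z n + x) :: real)) +
       (LINT x|lborel. indicator A (z n + x) * (1 - indicator A x :: real))"
      by (rule Bochner_Integration.integral_add[OF i1 i2])
    finally show ?thesis unfolding e2 .
  qed
  moreover have "(\<lambda>n. ((LINT x|lborel. indicator A x * (1 - indicator A (z n + x) :: real))
       + (LINT x|lborel. indicator A x * (1 - indicator A (- z n + x) :: real))) * norm c) \<longlonglongrightarrow> (0 + 0) * norm c"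
    by (intro tendsto_intros translation_diff_set_tendsto_zero fin z zm) auto
  ultimately show ?case by simp
next
  case (add f g)
  have m[measurable]: "f \<in> borel_measurable borel" "g \<in> borel_measurable borel"
    using add(1,2) by (auto dest: borel_measurable_integrable)
  have i: "integrable lborel (\<lambda>x. norm (f (y + x) - f x))" "integrable lborel (\<lambda>x. norm (g (y + x) - g x))" for y
    using add(1,2) by (auto intro!: integrable_norm Bochner_Integration.integrable_diff simp: lborel_integrable_translate_iff)
  show ?case
  proof (rule tendsto_sandwich[where f = "\<lambda>_. 0"])
    show "\<forall>\<^sub>F n in sequentially. (LINT x|lborel. norm (f (z n + x) + g (z n + x) - (f x + g x)))
        \<le> (LINT x|lborel. norm (f (z n + x) - f x)) + (LINT x|lborel. norm (g (z n + x) - g x))"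
    proof (rule always_eventually, rule allI)
      fix n
      have "(LINT x|lborel. norm (f (z n + x) + g (z n + x) - (f x + g x))) \<le>
         (LINT x|lborel. norm (f (z n + x) - f x) + norm (g (z n + x) - g x))"
      proof (rule integral_mono)
        show "integrable lborel (\<lambda>x. norm (f (z n + x) + g (z n + x) - (f x + g x)))"
          using add(1,2) m by (auto intro!: integrable_norm Bochner_Integration.integrable_diff Bochner_Integration.integrable_add
              simp: lborel_integrable_translate_iff)
        show "norm (f (z n + x) + g (z n + x) - (f x + g x)) \<le> norm (f (z n + x) - f x) + norm (g (z n + x) - g x)" for x
          by (metis add_diff_add norm_triangle_ineq)
      qed (intro Bochner_Integration.integrable_add i)
      then show "(LINT x|lborel. norm (f (z n + x) + g (z n + x) - (f x + g x)))
        \<le> (LINT x|lborel. norm (f (z n + x) - f x)) + (LINT x|lborel. norm (g (z n + x) - g x))"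
        using i by simp
    qed
    show "(\<lambda>n. (LINT x|lborel. norm (f (z n + x) - f x)) + (LINT x|lborel. norm (g (z n + x) - g x))) \<longlonglongrightarrow> 0"
      using tendsto_add[OF add(3,4)] by simp
  qed auto
next
  case (lim f s)
  have m[measurable]: "f \<in> borel_measurable borel" "\<And>i. s i \<in> borel_measurable borel"
    using lim by (auto dest: borel_measurable_integrable)
  have c: "(\<lambda>i. LINT x|lborel. norm (s i x - f x)) \<longlonglongrightarrow> (LINT x|(lborel::'a measure). 0)"
  proof (rule integral_dominated_convergence[where w = "\<lambda>x. 3 * norm (f x)"])
    show "integrable lborel (\<lambda>x. 3 * norm (f x))" using lim(4) by auto
    show "AE x in lborel. (\<lambda>i. norm (s i x - f x)) \<longlonglongrightarrow> 0"
      using lim(2) by (auto intro!: tendsto_norm_zero LIM_zero)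
    show "AE x in lborel. norm (norm (s i x - f x)) \<le> 3 * norm (f x)" for i
    proof (rule AE_I2)
      fix x show "norm (norm (s i x - f x)) \<le> 3 * norm (f x)"
        using lim(3)[of x i] norm_triangle_ineq4[of "s i x" "f x"] by simp
    qed
  qed auto
  have i: "integrable lborel (\<lambda>x. norm (s i (y + x) - s i x))" "integrable lborel (\<lambda>x. norm (s i x - f x))"
    "integrable lborel (\<lambda>x. norm (s i (y + x) - f (y + x)))" "integrable lborel (\<lambda>x. norm (f (y + x) - f x))" for y i
    using lim(1,4) by (auto intro!: integrable_norm Bochner_Integration.integrable_diff simp: lborel_integrable_translate_iff)
  \<comment> \<open>The usual three-term split. The approximation error appears twice, once
    translated, and both copies are equal by invariance, hence the factor 2.\<close>
  have bd: "(LINT x|lborel. norm (f (y + x) - f x)) \<le> 2 * (LINT x|lborel. norm (s i x - f x)) +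
      (LINT x|lborel. norm (s i (y + x) - s i x))" for y i
  proof -
    have "(LINT x|lborel. norm (f (y + x) - f x)) \<le> (LINT x|lborel. norm (s i (y + x) - f (y + x))
       + norm (s i x - f x) + norm (s i (y + x) - s i x))"
    proof (rule integral_mono)
      fix x
      have "f (y + x) - f x = - (s i (y + x) - f (y + x)) + (s i x - f x) + (s i (y + x) - s i x)" by simp
      then show "norm (f (y + x) - f x) \<le> norm (s i (y + x) - f (y + x)) + norm (s i x - f x) + norm (s i (y + x) - s i x)"
        by (smt (verit) norm_minus_cancel norm_triangle_ineq)
    qed (intro Bochner_Integration.integrable_add i)+
    also have "\<dots> = (LINT x|lborel. norm (s i (y + x) - f (y + x))) + (LINT x|lborel. norm (s i x - f x)) + (LINT x|lborel. norm (s i (y + x) - s i x))"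
      by (simp add: i)
    also have "(LINT x|lborel. norm (s i (y + x) - f (y + x))) = (LINT x|lborel. norm (s i x - f x))"
      by (rule lborel_integral_translate[of "\<lambda>x. norm (s i x - f x)"]) measurable
    finally show ?thesis by simp
  qed
  show ?case
  proof (rule LIMSEQ_I)
    fix e :: real assume "0 < e"
    then obtain i where i: "(LINT x|lborel. norm (s i x - f x)) < e / 4"
      using order_tendstoD(2)[OF c, of "e / 4"] by (auto simp: eventually_sequentially)
    obtain N where N: "\<And>n. n \<ge> N \<Longrightarrow> (LINT x|lborel. norm (s i (z n + x) - s i x)) < e / 2"
      using order_tendstoD(2)[OF lim(5)[of i], of "e / 2"] \<open>0 < e\<close> by (auto simp: eventually_sequentially)
    show "\<exists>no. \<forall>n\<ge>no. norm ((LINT x|lborel. norm (f (z n + x) - f x)) - 0) < e"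
    proof (intro exI allI impI)
      fix n assume "N \<le> n"
      show "norm ((LINT x|lborel. norm (f (z n + x) - f x)) - 0) < e"
        using bd[of "z n" i] i N[OF \<open>N \<le> n\<close>] by simp
    qed
  qed
qed

text \<open>Strong monotonicity of the map \<open>a -> |a| a\<close>. It brings \<open>L2\<close>
  continuity of translations back to the \<open>L1\<close> statement, because
  \<open>norm (f x) *\<^sub>R f x\<close> is integrable when \<open>f\<close> is square
  integrable.\<close>

lemma norm_diff_squared_le_signed_square:
  fixes a b :: "'a::real_inner"
  shows "(norm (a - b))\<^sup>2 \<le> 2 * norm (norm a *\<^sub>R a - norm b *\<^sub>R b)"
proof (cases "norm a + norm b = 0")
  case True
  then have "a = 0" "b = 0" by (smt (verit) norm_ge_zero norm_eq_zero)+
  then show ?thesis by simp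
next
  case False
  then have pos: "norm a + norm b > 0" by (smt (verit) norm_ge_zero)
  let ?h = "norm a *\<^sub>R a - norm b *\<^sub>R b"
  have n2: "a \<bullet> a = norm a * norm a" "b \<bullet> b = norm b * norm b" by (simp_all add: dot_square_norm power2_eq_square)
  have "?h \<bullet> (a - b) - (norm a + norm b) / 2 * (norm (a - b))\<^sup>2
      = (norm a + norm b) * (norm a - norm b)\<^sup>2 / 2"
    unfolding power2_norm_eq_inner inner_diff_left inner_diff_right inner_scaleR_left n2
    by (simp add: inner_commute field_simps power2_eq_square)
  then have "(norm a + norm b) / 2 * (norm (a - b))\<^sup>2 \<le> ?h \<bullet> (a - b)"
    using pos by (smt (verit) divide_nonneg_nonneg mult_nonneg_nonneg zero_le_power2)
  also have "\<dots> \<le> norm ?h * norm (a - b)" by (rule norm_cauchy_schwarz)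
  also have "\<dots> \<le> norm ?h * (norm a + norm b)" by (intro mult_left_mono norm_triangle_ineq4) auto
  finally have "(norm a + norm b) * (norm (a - b))\<^sup>2 \<le> (norm a + norm b) * (2 * norm ?h)" by (simp add: algebra_simps)
  then show ?thesis using pos by simp
qed

lemma translation_continuous_L2:
  fixes f :: "'a::euclidean_space \<Rightarrow> 'b::euclidean_space"
  assumes [measurable]: "f \<in> borel_measurable borel" and f: "integrable lborel (\<lambda>x. (norm (f x))\<^sup>2)" and z: "z \<longlonglongrightarrow> 0"
  shows "(\<lambda>n. LINT x|lborel. (norm (f (z n + x) - f x))\<^sup>2) \<longlonglongrightarrow> 0"
proof (rule tendsto_sandwich[where f = "\<lambda>_. 0"])
  let ?h = "\<lambda>x. norm (f x) *\<^sub>R f x"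
  have h: "integrable lborel ?h"
    by (rule Bochner_Integration.integrable_bound[OF f]) (auto simp: power2_eq_square)
  have ih: "integrable lborel (\<lambda>x. norm (?h (y + x) - ?h x))" for y
    using h by (intro integrable_norm Bochner_Integration.integrable_diff) (subst lborel_integrable_translate_iff[of ?h], auto)
  show "(\<lambda>n. 2 * (LINT x|lborel. norm (?h (z n + x) - ?h x))) \<longlonglongrightarrow> 0"
    using tendsto_mult_left[OF translation_continuous_L1[OF h z], of 2] by simp
  show "\<forall>\<^sub>F n in sequentially. (LINT x|lborel. (norm (f (z n + x) - f x))\<^sup>2) \<le> 2 * (LINT x|lborel. norm (?h (z n + x) - ?h x))"
  proof (rule always_eventually, rule allI)
    fix n
    have "(LINT x|lborel. (norm (f (z n + x) - f x))\<^sup>2) \<le> (LINT x|lborel. 2 * norm (?h (z n + x) - ?h x))"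
    proof (rule integral_mono)
      show "integrable lborel (\<lambda>x. 2 * norm (?h (z n + x) - ?h x))" using ih by auto
      then show "integrable lborel (\<lambda>x. (norm (f (z n + x) - f x))\<^sup>2)"
        by (rule Bochner_Integration.integrable_bound) (auto simp: norm_diff_squared_le_signed_square)
    qed (rule norm_diff_squared_le_signed_square)
    then show "(LINT x|lborel. (norm (f (z n + x) - f x))\<^sup>2) \<le> 2 * (LINT x|lborel. norm (?h (z n + x) - ?h x))" by simp
  qed
qed auto

section \<open>Square-integrable functions\<close>

definition L2 :: "'a measure \<Rightarrow> ('a \<Rightarrow> 'b::euclidean_space) \<Rightarrow> bool" where
  "L2 M f \<longleftrightarrow> f \<in> borel_measurable M \<and> integrable M (\<lambda>x. (norm (f x))\<^sup>2)"

lemma L2_measurable[measurable_dest]: "L2 M f \<Longrightarrow> f \<in> borel_measurable M"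
  by (simp add: L2_def)

lemma L2_integrable: "L2 M f \<Longrightarrow> integrable M (\<lambda>x. (norm (f x))\<^sup>2)"
  by (simp add: L2_def)

lemma L2_bound:
  assumes f: "L2 M f" and [measurable]: "g \<in> borel_measurable M" and le: "\<And>x. norm (g x) \<le> C * norm (f x)"
  shows "L2 M g"
  unfolding L2_def
proof
  show "integrable M (\<lambda>x. (norm (g x))\<^sup>2)"
  proof (rule Bochner_Integration.integrable_bound)
    show "integrable M (\<lambda>x. C\<^sup>2 * (norm (f x))\<^sup>2)" using f by (auto simp: L2_def)
    show "AE x in M. norm ((norm (g x))\<^sup>2) \<le> norm (C\<^sup>2 * (norm (f x))\<^sup>2)"
      using power_mono[OF le norm_ge_zero, of _ 2] by (auto simp: power_mult_distrib)
  qed auto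
qed fact

lemma L2_add:
  assumes f: "L2 M f" and g: "L2 M g"
  shows "L2 M (\<lambda>x. f x + g x)"
  unfolding L2_def
proof
  show [measurable]: "(\<lambda>x. f x + g x) \<in> borel_measurable M" using f g by (auto simp: L2_def)
  show "integrable M (\<lambda>x. (norm (f x + g x))\<^sup>2)"
  proof (rule Bochner_Integration.integrable_bound)
    show "integrable M (\<lambda>x. 2 * (norm (f x))\<^sup>2 + 2 * (norm (g x))\<^sup>2)" using f g by (auto simp: L2_def)
    have "(norm (f x + g x))\<^sup>2 \<le> 2 * (norm (f x))\<^sup>2 + 2 * (norm (g x))\<^sup>2" for x
    proof -
      have "(norm (f x + g x))\<^sup>2 \<le> (norm (f x) + norm (g x))\<^sup>2" by (intro power_mono norm_triangle_ineq) auto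
      also have "\<dots> \<le> 2 * (norm (f x))\<^sup>2 + 2 * (norm (g x))\<^sup>2"
        using zero_le_power2[of "norm (f x) - norm (g x)"] by (simp add: power2_eq_square algebra_simps)
      finally show ?thesis .
    qed
    then show "AE x in M. norm ((norm (f x + g x))\<^sup>2) \<le> norm (2 * (norm (f x))\<^sup>2 + 2 * (norm (g x))\<^sup>2)" by auto
  qed measurable
qed

lemma L2_uminus: "L2 M f \<Longrightarrow> L2 M (\<lambda>x. - f x)"
  by (auto simp: L2_def)

lemma L2_diff: "L2 M f \<Longrightarrow> L2 M g \<Longrightarrow> L2 M (\<lambda>x. f x - g x)"
  using L2_add[of M f "\<lambda>x. - g x"] L2_uminus[of M g] by simp

lemma L2_norm_mult_integrable:
  assumes f: "L2 M f" and g: "L2 M g"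
  shows "integrable M (\<lambda>x. norm (f x) * norm (g x))"
proof (rule Bochner_Integration.integrable_bound)
  show "integrable M (\<lambda>x. (norm (f x))\<^sup>2 + (norm (g x))\<^sup>2)" using f g by (auto simp: L2_def)
  have "norm (f x) * norm (g x) \<le> (norm (f x))\<^sup>2 + (norm (g x))\<^sup>2" for x
    using zero_le_power2[of "norm (f x) - norm (g x)"]
      zero_le_power2[of "norm (f x)"] zero_le_power2[of "norm (g x)"] unfolding power2_diff by linarith
  then show "AE x in M. norm (norm (f x) * norm (g x)) \<le> norm ((norm (f x))\<^sup>2 + (norm (g x))\<^sup>2)" by auto
  show "(\<lambda>x. norm (f x) * norm (g x)) \<in> borel_measurable M" using f g by (auto simp: L2_def)
qed

lemma L2_mult_integrable:
  fixes f g :: "'a \<Rightarrow> 'b::{euclidean_space, real_normed_algebra}"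
  assumes f: "L2 M f" and g: "L2 M g"
  shows "integrable M (\<lambda>x. f x * g x)"
proof (rule Bochner_Integration.integrable_bound[OF L2_norm_mult_integrable[OF f g]])
  show "(\<lambda>x. f x * g x) \<in> borel_measurable M" using f g by (auto simp: L2_def)
qed (auto simp: norm_mult_ineq)

text \<open>The quadratic in \<open>t\<close> given by the integral of
  \<open>(t |f| - |g|)^2\<close> is nonnegative, so its discriminant is not positive;
  \<open>A = 0\<close> is treated apart because the quadratic is then affine.\<close>

lemma L2_Cauchy_Schwarz:
  assumes f: "L2 M f" and g: "L2 M g"
  shows "(LINT x|M. norm (f x) * norm (g x))\<^sup>2 \<le> (LINT x|M. (norm (f x))\<^sup>2) * (LINT x|M. (norm (g x))\<^sup>2)"
proof -
  define A B C where "A = (LINT x|M. (norm (f x))\<^sup>2)" and "B = (LINT x|M. (norm (g x))\<^sup>2)"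
    and "C = (LINT x|M. norm (f x) * norm (g x))"
  have i: "integrable M (\<lambda>x. (norm (f x))\<^sup>2)" "integrable M (\<lambda>x. (norm (g x))\<^sup>2)" "integrable M (\<lambda>x. norm (f x) * norm (g x))"
    using f g L2_norm_mult_integrable[OF f g] by (auto simp: L2_def)
  have q: "0 \<le> t\<^sup>2 * A - 2 * t * C + B" for t
  proof -
    have "0 \<le> (LINT x|M. (t * norm (f x) - norm (g x))\<^sup>2)" by simp
    also have "\<dots> = (LINT x|M. t\<^sup>2 * (norm (f x))\<^sup>2 - 2 * t * (norm (f x) * norm (g x)) + (norm (g x))\<^sup>2)"
      by (intro Bochner_Integration.integral_cong) (auto simp: power2_eq_square algebra_simps)
    also have "\<dots> = t\<^sup>2 * A - 2 * t * C + B"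
      using i by (simp add: A_def B_def C_def)
    finally show ?thesis .
  qed
  have A0: "0 \<le> A" unfolding A_def by simp
  show ?thesis
    unfolding A_def[symmetric] B_def[symmetric] C_def[symmetric]
  proof (cases "A = 0")
    case True
    have "C = 0"
    proof (rule ccontr)
      assume "C \<noteq> 0"
      \<comment> \<open>At this \<open>t\<close> the affine function takes the value
        \<open>-1\<close>.\<close>
      then show False using q[of "(B + 1) / (2 * C)"] True by (simp add: field_simps)
    qed
    then show "C\<^sup>2 \<le> A * B" using True by simp
  next
    case False
    then have "0 \<le> A * ((C / A)\<^sup>2 * A - 2 * (C / A) * C + B)"
      by (intro mult_nonneg_nonneg[OF A0 q])
    also have "\<dots> = A * B - C\<^sup>2" using False by (simp add: power2_eq_square field_simps)
    finally show "C\<^sup>2 \<le> A * B" by simp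
  qed
qed

lemma L2_Cauchy_Schwarz_sqrt:
  assumes f: "L2 M f" and g: "L2 M g"
  shows "(LINT x|M. norm (f x) * norm (g x)) \<le> sqrt (LINT x|M. (norm (f x))\<^sup>2) * sqrt (LINT x|M. (norm (g x))\<^sup>2)"
  using real_le_rsqrt[OF L2_Cauchy_Schwarz[OF f g]] by (simp add: real_sqrt_mult)

definition L2_tendsto :: "'a measure \<Rightarrow> (nat \<Rightarrow> 'a \<Rightarrow> 'b::euclidean_space) \<Rightarrow> ('a \<Rightarrow> 'b) \<Rightarrow> bool" where
  "L2_tendsto M F f \<longleftrightarrow> (\<forall>n. L2 M (F n)) \<and> L2 M f \<and> (\<lambda>n. LINT x|M. (norm (F n x - f x))\<^sup>2) \<longlonglongrightarrow> 0"

lemma L2_tendsto_const: "L2 M f \<Longrightarrow> L2_tendsto M (\<lambda>_. f) f"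
  by (simp add: L2_tendsto_def)

text \<open>Lets \<open>L2\<close> convergence pass through pointwise Lipschitz operations such as
  conjugation, multiplication by a bounded function, and the regularised absolute value.\<close>

lemma L2_tendsto_dominated:
  fixes f :: "'a \<Rightarrow> 'b::euclidean_space" and g :: "'a \<Rightarrow> 'c::euclidean_space"
  assumes F: "L2_tendsto M F f" and G: "\<And>n. L2 M (G n)" "L2 M g"
    and le: "\<And>n x. norm (G n x - g x) \<le> C * norm (F n x - f x)"
  shows "L2_tendsto M G g"
  unfolding L2_tendsto_def
proof (intro conjI allI G)
  show "(\<lambda>n. LINT x|M. (norm (G n x - g x))\<^sup>2) \<longlonglongrightarrow> 0"
  proof (rule tendsto_sandwich[where f = "\<lambda>_. 0"])
    show "(\<lambda>n. C\<^sup>2 * (LINT x|M. (norm (F n x - f x))\<^sup>2)) \<longlonglongrightarrow> 0"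
      using F unfolding L2_tendsto_def by (auto intro!: tendsto_eq_intros)
    show "\<forall>\<^sub>F n in sequentially. (LINT x|M. (norm (G n x - g x))\<^sup>2) \<le> C\<^sup>2 * (LINT x|M. (norm (F n x - f x))\<^sup>2)"
    proof (rule always_eventually, rule allI)
      fix n
      have "(LINT x|M. (norm (G n x - g x))\<^sup>2) \<le> (LINT x|M. C\<^sup>2 * (norm (F n x - f x))\<^sup>2)"
      proof (rule integral_mono)
        show "integrable M (\<lambda>x. (norm (G n x - g x))\<^sup>2)"
          using L2_diff[OF G] by (simp add: L2_def)
        show "integrable M (\<lambda>x. C\<^sup>2 * (norm (F n x - f x))\<^sup>2)"
          using L2_diff[of M "F n" f] F by (simp add: L2_def L2_tendsto_def)
        show "(norm (G n x - g x))\<^sup>2 \<le> C\<^sup>2 * (norm (F n x - f x))\<^sup>2" for x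
          using power_mono[OF le norm_ge_zero, of _ _ 2] by (auto simp: power_mult_distrib)
      qed
      then show "(LINT x|M. (norm (G n x - g x))\<^sup>2) \<le> C\<^sup>2 * (LINT x|M. (norm (F n x - f x))\<^sup>2)" by simp
    qed
  qed auto
qed

text \<open>With \<open>F = f + (F - f)\<close> and the same for \<open>G\<close>, the difference of
  the products has two linear terms and one quadratic term, each handled by Cauchy--Schwarz.\<close>

lemma L2_tendsto_integral_mult:
  fixes f g :: "'a \<Rightarrow> 'b::{euclidean_space, real_normed_algebra}"
  assumes F: "L2_tendsto M F f" and G: "L2_tendsto M G g"
  shows "(\<lambda>n. LINT x|M. F n x * G n x) \<longlonglongrightarrow> (LINT x|M. f x * g x)"
proof -
  have l: "\<And>n. L2 M (F n)" "L2 M f" "\<And>n. L2 M (G n)" "L2 M g" using F G by (auto simp: L2_tendsto_def)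
  define a b where "a n = (LINT x|M. (norm (F n x - f x))\<^sup>2)" and "b n = (LINT x|M. (norm (G n x - g x))\<^sup>2)" for n
  have ab: "a \<longlonglongrightarrow> 0" "b \<longlonglongrightarrow> 0" using F G by (auto simp: L2_tendsto_def a_def[abs_def] b_def[abs_def])
  define N1 N2 where "N1 = (LINT x|M. (norm (f x))\<^sup>2)" and "N2 = (LINT x|M. (norm (g x))\<^sup>2)"
  have "(\<lambda>n. (LINT x|M. F n x * G n x) - (LINT x|M. f x * g x)) \<longlonglongrightarrow> 0"
  proof (rule Lim_null_comparison)
    show "(\<lambda>n. sqrt (a n) * sqrt (b n) + (sqrt (a n) * sqrt N2 + sqrt N1 * sqrt (b n))) \<longlonglongrightarrow> 0"
      using ab by (auto intro!: tendsto_eq_intros)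
    show "\<forall>\<^sub>F n in sequentially. norm ((LINT x|M. F n x * G n x) - (LINT x|M. f x * g x))
        \<le> sqrt (a n) * sqrt (b n) + (sqrt (a n) * sqrt N2 + sqrt N1 * sqrt (b n))"
    proof (rule always_eventually, rule allI)
      fix n
      note d = L2_diff[OF l(1)[of n] l(2)] L2_diff[OF l(3)[of n] l(4)]
      have "(LINT x|M. F n x * G n x) - (LINT x|M. f x * g x) = (LINT x|M. F n x * G n x - f x * g x)"
        using l by (simp add: L2_mult_integrable)
      also have "norm \<dots> \<le> (LINT x|M. norm (F n x * G n x - f x * g x))" by (rule integral_norm_bound)
      also have "\<dots> \<le> (LINT x|M. norm (F n x - f x) * norm (G n x - g x) +
          (norm (F n x - f x) * norm (g x) + norm (f x) * norm (G n x - g x)))"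
      proof (rule integral_mono)
        show "integrable M (\<lambda>x. norm (F n x * G n x - f x * g x))"
          using l by (auto intro!: integrable_norm Bochner_Integration.integrable_diff L2_mult_integrable)
        show "integrable M (\<lambda>x. norm (F n x - f x) * norm (G n x - g x) +
          (norm (F n x - f x) * norm (g x) + norm (f x) * norm (G n x - g x)))"
          by (intro Bochner_Integration.integrable_add L2_norm_mult_integrable d l)
        fix x
        have "F n x * G n x - f x * g x = (F n x - f x) * (G n x - g x) + ((F n x - f x) * g x + f x * (G n x - g x))"
          by (simp add: algebra_simps)
        then show "norm (F n x * G n x - f x * g x) \<le> norm (F n x - f x) * norm (G n x - g x) +
          (norm (F n x - f x) * norm (g x) + norm (f x) * norm (G n x - g x))"
          by (smt (verit, best) norm_mult_ineq norm_triangle_ineq)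
      qed
      also have "\<dots> = (LINT x|M. norm (F n x - f x) * norm (G n x - g x)) +
          ((LINT x|M. norm (F n x - f x) * norm (g x)) + (LINT x|M. norm (f x) * norm (G n x - g x)))"
        using d l by (simp add: L2_norm_mult_integrable)
      also have "\<dots> \<le> sqrt (a n) * sqrt (b n) + (sqrt (a n) * sqrt N2 + sqrt N1 * sqrt (b n))"
        unfolding a_def b_def N1_def N2_def by (intro add_mono L2_Cauchy_Schwarz_sqrt d l)
      finally show "norm ((LINT x|M. F n x * G n x) - (LINT x|M. f x * g x))
        \<le> sqrt (a n) * sqrt (b n) + (sqrt (a n) * sqrt N2 + sqrt N1 * sqrt (b n))" .
    qed
  qed
  then show ?thesis by (simp add: LIM_zero_iff)
qed

text \<open>Integrate over all \<open>x\<close> the identity that writes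
  \<open>f (x + e) - f x\<close> as the integral of \<open>f' (x + t e)\<close> over
  \<open>0 \<le> t \<le> 1\<close>: the left side gives 0, and by Fubini and translation invariance
  the right side gives the integral of \<open>f'\<close>. Later integrations by parts go back to
  this, applied to products, so boundary terms never occur.\<close>

lemma integral_directional_derivative_eq_0:
  fixes f f' :: "'a::euclidean_space \<Rightarrow> 'b::euclidean_space"
  assumes f: "integrable lborel f" and f': "integrable lborel f'" and cont: "continuous_on UNIV f'"
    and deriv: "\<And>x t. ((\<lambda>t. f (x + t *\<^sub>R e)) has_vector_derivative f' (x + t *\<^sub>R e)) (at t)"
  shows "(LINT x|lborel. f' x) = 0"
proof -
  have m[measurable]: "f \<in> borel_measurable borel" "f' \<in> borel_measurable borel"
    using f f' by (auto dest: borel_measurable_integrable)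
  let ?g = "\<lambda>(t::real) x. indicator {0..1::real} t *\<^sub>R f' (x + t *\<^sub>R e)"
  have tr: "integrable lborel (\<lambda>x. f' (x + c))" "(LINT x|lborel. norm (f' (x + c))) = (LINT x|lborel. norm (f' x))"
    "(LINT x|lborel. f' (x + c)) = (LINT x|lborel. f' x)"
    "integrable lborel (\<lambda>x. f (x + c))" "(LINT x|lborel. f (x + c)) = (LINT x|lborel. f x)" for c
    using lborel_integrable_translate_iff[of f' c] lborel_integral_translate[of "\<lambda>x. norm (f' x)" c] f' f
      lborel_integrable_translate_iff[of f c] lborel_integral_translate[of f' c] lborel_integral_translate[of f c]
    by (simp_all add: add.commute)
  have int: "integrable (lborel \<Otimes>\<^sub>M lborel) (case_prod ?g)"
  proof (rule lborel_pair.Fubini_integrable)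
    show "integrable lborel (\<lambda>t. LINT x|lborel. norm (case_prod ?g (t, x)))"
      by (simp add: tr)
    show "AE t in lborel. integrable lborel (\<lambda>x. case_prod ?g (t, x))"
      by (simp add: tr)
  qed measurable
  have ftc: "(LINT t|lborel. ?g t x) = f (x + e) - f x" for x
  proof -
    have "(LINT t|lborel. ?g t x) = f (x + 1 *\<^sub>R e) - f (x + 0 *\<^sub>R e)"
      by (rule integral_FTC_atLeastAtMost)
        (auto intro!: has_vector_derivative_at_within deriv continuous_on_compose2[OF cont] continuous_intros)
    then show ?thesis by simp
  qed
  have "(LINT x|lborel. f' x) = (LINT t|lborel. indicator {0..1::real} t *\<^sub>R (LINT x|lborel. f' x))"
    by simp
  also have "\<dots> = (LINT t|lborel. LINT x|lborel. ?g t x)"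
    by (simp add: tr)
  also have "\<dots> = (LINT x|lborel. LINT t|lborel. ?g t x)"
    by (rule lborel_pair.Fubini_integral[OF int, symmetric])
  also have "\<dots> = (LINT x|lborel. f (x + e) - f x)" unfolding ftc ..
  also have "\<dots> = 0" using f tr(4)[of e] tr(5)[of e] by simp
  finally show ?thesis .
qed

section \<open>Test functions\<close>

lemma frechet_derivative_at': "(f has_derivative f') (at x) \<Longrightarrow> frechet_derivative f (at x) = f'"
  by (rule frechet_derivative_at[symmetric])

lemma times_differentiable_SucD: "times_differentiable (Suc k) f \<Longrightarrow> times_differentiable k f"
proof (induction k arbitrary: f)
  case 0
  then show ?case
    by (auto intro!: differentiable_imp_continuous_on simp: differentiable_on_def intro: differentiable_at_withinI)
next
  case (Suc k)
  then show ?case by (metis times_differentiable.simps(2))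
qed

lemma times_differentiable_const: "times_differentiable k (\<lambda>_. c)"
  by (induction k arbitrary: c) auto

lemma times_differentiable_add:
  "times_differentiable k f \<Longrightarrow> times_differentiable k g \<Longrightarrow> times_differentiable k (\<lambda>x. f x + g x)"
proof (induction k arbitrary: f g)
  case 0
  then show ?case by (auto intro: continuous_intros)
next
  case (Suc k)
  then have d: "\<And>x. f differentiable (at x)" "\<And>x. g differentiable (at x)" by auto
  have "frechet_derivative (\<lambda>x. f x + g x) (at x) =
      (\<lambda>v. frechet_derivative f (at x) v + frechet_derivative g (at x) v)" for x
    using d[of x] frechet_derivative_works by (intro frechet_derivative_at' has_derivative_add) auto
  then show ?case using Suc d by auto
qed

lemma times_differentiable_mult:
  "times_differentiable k f \<Longrightarrow> times_differentiable k g \<Longrightarrow> times_differentiable k (\<lambda>x. f x * g x)"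
proof (induction k arbitrary: f g)
  case 0
  then show ?case by (auto intro: continuous_intros)
next
  case (Suc k)
  then have d: "\<And>x. f differentiable (at x)" "\<And>x. g differentiable (at x)" by auto
  have "frechet_derivative (\<lambda>x. f x * g x) (at x) =
      (\<lambda>v. f x * frechet_derivative g (at x) v + frechet_derivative f (at x) v * g x)" for x
    using d[of x] frechet_derivative_works by (intro frechet_derivative_at' has_derivative_mult) auto
  moreover have "times_differentiable k f" "times_differentiable k g"
    using Suc.prems times_differentiable_SucD by blast+
  ultimately show ?case using Suc d by (auto intro!: times_differentiable_add)
qed

lemma times_differentiable_translate:
  "times_differentiable k f \<Longrightarrow> times_differentiable k (\<lambda>y. f (y - x))"
  "f differentiable (at (y - x)) \<Longrightarrow> frechet_derivative (\<lambda>y. f (y - x)) (at y) = frechet_derivative f (at (y - x))"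
proof -
  have hd: "((\<lambda>y. f (y - x)) has_derivative frechet_derivative f (at (y - x))) (at y)"
    if "f differentiable (at (y - x))" for f and y
  proof -
    have "((\<lambda>y. y - x) has_derivative (\<lambda>h. h)) (at y)" by (auto intro!: derivative_eq_intros)
    moreover have "(f has_derivative frechet_derivative f (at (y - x))) (at (y - x))"
      using that frechet_derivative_works by blast
    ultimately show ?thesis using has_derivative_compose by fastforce
  qed
  then have fd: "frechet_derivative (\<lambda>y. f (y - x)) (at y) = frechet_derivative f (at (y - x))"
    if "f differentiable (at (y - x))" for f and y
    using that by (intro frechet_derivative_at') auto
  then show "f differentiable (at (y - x)) \<Longrightarrow> frechet_derivative (\<lambda>y. f (y - x)) (at y) = frechet_derivative f (at (y - x))" .
  show "times_differentiable k f \<Longrightarrow> times_differentiable k (\<lambda>y. f (y - x))"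
  proof (induction k arbitrary: f)
    case 0
    then show ?case by (auto intro!: continuous_on_compose2[of UNIV f] continuous_intros)
  next
    case (Suc k)
    then have d: "\<And>x. f differentiable (at x)" by auto
    have "times_differentiable k (\<lambda>xa. frechet_derivative f (at (xa - x)) v)" for v
      using Suc.prems by (intro Suc.IH[of "\<lambda>x. frechet_derivative f (at x) v"]) auto
    then show ?case using hd[OF d] by (auto simp: fd[OF d] differentiable_def)
  qed
qed

text \<open>\<open>g\<close> is a whole sequence of successive derivatives, and the induction is
  over all of its members at once, since differentiating moves from \<open>g n\<close> to
  \<open>g (Suc n)\<close>.\<close>

lemma times_differentiable_compose_coordinate:
  fixes g :: "nat \<Rightarrow> real \<Rightarrow> real"
  assumes "\<And>n t. (g n has_real_derivative g (Suc n) t) (at t)"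
  shows "times_differentiable k (\<lambda>x. g n (a * x $ i + b))"
proof (induction k arbitrary: n)
  case 0
  have "continuous_on UNIV (g n)"
    using DERIV_isCont[OF assms] by (auto intro!: continuous_at_imp_continuous_on)
  then show ?case by (auto intro!: continuous_on_compose2[of UNIV "g n"] continuous_intros)
next
  case (Suc k)
  have hd: "((\<lambda>x. g n (a * x $ i + b)) has_derivative (\<lambda>v. (a * v $ i) * g (Suc n) (a * x $ i + b))) (at x)" for x
  proof -
    have "((\<lambda>x. a * x $ i + b) has_derivative (\<lambda>v. a * v $ i)) (at x)"
      by (auto intro!: derivative_eq_intros bounded_linear_imp_has_derivative)
    from DERIV_compose_FDERIV[OF assms this] show ?thesis .
  qed
  then have "frechet_derivative (\<lambda>x. g n (a * x $ i + b)) (at x) = (\<lambda>v. (a * v $ i) * g (Suc n) (a * x $ i + b))" for x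
    by (rule frechet_derivative_at')
  then show ?case using hd Suc
    by (auto simp: differentiable_def intro!: times_differentiable_mult times_differentiable_const)
qed

lemma test_function_translate: "test_function \<phi> \<Longrightarrow> test_function (\<lambda>y. \<phi> (y - x))"
proof -
  assume t: "test_function \<phi>"
  have "{y. \<phi> (y - x) \<noteq> 0} = (+) x ` {y. \<phi> y \<noteq> 0}"
    by (auto simp: image_iff) (metis add_diff_cancel_left' diff_add_cancel add.commute)
  then have "closure {y. \<phi> (y - x) \<noteq> 0} = (+) x ` closure {y. \<phi> y \<noteq> 0}"
    by (simp add: closure_translation)
  then have "compact (closure {y. \<phi> (y - x) \<noteq> 0})"
    using t compact_translation unfolding test_function_def by metis
  then show ?thesis using t times_differentiable_translate(1)
    unfolding test_function_def by blast
qed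

lemma test_function_differentiable: "test_function \<phi> \<Longrightarrow> \<phi> differentiable (at x)"
  unfolding test_function_def by (metis times_differentiable.simps(2))

lemma test_function_continuous: "test_function \<phi> \<Longrightarrow> continuous_on UNIV \<phi>"
  unfolding test_function_def by (metis times_differentiable.simps(1))

lemma test_function_measurable: "test_function \<phi> \<Longrightarrow> \<phi> \<in> borel_measurable borel"
  by (rule borel_measurable_continuous_onI[OF test_function_continuous])

lemma partial_deriv_translate:
  "test_function \<phi> \<Longrightarrow> partial_deriv (\<lambda>y. \<phi> (y - x)) j y = partial_deriv \<phi> j (y - x)"
  unfolding partial_deriv_def by (simp add: times_differentiable_translate(2) test_function_differentiable)

text \<open>Off the closed support \<open>\<phi>\<close> vanishes on an open set, so the derivative
  vanishes there too and the support cannot grow.\<close>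

lemma test_function_partial_deriv:
  assumes "test_function \<phi>" shows "test_function (partial_deriv \<phi> j)"
proof -
  have "partial_deriv \<phi> j = (\<lambda>x. frechet_derivative \<phi> (at x) (axis j 1))"
    by (simp add: partial_deriv_def fun_eq_iff)
  then have "times_differentiable k (partial_deriv \<phi> j)" for k
    using assms unfolding test_function_def by (metis times_differentiable.simps(2))
  moreover have "compact (closure {x. partial_deriv \<phi> j x \<noteq> 0})"
  proof -
    have "{x. partial_deriv \<phi> j x \<noteq> 0} \<subseteq> closure {x. \<phi> x \<noteq> 0}"
    proof (rule subsetI, rule ccontr)
      fix x assume x: "x \<in> {x. partial_deriv \<phi> j x \<noteq> 0}" "x \<notin> closure {x. \<phi> x \<noteq> 0}"
      have "(\<phi> has_derivative (\<lambda>v. 0)) (at x)"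
      proof (rule has_derivative_transform_within_open[of "\<lambda>_. 0"])
        show "open (- closure {x. \<phi> x \<noteq> 0})" by auto
        show "0 = \<phi> y" if "y \<in> - closure {x. \<phi> x \<noteq> 0}" for y
          using that closure_subset[of "{x. \<phi> x \<noteq> 0}"] by auto
      qed (use x in auto)
      then have "partial_deriv \<phi> j x = 0" unfolding partial_deriv_def by (simp add: frechet_derivative_at')
      then show False using x by auto
    qed
    then have "closure {x. partial_deriv \<phi> j x \<noteq> 0} \<subseteq> closure {x. \<phi> x \<noteq> 0}"
      by (simp add: closure_minimal)
    then show ?thesis using assms unfolding test_function_def
      by (metis closed_closure compact_Int_closed inf.absorb_iff2)
  qed
  ultimately show ?thesis by (simp add: test_function_def)
qed

lemma has_derivative_imp_directional:
  fixes f :: "'a::real_normed_vector \<Rightarrow> 'b::real_normed_vector"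
  assumes "(f has_derivative f') (at (x + t *\<^sub>R e))"
  shows "((\<lambda>t. f (x + t *\<^sub>R e)) has_vector_derivative f' e) (at t)"
proof -
  have "((\<lambda>t. x + t *\<^sub>R e) has_derivative (\<lambda>h. h *\<^sub>R e)) (at t)"
    by (auto intro!: derivative_eq_intros)
  from has_derivative_compose[OF this assms] have "((\<lambda>t. f (x + t *\<^sub>R e)) has_derivative (\<lambda>h. f' (h *\<^sub>R e))) (at t)" .
  moreover have "(\<lambda>h. f' (h *\<^sub>R e)) = (\<lambda>h. h *\<^sub>R f' e)"
    using linear_cmul[OF has_derivative_linear[OF assms]] by auto
  ultimately show ?thesis by (simp add: has_vector_derivative_def)
qed

lemma test_function_directional:
  assumes "test_function \<phi>"
  shows "((\<lambda>t. \<phi> (x + t *\<^sub>R axis j 1)) has_vector_derivative partial_deriv \<phi> j (x + t *\<^sub>R axis j 1)) (at t)"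
  unfolding partial_deriv_def
  by (rule has_derivative_imp_directional) (use test_function_differentiable[OF assms] frechet_derivative_works in blast)

text \<open>The form in which compact support is used: a single integrable majorant.\<close>

lemma test_function_bounds:
  assumes "test_function \<phi>"
  obtains C R where "0 < C" "0 < R" "\<And>x. \<bar>\<phi> x\<bar> \<le> C * indicator (cball 0 R) x"
proof -
  let ?K = "closure {x. \<phi> x \<noteq> 0}"
  have K: "compact ?K" using assms by (simp add: test_function_def)
  obtain R where R: "0 < R" "?K \<subseteq> cball 0 R"
    using compact_imp_bounded[OF K] unfolding bounded_pos by (auto simp: subset_eq)
  have "bounded (\<phi> ` ?K)"
    using compact_continuous_image[OF continuous_on_subset[OF test_function_continuous[OF assms]] K] compact_imp_bounded by auto
  then obtain C where C: "0 < C" "\<And>x. x \<in> ?K \<Longrightarrow> \<bar>\<phi> x\<bar> \<le> C"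
    unfolding bounded_pos by auto
  show thesis
  proof (rule that[OF C(1) R(1)])
    fix x show "\<bar>\<phi> x\<bar> \<le> C * indicator (cball 0 R) x"
    proof (cases "\<phi> x = 0")
      case False
      then have "x \<in> ?K" using closure_subset[of "{x. \<phi> x \<noteq> 0}"] by auto
      then show ?thesis using C R by (auto simp: subset_eq)
    qed (use C in auto)
  qed
qed

lemma indicator_cball_integrable: "integrable lborel (indicator (cball (a::'a::euclidean_space) R) :: 'a \<Rightarrow> real)"
  using emeasure_lborel_cball_finite[of a R] by simp

lemma test_function_L2:
  assumes "test_function \<phi>"
  shows "L2 lborel \<phi>"
proof -
  obtain C R where "0 < C" "0 < R" and b: "\<And>x. \<bar>\<phi> x\<bar> \<le> C * indicator (cball 0 R) x"
    using test_function_bounds[OF assms] by blast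
  have "(\<lambda>x. (norm (indicator (cball (0::real^2) R) x :: real))\<^sup>2) = indicator (cball 0 R)"
    by (auto simp: indicator_def)
  then have "L2 lborel (indicator (cball (0::real^2) R) :: _ \<Rightarrow> real)"
    unfolding L2_def using indicator_cball_integrable[of "0::real^2" R] by simp
  then show ?thesis
    by (rule L2_bound[where C = C]) (use b test_function_measurable[OF assms] in auto)
qed

lemma test_function_integrable:
  assumes "test_function \<phi>"
  shows "integrable lborel \<phi>"
proof -
  obtain C R where "0 < C" "0 < R" and b: "\<And>x. \<bar>\<phi> x\<bar> \<le> C * indicator (cball 0 R) x"
    using test_function_bounds[OF assms] by blast
  have "integrable lborel (\<lambda>x. C * indicator (cball (0::real^2) R) x)"
    using indicator_cball_integrable[of "0::real^2" R] by simp
  then show ?thesis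
  proof (rule Bochner_Integration.integrable_bound)
    show "AE x in lborel. norm (\<phi> x) \<le> norm (C * indicator (cball 0 R) x)"
    proof (rule AE_I2)
      fix x show "norm (\<phi> x) \<le> norm (C * indicator (cball 0 R) x)"
        using b[of x] by simp
    qed
  qed (use test_function_measurable[OF assms] in simp)
qed

section \<open>A smooth mollifier\<close>

text \<open>For \<open>p = 1\<close> this is the classical flat function
  \<open>exp (- 1 / t)\<close>. Allowing any polynomial in \<open>1 / t\<close> as a factor gives a
  class closed under differentiation, so smoothness follows from one derivative formula.\<close>

definition poly_exp :: "real poly \<Rightarrow> real \<Rightarrow> real" where
  "poly_exp p t = (if 0 < t then poly p (1 / t) * exp (- (1 / t)) else 0)"

lemma poly_times_exp_tendsto_0: "((\<lambda>s::real. poly p s * exp (- s)) \<longlongrightarrow> 0) at_top"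
proof -
  have "((\<lambda>s::real. \<Sum>i\<le>degree p. coeff p i * (s ^ i / exp s)) \<longlongrightarrow> (\<Sum>i\<le>degree p. coeff p i * 0)) at_top"
    by (intro tendsto_intros tendsto_power_div_exp_0)
  then show ?thesis by (simp add: poly_altdef exp_minus sum_distrib_right divide_inverse mult.assoc)
qed

lemma poly_exp_has_derivative:
  "(poly_exp p has_real_derivative poly_exp ((p - pderiv p) * [:0, 0, 1:]) t) (at t)"
proof -
  consider "t > 0" | "t < 0" | "t = 0" by linarith
  then show ?thesis
  proof cases
    case 1
    have "((\<lambda>t. poly p (1 / t) * exp (- (1 / t))) has_real_derivative poly_exp ((p - pderiv p) * [:0, 0, 1:]) t) (at t)"
      using 1 by (auto intro!: derivative_eq_intros simp: poly_exp_def field_simps power2_eq_square)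
    then show ?thesis
      by (rule has_field_derivative_transform_within_open[where S = "{0<..}"]) (use 1 in \<open>auto simp: poly_exp_def\<close>)
  next
    case 2
    have "((\<lambda>t. 0) has_real_derivative poly_exp ((p - pderiv p) * [:0, 0, 1:]) t) (at t)"
      using 2 by (auto simp: poly_exp_def)
    then show ?thesis
      by (rule has_field_derivative_transform_within_open[where S = "{..<0}"]) (use 2 in \<open>auto simp: poly_exp_def\<close>)
  next
    case 3
    \<comment> \<open>At 0 the difference quotients vanish on the left, and on the right they equal
      \<open>s p(s) exp (- s)\<close> with \<open>s = 1 / h\<close>, where the exponential
      wins.\<close>
    have "((\<lambda>h. poly_exp p h / h) \<longlongrightarrow> 0) (at 0)"
    proof (rule filterlim_split_at)
      show "((\<lambda>h. poly_exp p h / h) \<longlongrightarrow> 0) (at_left 0)"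
        by (rule tendsto_eventually) (auto simp: eventually_at_filter poly_exp_def)
      have "((\<lambda>h. poly (p * [:0, 1:]) (inverse h) * exp (- inverse h)) \<longlongrightarrow> 0) (at_right (0::real))"
        by (rule filterlim_compose[OF poly_times_exp_tendsto_0 filterlim_inverse_at_top_right])
      moreover have "\<forall>\<^sub>F h in at_right 0. poly (p * [:0, 1:]) (inverse h) * exp (- inverse h) = poly_exp p h / h"
        by (auto simp: eventually_at_filter poly_exp_def field_simps)
      ultimately show "((\<lambda>h. poly_exp p h / h) \<longlongrightarrow> 0) (at_right 0)"
        by (rule Lim_transform_eventually)
    qed
    then show ?thesis using 3 by (simp add: DERIV_def poly_exp_def)
  qed
qed

definition bump :: "real \<Rightarrow> real \<Rightarrow> real" where
  "bump d t = poly_exp 1 (d - t) * poly_exp 1 (d + t)"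

definition bump' :: "real \<Rightarrow> real \<Rightarrow> real" where
  "bump' d t = poly_exp 1 (d - t) * poly_exp [:0, 0, 1:] (d + t) - poly_exp [:0, 0, 1:] (d - t) * poly_exp 1 (d + t)"

lemma bump_has_derivative: "(bump d has_real_derivative bump' d t) (at t)"
  unfolding bump_def[abs_def] bump'_def
  by (rule derivative_eq_intros DERIV_chain2[OF poly_exp_has_derivative] refl)+ (simp add: pderiv_1)

lemma bump_nonneg: "0 \<le> bump d t"
  by (simp add: bump_def poly_exp_def)

lemma bump_pos_iff: "0 < bump d t \<longleftrightarrow> \<bar>t\<bar> < d"
  by (auto simp: bump_def poly_exp_def)

text \<open>A product of one-variable bumps, not a radial function: smoothness, the partial
  derivatives and the symmetry of the second derivatives then reduce to one variable.\<close>

definition plane_bump :: "real \<Rightarrow> real^2 \<Rightarrow> real" where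
  "plane_bump d x = bump d (x $ 1) * bump d (x $ 2)"

lemma plane_bump_nonneg: "0 \<le> plane_bump d x"
  by (simp add: plane_bump_def bump_nonneg)

lemma plane_bump_support: "plane_bump d x \<noteq> 0 \<longleftrightarrow> \<bar>x $ 1\<bar> < d \<and> \<bar>x $ 2\<bar> < d"
  unfolding plane_bump_def using bump_pos_iff[of d "x $ 1"] bump_pos_iff[of d "x $ 2"] bump_nonneg[of d "x $ 1"] bump_nonneg[of d "x $ 2"]
  by (auto simp: less_le)

lemma norm_le_two_coordinates: "norm (x::real^2) \<le> \<bar>x $ 1\<bar> + \<bar>x $ 2\<bar>"
  using norm_le_l1_cart[of x] by (simp add: sum_2)

lemma times_differentiable_plane_bump: "times_differentiable k (plane_bump d)"
proof -
  \<comment> \<open>The operator \<open>p -> (p - p') s^2\<close> from the derivative formula,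
    iterated \<open>n\<close> times on 1, yields the \<open>n\<close>-th derivative of the flat
    function.\<close>
  define g where "g n = poly_exp (((\<lambda>p. (p - pderiv p) * [:0, 0, 1:]) ^^ n) 1)" for n
  have g: "(g n has_real_derivative g (Suc n) t) (at t)" for n t
    unfolding g_def using poly_exp_has_derivative by simp
  have "plane_bump d = (\<lambda>x. (g 0 ((-1) * x $ 1 + d) * g 0 (1 * x $ 1 + d)) * (g 0 ((-1) * x $ 2 + d) * g 0 (1 * x $ 2 + d)))"
    by (simp add: plane_bump_def bump_def g_def add.commute fun_eq_iff)
  then show ?thesis
    by (simp only:) (intro times_differentiable_mult times_differentiable_compose_coordinate g)
qed

lemma test_function_plane_bump: "test_function (plane_bump d)"
proof -
  have "{x. plane_bump d x \<noteq> 0} \<subseteq> cball 0 (2 * d)"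
  proof
    fix x :: "real^2" assume "x \<in> {x. plane_bump d x \<noteq> 0}"
    then show "x \<in> cball 0 (2 * d)"
      using norm_le_two_coordinates[of x] by (simp add: plane_bump_support)
  qed
  then have "closure {x. plane_bump d x \<noteq> 0} \<subseteq> cball 0 (2 * d)" by (simp add: closure_minimal)
  then have "compact (closure {x. plane_bump d x \<noteq> 0})"
    by (metis closed_closure compact_Int_closed compact_cball inf.absorb_iff2)
  then show ?thesis using times_differentiable_plane_bump by (simp add: test_function_def)
qed

lemma coordinate_product_partial_deriv:
  assumes f: "\<And>t. (f has_real_derivative f' t) (at t)" and g: "\<And>t. (g has_real_derivative g' t) (at t)"
  shows "partial_deriv (\<lambda>x. f (x $ 1) * g (x $ 2)) 1 = (\<lambda>x. f' (x $ 1) * g (x $ 2))"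
    and "partial_deriv (\<lambda>x. f (x $ 1) * g (x $ 2)) 2 = (\<lambda>x. f (x $ 1) * g' (x $ 2))"
proof -
  have c: "((\<lambda>x::real^2. x $ i) has_derivative (\<lambda>v. v $ i)) (at x)" for i x
    by (rule bounded_linear_imp_has_derivative) (rule bounded_linear_vec_nth)
  have "((\<lambda>x. f (x $ 1) * g (x $ 2)) has_derivative
      (\<lambda>v. f (x $ 1) * (v $ 2 * g' (x $ 2)) + (v $ 1 * f' (x $ 1)) * g (x $ 2))) (at x)" for x :: "real^2"
    by (intro has_derivative_mult DERIV_compose_FDERIV[OF f c] DERIV_compose_FDERIV[OF g c])
  then have fd: "frechet_derivative (\<lambda>x. f (x $ 1) * g (x $ 2)) (at x) =
      (\<lambda>v. f (x $ 1) * (v $ 2 * g' (x $ 2)) + (v $ 1 * f' (x $ 1)) * g (x $ 2))" for x :: "real^2"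
    by (rule frechet_derivative_at')
  show "partial_deriv (\<lambda>x. f (x $ 1) * g (x $ 2)) 1 = (\<lambda>x. f' (x $ 1) * g (x $ 2))"
    "partial_deriv (\<lambda>x. f (x $ 1) * g (x $ 2)) 2 = (\<lambda>x. f (x $ 1) * g' (x $ 2))"
    by (simp_all add: partial_deriv_def fd fun_eq_iff axis_def)
qed

text \<open>If the integral were 0, the zero set would be closed and of full measure, hence the
  whole plane, yet the bump is positive at the origin.\<close>

lemma plane_bump_integral_pos:
  assumes "0 < d" shows "0 < (LINT x|lborel. plane_bump d x)"
proof -
  have "(LINT x|lborel. plane_bump d x) \<noteq> 0"
  proof
    assume "(LINT x|lborel. plane_bump d x) = 0"
    then have "AE x in lborel. plane_bump d x = 0"
      using integral_nonneg_eq_0_iff_AE[OF test_function_integrable[OF test_function_plane_bump]] plane_bump_nonneg by auto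
    then have "AE x in lebesgue. x \<in> {x. plane_bump d x = 0}"
      by (auto intro: AE_completion)
    moreover have "closed {x. plane_bump d x = 0}"
      by (rule closed_Collect_eq) (auto intro: test_function_continuous test_function_plane_bump)
    ultimately have "(0::real^2) \<in> {x. plane_bump d x = 0}" using mem_closed_if_AE_lebesgue by blast
    then show False using plane_bump_support[of d 0] assms by auto
  qed
  moreover have "0 \<le> (LINT x|lborel. plane_bump d x)" by (simp add: plane_bump_nonneg)
  ultimately show ?thesis by simp
qed

definition mollifier :: "nat \<Rightarrow> real^2 \<Rightarrow> real" where
  "mollifier n x = plane_bump (1 / (Suc n)) x / (LINT x|lborel. plane_bump (1 / (Suc n)) x)"

lemma test_function_scale: assumes "test_function \<phi>" shows "test_function (\<lambda>x. c * \<phi> x)"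
proof -
  have "closure {x. c * \<phi> x \<noteq> 0} \<subseteq> closure {x. \<phi> x \<noteq> 0}" by (intro closure_mono) auto
  then have "compact (closure {x. c * \<phi> x \<noteq> 0})"
    using assms unfolding test_function_def by (metis closed_closure compact_Int_closed inf.absorb_iff2)
  then show ?thesis using assms by (auto simp: test_function_def intro!: times_differentiable_mult times_differentiable_const)
qed

lemma test_function_mollifier: "test_function (mollifier n)"
  using test_function_scale[OF test_function_plane_bump, of "1 / (LINT x|lborel. plane_bump (1 / (Suc n)) x)" "1 / Suc n"]
  unfolding mollifier_def[abs_def] by simp

lemma mollifier_nonneg: "0 \<le> mollifier n x"
  unfolding mollifier_def by (intro divide_nonneg_nonneg plane_bump_nonneg Bochner_Integration.integral_nonneg)

lemma mollifier_integral: "(LINT x|lborel. mollifier n x) = 1"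
  using plane_bump_integral_pos[of "1 / Suc n"] by (simp add: mollifier_def)

lemma mollifier_support: "mollifier n x \<noteq> 0 \<Longrightarrow> norm x \<le> 2 / Suc n"
  using norm_le_two_coordinates[of x] plane_bump_support[of "1 / Suc n" x] by (auto simp: mollifier_def)

text \<open>Symmetry of the second derivatives is what makes the Jacobian of an \<open>H1\<close>
  function a null Lagrangian; for a product of one-variable functions both orders give the product
  of the two derivatives.\<close>

lemma mollifier_mixed: "partial_deriv (partial_deriv (mollifier n) 1) 2 = partial_deriv (partial_deriv (mollifier n) 2) 1"
proof -
  let ?d = "1 / real (Suc n)"
  define c where "c = 1 / (LINT x|lborel. plane_bump ?d x)"
  have d: "((\<lambda>t. c * bump ?d t) has_real_derivative c * bump' ?d t) (at t)" for t
    by (intro DERIV_cmult bump_has_derivative)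
  have eq: "mollifier n = (\<lambda>x. (c * bump ?d (x $ 1)) * bump ?d (x $ 2))"
  proof
    fix x
    have "mollifier n x = c * plane_bump ?d x" by (simp add: mollifier_def c_def)
    then show "mollifier n x = (c * bump ?d (x $ 1)) * bump ?d (x $ 2)"
      by (simp only: plane_bump_def mult.assoc)
  qed
  have b': "bump' ?d differentiable (at t)" for t
  proof -
    have "\<exists>D. (bump' ?d has_real_derivative D) (at t)"
      unfolding bump'_def[abs_def]
      by (rule exI) (rule derivative_eq_intros DERIV_chain2[OF poly_exp_has_derivative] refl)+
    then show ?thesis by (auto simp: real_differentiable_def)
  qed
  then have b'd: "(bump' ?d has_real_derivative deriv (bump' ?d) t) (at t)" for t
    by (metis DERIV_deriv_iff_real_differentiable)
  have b'c: "((\<lambda>t. c * bump' ?d t) has_real_derivative c * deriv (bump' ?d) t) (at t)" for t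
    by (intro DERIV_cmult b'd)
  show ?thesis
    unfolding eq coordinate_product_partial_deriv[OF d bump_has_derivative]
    unfolding coordinate_product_partial_deriv[OF b'c bump_has_derivative] coordinate_product_partial_deriv[OF d b'd] ..
qed

section \<open>Mollification\<close>

lemma L2_translate:
  fixes f :: "'a::euclidean_space \<Rightarrow> 'b::euclidean_space"
  assumes "L2 lborel f"
  shows "L2 lborel (\<lambda>y. f (c + y))" "L2 lborel (\<lambda>y. f (y + c))" "L2 lborel (\<lambda>y. f (y - c))"
proof -
  have [measurable]: "f \<in> borel_measurable borel" using assms by (simp add: L2_def)
  have "L2 lborel (\<lambda>y. f (c + y))" for c
    using assms lborel_integrable_translate_iff[of "\<lambda>x. (norm (f x))\<^sup>2" c] by (simp add: L2_def)
  from this[of c] this[of "- c"] show "L2 lborel (\<lambda>y. f (c + y))" "L2 lborel (\<lambda>y. f (y + c))" "L2 lborel (\<lambda>y. f (y - c))"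
    by (simp_all add: add.commute)
qed

text \<open>Cauchy--Schwarz in \<open>z\<close> with the weight split as
  \<open>sqrt |\<eta>| * sqrt |\<eta>|\<close>, then Tonelli. A general \<open>w\<close> is allowed
  because the bound is applied both to translates \<open>u (x + z)\<close>, for the size of a
  correlation, and to differences \<open>u (x + z) - u x\<close>, for the mollification
  error.\<close>

lemma weighted_average_L2_bound:
  fixes \<eta> :: "'a::euclidean_space \<Rightarrow> real" and w :: "'a \<Rightarrow> 'a \<Rightarrow> 'b::euclidean_space"
  assumes [measurable]: "\<eta> \<in> borel_measurable borel" "case_prod w \<in> borel_measurable (borel \<Otimes>\<^sub>M borel)"
  shows "(\<integral>\<^sup>+x. ennreal ((norm (LINT z|lborel. \<eta> z *\<^sub>R w x z))\<^sup>2) \<partial>lborel)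
      \<le> (\<integral>\<^sup>+z. ennreal \<bar>\<eta> z\<bar> \<partial>lborel) * (\<integral>\<^sup>+z. ennreal \<bar>\<eta> z\<bar> * (\<integral>\<^sup>+x. ennreal ((norm (w x z))\<^sup>2) \<partial>lborel) \<partial>lborel)"
proof -
  have m[measurable]: "(\<lambda>x. w x z) \<in> borel_measurable borel" "w x \<in> borel_measurable borel" for x z
    using measurable_compose[OF measurable_Pair1' assms(2)] measurable_compose[OF measurable_Pair2' assms(2)] by auto
  have pt: "ennreal ((norm (LINT z|lborel. \<eta> z *\<^sub>R w x z))\<^sup>2) \<le>
      (\<integral>\<^sup>+z. ennreal \<bar>\<eta> z\<bar> \<partial>lborel) * (\<integral>\<^sup>+z. ennreal \<bar>\<eta> z\<bar> * ennreal ((norm (w x z))\<^sup>2) \<partial>lborel)" for x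
  proof -
    have "ennreal (norm (LINT z|lborel. \<eta> z *\<^sub>R w x z)) \<le> (\<integral>\<^sup>+z. norm (\<eta> z *\<^sub>R w x z) \<partial>lborel)"
    \<comment> \<open>If the integrand is not integrable, the Bochner integral is 0 and the bound is
      trivial.\<close>
    proof (cases "integrable lborel (\<lambda>z. \<eta> z *\<^sub>R w x z)")
      case True
      then show ?thesis by (rule integral_norm_bound_ennreal)
    qed (simp add: not_integrable_integral_eq)
    also have "\<dots> = (\<integral>\<^sup>+z. ennreal (sqrt \<bar>\<eta> z\<bar>) * ennreal (sqrt \<bar>\<eta> z\<bar> * norm (w x z)) \<partial>lborel)"
      by (intro nn_integral_cong) (simp add: ennreal_mult[symmetric] mult.assoc[symmetric])
    finally have "(ennreal (norm (LINT z|lborel. \<eta> z *\<^sub>R w x z)))\<^sup>2 \<le> \<dots>\<^sup>2" by (intro power_mono) auto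
    also have "\<dots> \<le> (\<integral>\<^sup>+z. (ennreal (sqrt \<bar>\<eta> z\<bar>))\<^sup>2 \<partial>lborel) * (\<integral>\<^sup>+z. (ennreal (sqrt \<bar>\<eta> z\<bar> * norm (w x z)))\<^sup>2 \<partial>lborel)"
      by (rule Cauchy_Schwarz_nn_integral) measurable
    also have "\<dots> = (\<integral>\<^sup>+z. ennreal \<bar>\<eta> z\<bar> \<partial>lborel) * (\<integral>\<^sup>+z. ennreal \<bar>\<eta> z\<bar> * ennreal ((norm (w x z))\<^sup>2) \<partial>lborel)"
      by (intro arg_cong2[where f = "(*)"] nn_integral_cong) (simp_all add: ennreal_power ennreal_mult[symmetric] power_mult_distrib)
    finally show ?thesis by (simp add: ennreal_power)
  qed
  have "(\<integral>\<^sup>+x. ennreal ((norm (LINT z|lborel. \<eta> z *\<^sub>R w x z))\<^sup>2) \<partial>lborel) \<le>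
      (\<integral>\<^sup>+x. (\<integral>\<^sup>+z. ennreal \<bar>\<eta> z\<bar> \<partial>lborel) * (\<integral>\<^sup>+z. ennreal \<bar>\<eta> z\<bar> * ennreal ((norm (w x z))\<^sup>2) \<partial>lborel) \<partial>lborel)"
    by (intro nn_integral_mono pt)
  also have "\<dots> = (\<integral>\<^sup>+z. ennreal \<bar>\<eta> z\<bar> \<partial>lborel) * (\<integral>\<^sup>+x. \<integral>\<^sup>+z. ennreal \<bar>\<eta> z\<bar> * ennreal ((norm (w x z))\<^sup>2) \<partial>lborel \<partial>lborel)"
    by (rule nn_integral_cmult) measurable
  also have "(\<integral>\<^sup>+x. \<integral>\<^sup>+z. ennreal \<bar>\<eta> z\<bar> * ennreal ((norm (w x z))\<^sup>2) \<partial>lborel \<partial>lborel) =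
      (\<integral>\<^sup>+z. \<integral>\<^sup>+x. ennreal \<bar>\<eta> z\<bar> * ennreal ((norm (w x z))\<^sup>2) \<partial>lborel \<partial>lborel)"
    by (rule lborel_pair.Fubini'[symmetric]) measurable
  also have "\<dots> = (\<integral>\<^sup>+z. ennreal \<bar>\<eta> z\<bar> * (\<integral>\<^sup>+x. ennreal ((norm (w x z))\<^sup>2) \<partial>lborel) \<partial>lborel)"
    by (intro nn_integral_cong nn_integral_cmult) measurable
  finally show ?thesis .
qed

text \<open>A correlation, not a convolution: a test function is then only translated, and the weak derivative
  passes onto it without a sign.\<close>

definition corr :: "(real^2 \<Rightarrow> real) \<Rightarrow> (real^2 \<Rightarrow> complex) \<Rightarrow> real^2 \<Rightarrow> complex" where
  "corr \<phi> u x = (LINT y|lborel. \<phi> (y - x) *\<^sub>R u y)"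

lemma corr_translate:
  assumes [measurable]: "\<phi> \<in> borel_measurable borel" "u \<in> borel_measurable borel"
  shows "corr \<phi> u x = (LINT z|lborel. \<phi> z *\<^sub>R u (x + z))"
  unfolding corr_def by (subst lborel_integral_translate[of _ x, symmetric]) auto

lemma L2_scaleR_integrable:
  fixes f :: "'a \<Rightarrow> real" and u :: "'a \<Rightarrow> 'b::euclidean_space"
  assumes f: "L2 M f" and u: "L2 M u"
  shows "integrable M (\<lambda>x. f x *\<^sub>R u x)"
proof (rule Bochner_Integration.integrable_bound[OF L2_norm_mult_integrable[OF f u]])
  show "(\<lambda>x. f x *\<^sub>R u x) \<in> borel_measurable M" using f u by (auto simp: L2_def)
qed auto

lemma corr_integrable:
  assumes "test_function \<phi>" and "L2 lborel u"
  shows "integrable lborel (\<lambda>y. \<phi> (y - x) *\<^sub>R u y)"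
  by (intro L2_scaleR_integrable L2_translate(3) test_function_L2 assms)

lemma L2_corr:
  assumes \<phi>: "test_function \<phi>" and u: "L2 lborel u" and m: "corr \<phi> u \<in> borel_measurable borel"
  shows "L2 lborel (corr \<phi> u)"
  unfolding L2_def
proof
  have [measurable]: "\<phi> \<in> borel_measurable borel" "u \<in> borel_measurable borel"
    using test_function_measurable[OF \<phi>] u by (auto simp: L2_def)
  note [measurable] = m
  show "corr \<phi> u \<in> borel_measurable lborel" by simp
  have n1: "(\<integral>\<^sup>+z. ennreal \<bar>\<phi> z\<bar> \<partial>lborel) < \<infinity>"
    using test_function_integrable[OF \<phi>] by (simp add: integrable_iff_bounded)
  have n2: "(\<integral>\<^sup>+x. ennreal ((norm (u x))\<^sup>2) \<partial>lborel) < \<infinity>"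
    using u by (simp add: L2_def integrable_iff_bounded)
  have tr: "(\<integral>\<^sup>+x. ennreal ((norm (u (x + z)))\<^sup>2) \<partial>lborel) = (\<integral>\<^sup>+x. ennreal ((norm (u x))\<^sup>2) \<partial>lborel)" for z
    using lborel_nn_integral_translate[of "\<lambda>x. ennreal ((norm (u x))\<^sup>2)" z] by (simp add: add.commute)
  have "(\<integral>\<^sup>+x. ennreal ((norm (corr \<phi> u x))\<^sup>2) \<partial>lborel) \<le> (\<integral>\<^sup>+z. ennreal \<bar>\<phi> z\<bar> \<partial>lborel) *
      (\<integral>\<^sup>+z. ennreal \<bar>\<phi> z\<bar> * (\<integral>\<^sup>+x. ennreal ((norm (u (x + z)))\<^sup>2) \<partial>lborel) \<partial>lborel)"
    by (subst corr_translate, simp, simp, rule weighted_average_L2_bound) measurable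
  also have "\<dots> = (\<integral>\<^sup>+z. ennreal \<bar>\<phi> z\<bar> \<partial>lborel) * ((\<integral>\<^sup>+z. ennreal \<bar>\<phi> z\<bar> \<partial>lborel) * (\<integral>\<^sup>+x. ennreal ((norm (u x))\<^sup>2) \<partial>lborel))"
    unfolding tr by (subst nn_integral_multc) auto
  also have "\<dots> < \<infinity>" using n1 n2 by (auto simp: ennreal_mult_less_top)
  finally show "integrable lborel (\<lambda>x. (norm (corr \<phi> u x))\<^sup>2)"
    by (simp add: integrable_iff_bounded)
qed

text \<open>Continuity and differentiability of correlations in \<open>x\<close> are both limits of
  this type: the weights converge pointwise, are bounded uniformly and live in a common
  ball.\<close>

lemma corr_dominated_limit:
  fixes q :: "nat \<Rightarrow> real^2 \<Rightarrow> real" and u :: "real^2 \<Rightarrow> complex"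
  assumes u: "L2 lborel u" and [measurable]: "\<And>n. q n \<in> borel_measurable borel" "q' \<in> borel_measurable borel"
    and lim: "\<And>y. (\<lambda>n. q n y) \<longlonglongrightarrow> q' y"
    and bd: "\<And>n y. \<bar>q n y\<bar> \<le> C * indicator (cball 0 R) y"
  shows "(\<lambda>n. LINT y|lborel. q n y *\<^sub>R u y) \<longlonglongrightarrow> (LINT y|lborel. q' y *\<^sub>R u y)"
proof (rule integral_dominated_convergence[where w = "\<lambda>y. norm (C * indicator (cball 0 R) y :: real) * norm (u y)"])
  have [measurable]: "u \<in> borel_measurable borel" using u by (auto simp: L2_def)
  have "(\<lambda>x::real^2. (C * indicat_real (cball 0 R) x)\<^sup>2) = (\<lambda>x. C\<^sup>2 * indicator (cball 0 R) x)"
    by (auto simp: indicator_def)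
  then have "integrable lborel (\<lambda>x::real^2. (C * indicat_real (cball 0 R) x)\<^sup>2)"
    using indicator_cball_integrable[of "0::real^2" R] by simp
  then have "L2 lborel (\<lambda>y. C * indicator (cball (0::real^2) R) y :: real)"
    unfolding L2_def real_norm_def power2_abs by (intro conjI) (measurable, simp)
  then show "integrable lborel (\<lambda>y. norm (C * indicator (cball 0 R) y :: real) * norm (u y))"
    using u by (rule L2_norm_mult_integrable)
  show "AE y in lborel. (\<lambda>n. q n y *\<^sub>R u y) \<longlonglongrightarrow> q' y *\<^sub>R u y"
    by (intro AE_I2 tendsto_intros lim)
  show "AE y in lborel. norm (q n y *\<^sub>R u y) \<le> norm (C * indicator (cball 0 R) y :: real) * norm (u y)" for n
  proof (rule AE_I2)
    fix y show "norm (q n y *\<^sub>R u y) \<le> norm (C * indicator (cball 0 R) y :: real) * norm (u y)"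
      using bd[of n y] by (auto intro!: mult_right_mono)
  qed
qed (use u in \<open>auto simp: L2_def\<close>)

lemma corr_continuous:
  assumes \<phi>: "test_function \<phi>" and u: "L2 lborel u"
  shows "continuous_on UNIV (corr \<phi> u)"
proof (rule continuous_on_sequentiallyI)
  fix x :: "nat \<Rightarrow> real^2" and a :: "real^2" assume x: "x \<longlonglongrightarrow> a"
  note [measurable] = test_function_measurable[OF \<phi>]
  obtain C R where CR: "0 < C" "0 < R" "\<And>x. \<bar>\<phi> x\<bar> \<le> C * indicator (cball 0 R) x"
    using test_function_bounds[OF \<phi>] by blast
  obtain B where B: "\<And>n. norm (x n) \<le> B"
    using convergent_imp_Bseq[OF convergentI[OF x]] by (auto simp: Bseq_def)
  show "(\<lambda>n. corr \<phi> u (x n)) \<longlonglongrightarrow> corr \<phi> u a"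
    unfolding corr_def
  proof (rule corr_dominated_limit[OF u, where C = C and R = "R + B"])
    show "(\<lambda>n. \<phi> (y - x n)) \<longlonglongrightarrow> \<phi> (y - a)" for y
      using test_function_continuous[OF \<phi>]
      by (intro isCont_tendsto_compose[of _ \<phi>] tendsto_intros x) (auto simp: continuous_on_eq_continuous_at)
    show "\<bar>\<phi> (y - x n)\<bar> \<le> C * indicator (cball 0 (R + B)) y" for n y
    proof -
      have "norm y \<le> R + B" if "norm (y - x n) \<le> R"
        using norm_triangle_sub[of y "x n"] that B[of n] by simp
      then show ?thesis using CR(1) CR(3)[of "y - x n"] by (auto split: split_indicator_asm split_indicator)
    qed
  qed measurable
qed

lemma corr_measurable:
  assumes "test_function \<phi>" and "L2 lborel u"
  shows "corr \<phi> u \<in> borel_measurable borel"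
  by (intro borel_measurable_continuous_onI corr_continuous assms)

lemma test_function_lipschitz_direction:
  assumes \<phi>: "test_function \<phi>" and C: "\<And>x. \<bar>partial_deriv \<phi> j x\<bar> \<le> C"
  shows "\<bar>\<phi> (x + t *\<^sub>R axis j 1) - \<phi> x\<bar> \<le> C * \<bar>t\<bar>"
proof -
  have "norm ((\<lambda>t. \<phi> (x + t *\<^sub>R axis j 1)) t - (\<lambda>t. \<phi> (x + t *\<^sub>R axis j 1)) 0) \<le> C * norm (t - 0)"
  proof (rule field_differentiable_bound[of UNIV])
    show "((\<lambda>t. \<phi> (x + t *\<^sub>R axis j 1)) has_field_derivative partial_deriv \<phi> j (x + t *\<^sub>R axis j 1)) (at t within UNIV)" for t
      using test_function_directional[OF \<phi>] by (simp add: has_real_derivative_iff_has_vector_derivative)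
  qed (use C in auto)
  then show ?thesis by simp
qed

text \<open>Tests differentiability on sequences only, which is the form in which dominated
  convergence delivers limits.\<close>

lemma has_vector_derivative_sequentially:
  fixes h :: "real \<Rightarrow> 'a::real_normed_vector"
  assumes "\<And>s. s \<longlonglongrightarrow> 0 \<Longrightarrow> (\<And>n. s n \<noteq> 0) \<Longrightarrow> (\<lambda>n. (h (t + s n) - h t) /\<^sub>R s n) \<longlonglongrightarrow> D"
  shows "(h has_vector_derivative D) (at t)"
proof -
  have "(\<lambda>s. (h (t + s) - h t) /\<^sub>R s) \<midarrow>0\<rightarrow> D"
    unfolding tendsto_at_iff_sequentially using assms by (auto simp: o_def)
  then have l: "(\<lambda>s. norm ((h (t + s) - h t) /\<^sub>R s - D)) \<midarrow>0\<rightarrow> 0"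
    by (intro tendsto_norm_zero LIM_zero)
  have "(\<lambda>s. norm (h (t + s) - h t - s *\<^sub>R D) / norm s) \<midarrow>0\<rightarrow> 0"
  proof (rule Lim_transform_eventually[OF l])
    show "\<forall>\<^sub>F s in at 0. norm ((h (t + s) - h t) /\<^sub>R s - D) = norm (h (t + s) - h t - s *\<^sub>R D) / norm s"
      unfolding eventually_at_filter
    proof (intro always_eventually allI impI)
      fix s :: real assume "s \<noteq> 0"
      then have "(h (t + s) - h t) /\<^sub>R s - D = (h (t + s) - h t - s *\<^sub>R D) /\<^sub>R s" by (simp add: algebra_simps)
      then show "norm ((h (t + s) - h t) /\<^sub>R s - D) = norm (h (t + s) - h t - s *\<^sub>R D) / norm s"
        by (simp add: divide_inverse_commute)
    qed
  qed
  then show ?thesis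
    unfolding has_vector_derivative_def has_derivative_at by (auto simp: bounded_linear_scaleR_left)
qed

text \<open>The minus sign arises because \<open>x\<close> enters the weight as
  \<open>\<phi> (y - x)\<close>. The difference quotients of \<open>\<phi>\<close> are bounded by a
  bound of its derivative, and their supports stay in one ball because \<open>s\<close> is
  bounded.\<close>

lemma corr_directional:
  assumes \<phi>: "test_function \<phi>" and u: "L2 lborel u"
  shows "((\<lambda>t. corr \<phi> u (x + t *\<^sub>R axis j 1)) has_vector_derivative - corr (partial_deriv \<phi> j) u (x + t *\<^sub>R axis j 1)) (at t)"
proof (rule has_vector_derivative_sequentially)
  fix s :: "nat \<Rightarrow> real" assume s: "s \<longlonglongrightarrow> 0" "\<And>n. s n \<noteq> 0"
  let ?e = "axis j 1 :: real^2"
  define a where "a = x + t *\<^sub>R ?e"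
  note \<phi>' = test_function_partial_deriv[OF \<phi>, of j]
  note [measurable] = test_function_measurable[OF \<phi>] test_function_measurable[OF \<phi>']
  have [measurable]: "u \<in> borel_measurable borel" using u by (auto simp: L2_def)
  obtain C R where CR: "0 < C" "0 < R" "\<And>x. \<bar>\<phi> x\<bar> \<le> C * indicator (cball 0 R) x"
    using test_function_bounds[OF \<phi>] by blast
  obtain C' R' where CR': "0 < C'" "0 < R'" "\<And>x. \<bar>partial_deriv \<phi> j x\<bar> \<le> C' * indicator (cball 0 R') x"
    using test_function_bounds[OF \<phi>'] by blast
  have C': "\<bar>partial_deriv \<phi> j x\<bar> \<le> C'" for x
    using CR'(3)[of x] CR'(1) by (auto split: split_indicator_asm)
  obtain B where B: "0 < B" "\<And>n. \<bar>s n\<bar> \<le> B"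
    using convergent_imp_Bseq[OF convergentI[OF s(1)]] by (auto simp: Bseq_def)
  have "(\<lambda>n. LINT y|lborel. ((\<phi> (y - (a + s n *\<^sub>R ?e)) - \<phi> (y - a)) / s n) *\<^sub>R u y) \<longlonglongrightarrow>
      (LINT y|lborel. (- partial_deriv \<phi> j (y - a)) *\<^sub>R u y)"
  \<comment> \<open>This radius covers the supports of \<open>\<phi> (y - a)\<close> and of all the
    shifted copies at once, as \<open>|s n| \<le> B\<close>.\<close>
  proof (rule corr_dominated_limit[OF u, where C = C' and R = "R + norm a + B"])
    fix y
    have "((\<lambda>t. \<phi> ((y - a) + t *\<^sub>R ?e)) has_real_derivative partial_deriv \<phi> j ((y - a) + 0 *\<^sub>R ?e)) (at 0)"
      unfolding has_real_derivative_iff_has_vector_derivative by (rule test_function_directional[OF \<phi>])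
    then have "((\<lambda>h. (\<phi> ((y - a) + h *\<^sub>R ?e) - \<phi> (y - a)) / h) \<longlongrightarrow> partial_deriv \<phi> j (y - a)) (at 0)"
      by (simp add: DERIV_def)
    moreover have "(\<lambda>n. - s n) \<longlonglongrightarrow> 0" using tendsto_minus[OF s(1)] by simp
    ultimately have "((\<lambda>n. (\<phi> ((y - a) + (- s n) *\<^sub>R ?e) - \<phi> (y - a)) / (- s n)) \<longlonglongrightarrow> partial_deriv \<phi> j (y - a))"
      using s(2) unfolding tendsto_at_iff_sequentially o_def by (elim allE[of _ "\<lambda>n. - s n"]) auto
    from tendsto_minus[OF this] show "(\<lambda>n. (\<phi> (y - (a + s n *\<^sub>R ?e)) - \<phi> (y - a)) / s n) \<longlonglongrightarrow> - partial_deriv \<phi> j (y - a)"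
      by (simp add: diff_diff_eq)
  next
    fix n y
    show "\<bar>(\<phi> (y - (a + s n *\<^sub>R ?e)) - \<phi> (y - a)) / s n\<bar> \<le> C' * indicator (cball 0 (R + norm a + B)) y"
    proof (cases "norm y \<le> R + norm a + B")
      case True
      have "\<bar>\<phi> ((y - a) + (- s n) *\<^sub>R ?e) - \<phi> (y - a)\<bar> \<le> C' * \<bar>- s n\<bar>"
        by (rule test_function_lipschitz_direction[OF \<phi> C'])
      then have "\<bar>\<phi> (y - (a + s n *\<^sub>R ?e)) - \<phi> (y - a)\<bar> \<le> C' * \<bar>s n\<bar>"
        by (simp add: diff_diff_eq)
      then show ?thesis using True s(2)[of n] by (simp add: divide_le_eq)
    next
      case False
      have ne: "norm (s n *\<^sub>R ?e) \<le> B" using B(2)[of n] by simp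
      have "\<not> norm (y - a) \<le> R" using False norm_triangle_sub[of y a] B(1) by auto
      moreover have "\<not> norm (y - (a + s n *\<^sub>R ?e)) \<le> R"
        using False norm_triangle_sub[of y "a + s n *\<^sub>R ?e"] norm_triangle_ineq[of a "s n *\<^sub>R ?e"] ne by linarith
      ultimately have "\<phi> (y - a) = 0" "\<phi> (y - (a + s n *\<^sub>R ?e)) = 0"
        using CR(3)[of "y - a"] CR(3)[of "y - (a + s n *\<^sub>R ?e)"] by auto
      then show ?thesis using CR' by simp
    qed
  qed measurable
  moreover have "(LINT y|lborel. ((\<phi> (y - (a + s n *\<^sub>R ?e)) - \<phi> (y - a)) / s n) *\<^sub>R u y) =
      (corr \<phi> u (a + s n *\<^sub>R ?e) - corr \<phi> u a) /\<^sub>R s n" for n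
  proof -
    have "(LINT y|lborel. ((\<phi> (y - (a + s n *\<^sub>R ?e)) - \<phi> (y - a)) / s n) *\<^sub>R u y) =
      (LINT y|lborel. inverse (s n) *\<^sub>R (\<phi> (y - (a + s n *\<^sub>R ?e)) *\<^sub>R u y - \<phi> (y - a) *\<^sub>R u y))"
      by (intro Bochner_Integration.integral_cong) (auto simp: algebra_simps divide_inverse)
    also have "\<dots> = inverse (s n) *\<^sub>R (LINT y|lborel. \<phi> (y - (a + s n *\<^sub>R ?e)) *\<^sub>R u y - \<phi> (y - a) *\<^sub>R u y)"
      by simp
    also have "\<dots> = (corr \<phi> u (a + s n *\<^sub>R ?e) - corr \<phi> u a) /\<^sub>R s n"
      unfolding corr_def by (subst Bochner_Integration.integral_diff[OF corr_integrable[OF \<phi> u] corr_integrable[OF \<phi> u]]) simp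
    finally show ?thesis .
  qed
  ultimately have "(\<lambda>n. (corr \<phi> u (a + s n *\<^sub>R ?e) - corr \<phi> u a) /\<^sub>R s n) \<longlonglongrightarrow> - corr (partial_deriv \<phi> j) u a"
    unfolding corr_def by simp
  moreover have "x + (t + s n) *\<^sub>R ?e = a + s n *\<^sub>R ?e" for n
    by (simp add: a_def scaleR_add_left)
  ultimately show "(\<lambda>n. (corr \<phi> u (x + (t + s n) *\<^sub>R ?e) - corr \<phi> u (x + t *\<^sub>R ?e)) /\<^sub>R s n) \<longlonglongrightarrow> - corr (partial_deriv \<phi> j) u (x + t *\<^sub>R ?e)"
    by (simp only: a_def[symmetric])
qed

text \<open>Since the mollifier has integral 1, the error at \<open>x\<close> is the weighted mean
  of \<open>u (x + z) - u x\<close>. Its squared \<open>L2\<close> norm is at most the weighted mean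
  of \<open>T z\<close>, which is small because the weights sit near 0 and translations are
  continuous in \<open>L2\<close>.\<close>

lemma mollifier_L2_tendsto:
  assumes u: "L2 lborel u"
  shows "L2_tendsto lborel (\<lambda>n. corr (mollifier n) u) u"
  unfolding L2_tendsto_def
proof (intro conjI allI u)
  show l: "L2 lborel (corr (mollifier n) u)" for n
    by (intro L2_corr corr_measurable test_function_mollifier u)
  have [measurable]: "u \<in> borel_measurable borel" using u by (auto simp: L2_def)
  note [measurable] = test_function_measurable[OF test_function_mollifier] corr_measurable[OF test_function_mollifier u]
  define T where "T z = (LINT x|lborel. (norm (u (x + z) - u x))\<^sup>2)" for z
  have T0: "0 \<le> T z" for z unfolding T_def by simp
  have Tn: "(\<integral>\<^sup>+x. ennreal ((norm (u (x + z) - u x))\<^sup>2) \<partial>lborel) = ennreal (T z)" for z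
    unfolding T_def using L2_diff[OF L2_translate(2)[OF u] u, of z] by (intro nn_integral_eq_integral) (auto simp: L2_def)
  have Tlim: "(T \<longlongrightarrow> 0) (at 0)"
    unfolding tendsto_at_iff_sequentially o_def T_def
    using translation_continuous_L2[of u] u by (auto simp: L2_def add.commute)
  have nm: "(\<integral>\<^sup>+z. ennreal \<bar>mollifier n z\<bar> \<partial>lborel) = 1" for n
    using nn_integral_eq_integral[OF test_function_integrable[OF test_function_mollifier, of n]] mollifier_nonneg
    by (simp add: mollifier_integral)
  show "(\<lambda>n. LINT x|lborel. (norm (corr (mollifier n) u x - u x))\<^sup>2) \<longlonglongrightarrow> 0"
  proof (rule LIMSEQ_I)
    fix e :: real assume e: "0 < e"
    then have "\<forall>\<^sub>F z in at 0. T z < e / 2" using order_tendstoD(2)[OF Tlim, of "e / 2"] by simp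
    then obtain d where d: "0 < d" "\<And>z. z \<noteq> 0 \<Longrightarrow> norm z < d \<Longrightarrow> T z < e / 2"
      by (auto simp: eventually_at dist_norm)
    have d': "T z \<le> e / 2" if "norm z < d" for z
    proof (cases "z = 0")
      case True then show ?thesis using e by (simp add: T_def)
    qed (use d that in force)
    \<comment> \<open>The mollifier lives in the ball of radius \<open>2 / Suc n\<close>, so from
      \<open>N\<close> on only points with \<open>norm z < d\<close> carry weight.\<close>
    obtain N where N: "2 / d < real N" using reals_Archimedean2 by blast
    show "\<exists>no. \<forall>n\<ge>no. norm ((LINT x|lborel. (norm (corr (mollifier n) u x - u x))\<^sup>2) - 0) < e"
    proof (intro exI allI impI)
      fix n assume "N \<le> n"
      then have "2 / d < real (Suc n)" using N by linarith
      then have small: "2 / real (Suc n) < d" using d(1) by (simp add: field_simps)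
      have eq: "corr (mollifier n) u x - u x = (LINT z|lborel. mollifier n z *\<^sub>R (u (x + z) - u x))" for x
      proof -
        have i: "integrable lborel (\<lambda>z. mollifier n z *\<^sub>R u (x + z))"
          by (intro L2_scaleR_integrable test_function_L2 test_function_mollifier L2_translate u)
        have i2: "integrable lborel (\<lambda>z. mollifier n z *\<^sub>R u x)"
          using test_function_integrable[OF test_function_mollifier] by simp
        have "(LINT z|lborel. mollifier n z *\<^sub>R (u (x + z) - u x)) =
            (LINT z|lborel. mollifier n z *\<^sub>R u (x + z)) - (LINT z|lborel. mollifier n z *\<^sub>R u x)"
          unfolding scaleR_diff_right by (rule Bochner_Integration.integral_diff[OF i i2])
        also have "(LINT z|lborel. mollifier n z *\<^sub>R u x) = u x"
          using test_function_integrable[OF test_function_mollifier, of n] by (simp add: mollifier_integral)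
        finally show ?thesis by (subst corr_translate) auto
      qed
      have "ennreal (LINT x|lborel. (norm (corr (mollifier n) u x - u x))\<^sup>2) =
          (\<integral>\<^sup>+x. ennreal ((norm (corr (mollifier n) u x - u x))\<^sup>2) \<partial>lborel)"
        using L2_diff[OF l u] by (intro nn_integral_eq_integral[symmetric]) (auto simp: L2_def)
      also have "\<dots> \<le> (\<integral>\<^sup>+z. ennreal \<bar>mollifier n z\<bar> \<partial>lborel) *
          (\<integral>\<^sup>+z. ennreal \<bar>mollifier n z\<bar> * (\<integral>\<^sup>+x. ennreal ((norm (u (x + z) - u x))\<^sup>2) \<partial>lborel) \<partial>lborel)"
        unfolding eq by (rule weighted_average_L2_bound) measurable
      also have "\<dots> = (\<integral>\<^sup>+z. ennreal \<bar>mollifier n z\<bar> * ennreal (T z) \<partial>lborel)"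
        by (simp add: nm Tn)
      also have "\<dots> \<le> (\<integral>\<^sup>+z. ennreal \<bar>mollifier n z\<bar> * ennreal (e / 2) \<partial>lborel)"
      proof (rule nn_integral_mono)
        fix z
        show "ennreal \<bar>mollifier n z\<bar> * ennreal (T z) \<le> ennreal \<bar>mollifier n z\<bar> * ennreal (e / 2)"
          using mollifier_support[of n z] d'[of z] small
          by (cases "mollifier n z = 0") (auto intro!: mult_left_mono ennreal_leI)
      qed
      also have "\<dots> = ennreal (e / 2)" by (subst nn_integral_multc) (auto simp: nm)
      finally have "(LINT x|lborel. (norm (corr (mollifier n) u x - u x))\<^sup>2) \<le> e / 2"
        using e by (simp add: ennreal_le_iff)
      then show "norm ((LINT x|lborel. (norm (corr (mollifier n) u x - u x))\<^sup>2) - 0) < e"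
        using e by simp
    qed
  qed
qed

text \<open>One direction at a time, with Borel functions and square integrability built in; the
  passage from Lebesgue measurable functions and from the chosen \<open>weak_gradient\<close> is
  postponed to the choice of representatives.\<close>

definition weak_deriv :: "2 \<Rightarrow> (real^2 \<Rightarrow> complex) \<Rightarrow> (real^2 \<Rightarrow> complex) \<Rightarrow> bool" where
  "weak_deriv j u g \<longleftrightarrow> L2 lborel u \<and> L2 lborel g \<and>
     (\<forall>\<phi>. test_function \<phi> \<longrightarrow>
        (LINT x|lborel. partial_deriv \<phi> j x *\<^sub>R u x) = - (LINT x|lborel. \<phi> x *\<^sub>R g x))"

lemma corr_weak_deriv:
  assumes "weak_deriv j u g" "test_function \<phi>"
  shows "corr (partial_deriv \<phi> j) u x = - corr \<phi> g x"
proof -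
  have "(LINT y|lborel. partial_deriv (\<lambda>y. \<phi> (y - x)) j y *\<^sub>R u y) = - (LINT y|lborel. \<phi> (y - x) *\<^sub>R g y)"
    using assms test_function_translate unfolding weak_deriv_def by blast
  then show ?thesis by (simp add: corr_def partial_deriv_translate assms(2))
qed

lemma corr_directional_weak:
  assumes w: "weak_deriv j u g" and \<phi>: "test_function \<phi>"
  shows "((\<lambda>t. corr \<phi> u (x + t *\<^sub>R axis j 1)) has_vector_derivative corr \<phi> g (x + t *\<^sub>R axis j 1)) (at t)"
  using corr_directional[OF \<phi>, of u x j t] w corr_weak_deriv[OF w \<phi>] by (simp add: weak_deriv_def)

text \<open>The mollified difference \<open>g - h\<close> is 0 at every point, because both
  mollified derivatives come from the same mollified \<open>u\<close>; but it converges to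
  \<open>g - h\<close> in \<open>L2\<close>.\<close>

lemma weak_deriv_unique:
  assumes g: "weak_deriv j u g" and h: "weak_deriv j u h"
  shows "AE x in lborel. g x = h x"
proof -
  have l: "L2 lborel g" "L2 lborel h" using g h by (auto simp: weak_deriv_def)
  note d = L2_diff[OF l]
  have "corr (mollifier n) (\<lambda>x. g x - h x) x = 0" for n x
  proof -
    have "corr (mollifier n) (\<lambda>x. g x - h x) x = corr (mollifier n) g x - corr (mollifier n) h x"
      unfolding corr_def scaleR_diff_right
      by (intro Bochner_Integration.integral_diff corr_integrable test_function_mollifier l)
    also have "\<dots> = 0"
      using corr_weak_deriv[OF g test_function_mollifier, of n x] corr_weak_deriv[OF h test_function_mollifier, of n x] by simp
    finally show ?thesis .
  qed
  then have "(\<lambda>n::nat. LINT x|lborel. (norm (g x - h x))\<^sup>2) \<longlonglongrightarrow> 0"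
    using mollifier_L2_tendsto[OF d] by (simp add: L2_tendsto_def norm_minus_commute)
  then have "(LINT x|lborel. (norm (g x - h x))\<^sup>2) = 0" by (simp add: LIMSEQ_const_iff)
  then have "AE x in lborel. (norm (g x - h x))\<^sup>2 = 0"
    using integral_nonneg_eq_0_iff_AE[of lborel "\<lambda>x. (norm (g x - h x))\<^sup>2"] d by (auto simp: L2_def)
  then show ?thesis by auto
qed

section \<open>Calculus of weak derivatives\<close>

lemma weak_deriv_L2: "weak_deriv j u g \<Longrightarrow> L2 lborel u" "weak_deriv j u g \<Longrightarrow> L2 lborel g"
  by (auto simp: weak_deriv_def)

lemma weak_derivD:
  "weak_deriv j u g \<Longrightarrow> test_function \<phi> \<Longrightarrow>
    (LINT x|lborel. partial_deriv \<phi> j x *\<^sub>R u x) = - (LINT x|lborel. \<phi> x *\<^sub>R g x)"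
  by (auto simp: weak_deriv_def)

lemma smooth_weak_deriv:
  assumes f: "L2 lborel f" and g: "L2 lborel g" and cf: "continuous_on UNIV f" and cont: "continuous_on UNIV g"
    and deriv: "\<And>x t. ((\<lambda>t. f (x + t *\<^sub>R axis j 1)) has_vector_derivative g (x + t *\<^sub>R axis j 1)) (at t)"
  shows "weak_deriv j f g"
  unfolding weak_deriv_def
proof (intro conjI allI impI f g)
  fix \<phi> assume \<phi>: "test_function \<phi>"
  note \<phi>' = test_function_partial_deriv[OF \<phi>, of j]
  have i1: "integrable lborel (\<lambda>x. partial_deriv \<phi> j x *\<^sub>R f x)" and i2: "integrable lborel (\<lambda>x. \<phi> x *\<^sub>R g x)"
    by (intro L2_scaleR_integrable test_function_L2 \<phi> \<phi>' f g)+
  have *: "(LINT x|lborel. partial_deriv \<phi> j x *\<^sub>R f x + \<phi> x *\<^sub>R g x) = 0"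
  proof (rule integral_directional_derivative_eq_0[where f = "\<lambda>x. \<phi> x *\<^sub>R f x" and e = "axis j 1"])
    show "integrable lborel (\<lambda>x. \<phi> x *\<^sub>R f x)"
      by (intro L2_scaleR_integrable test_function_L2 \<phi> f)
    show "integrable lborel (\<lambda>x. partial_deriv \<phi> j x *\<^sub>R f x + \<phi> x *\<^sub>R g x)"
      using i1 i2 by (rule Bochner_Integration.integrable_add)
    show "continuous_on UNIV (\<lambda>x. partial_deriv \<phi> j x *\<^sub>R f x + \<phi> x *\<^sub>R g x)"
      using \<phi> \<phi>' cf cont by (intro continuous_intros test_function_continuous)
    fix x t
    show "((\<lambda>t. \<phi> (x + t *\<^sub>R axis j 1) *\<^sub>R f (x + t *\<^sub>R axis j 1)) has_vector_derivative
        partial_deriv \<phi> j (x + t *\<^sub>R axis j 1) *\<^sub>R f (x + t *\<^sub>R axis j 1) + \<phi> (x + t *\<^sub>R axis j 1) *\<^sub>R g (x + t *\<^sub>R axis j 1)) (at t)"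
      using has_vector_derivative_scaleR[of "\<lambda>t. \<phi> (x + t *\<^sub>R axis j 1)" "partial_deriv \<phi> j (x + t *\<^sub>R axis j 1)" t UNIV, OF _ deriv[of x t]]
        test_function_directional[OF \<phi>, of x j t]
      by (simp add: has_real_derivative_iff_has_vector_derivative add.commute)
  qed
  show "(LINT x|lborel. partial_deriv \<phi> j x *\<^sub>R f x) = - (LINT x|lborel. \<phi> x *\<^sub>R g x)"
    using * i1 i2 by (simp add: eq_neg_iff_add_eq_0)
qed

lemma corr_mollifier_smooth:
  assumes w: "weak_deriv j u g"
  shows "L2_tendsto lborel (\<lambda>n. corr (mollifier n) u) u" "L2_tendsto lborel (\<lambda>n. corr (mollifier n) g) g"
    "continuous_on UNIV (corr (mollifier n) u)" "continuous_on UNIV (corr (mollifier n) g)"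
    "((\<lambda>t. corr (mollifier n) u (x + t *\<^sub>R axis j 1)) has_vector_derivative corr (mollifier n) g (x + t *\<^sub>R axis j 1)) (at t)"
    "L2 lborel (corr (mollifier n) u)" "L2 lborel (corr (mollifier n) g)"
  using weak_deriv_L2[OF w] mollifier_L2_tendsto corr_directional_weak[OF w test_function_mollifier]
  by (auto intro!: corr_continuous test_function_mollifier L2_corr corr_measurable)

lemma L2_scaleR_bounded:
  fixes f :: "'a \<Rightarrow> 'b::euclidean_space"
  assumes f: "L2 M f" and [measurable]: "\<psi> \<in> borel_measurable M" and le: "\<And>x. \<bar>\<psi> x\<bar> \<le> C"
  shows "L2 M (\<lambda>x. \<psi> x *\<^sub>R f x)"
  by (rule L2_bound[OF f, where C = C]) (use f le in \<open>auto simp: L2_def intro!: mult_right_mono\<close>)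

lemma borel_measurable_cnj[measurable (raw)]: "f \<in> borel_measurable M \<Longrightarrow> (\<lambda>x. cnj (f x)) \<in> borel_measurable M"
  by (rule borel_measurable_continuous_on[OF continuous_on_cnj[OF continuous_on_id]])

lemma L2_cnj: "L2 M f \<Longrightarrow> L2 M (\<lambda>x. cnj (f x))"
  by (rule L2_bound[of _ f _ 1]) (auto simp: L2_def)

lemma L2_tendsto_scaleR_cnj:
  assumes F: "L2_tendsto M F f" and [measurable]: "\<psi> \<in> borel_measurable M" and le: "\<And>x. \<bar>\<psi> x\<bar> \<le> C"
  shows "L2_tendsto M (\<lambda>n x. \<psi> x *\<^sub>R cnj (F n x)) (\<lambda>x. \<psi> x *\<^sub>R cnj (f x))"
proof (rule L2_tendsto_dominated[OF F, where C = C])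
  show "L2 M (\<lambda>x. \<psi> x *\<^sub>R cnj (F n x))" "L2 M (\<lambda>x. \<psi> x *\<^sub>R cnj (f x))" for n
    using F le by (auto intro!: L2_scaleR_bounded L2_cnj simp: L2_tendsto_def)
  show "norm (\<psi> x *\<^sub>R cnj (F n x) - \<psi> x *\<^sub>R cnj (f x)) \<le> C * norm (F n x - f x)" for n x
    using mult_right_mono[OF le norm_ge_zero, of x "F n x - f x"]
    by (simp flip: scaleR_diff_right complex_cnj_diff)
qed

text \<open>Leibniz rule for the mollified functions, followed by the \<open>L2\<close> limit. The
  weight is just bounded with bounded derivative, so that the constant 1 (for the Jacobian) and the
  regularised fields (for the divergence identity) are admissible. The conjugate is placed so that
  \<open>v = u\<close> gives \<open>|u|^2\<close>.\<close>

lemma weak_deriv_product: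
  fixes \<psi> \<psi>' :: "real^2 \<Rightarrow> real"
  assumes u: "weak_deriv j u g" and v: "weak_deriv j v h"
    and \<psi>: "continuous_on UNIV \<psi>" "continuous_on UNIV \<psi>'" "\<And>x. \<bar>\<psi> x\<bar> \<le> C" "\<And>x. \<bar>\<psi>' x\<bar> \<le> C"
    and d: "\<And>x t. ((\<lambda>t. \<psi> (x + t *\<^sub>R axis j 1)) has_real_derivative \<psi>' (x + t *\<^sub>R axis j 1)) (at t)"
  shows "(LINT x|lborel. \<psi>' x *\<^sub>R (cnj (u x) * v x)) =
     - (LINT x|lborel. \<psi> x *\<^sub>R (cnj (g x) * v x + cnj (u x) * h x))"
proof -
  have [measurable]: "\<psi> \<in> borel_measurable borel" "\<psi>' \<in> borel_measurable borel"
    using \<psi> by (auto intro: borel_measurable_continuous_onI)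
  note U = corr_mollifier_smooth[OF u] and V = corr_mollifier_smooth[OF v]
  define U G V H where "U n = corr (mollifier n) u" and "G n = corr (mollifier n) g"
    and "V n = corr (mollifier n) v" and "H n = corr (mollifier n) h" for n
  note folds = U_def[symmetric] G_def[symmetric] V_def[symmetric] H_def[symmetric]
  note U = U[unfolded folds] and V = V[unfolded folds]
  have int: "integrable lborel (\<lambda>x. \<omega> x *\<^sub>R (cnj (a x) * b x))" if "L2 lborel a" "L2 lborel b"
      "\<omega> \<in> borel_measurable borel" "\<And>x. \<bar>\<omega> x\<bar> \<le> C" for \<omega> :: "real^2 \<Rightarrow> real" and a b
    using L2_mult_integrable[OF L2_scaleR_bounded[OF L2_cnj[OF that(1)], of \<omega> C] that(2)] that by simp
  have zero: "(LINT x|lborel. \<psi>' x *\<^sub>R (cnj (U n x) * V n x) + (\<psi> x *\<^sub>R (cnj (G n x) * V n x) + \<psi> x *\<^sub>R (cnj (U n x) * H n x))) = 0" for n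
  proof (rule integral_directional_derivative_eq_0[where f = "\<lambda>x. \<psi> x *\<^sub>R (cnj (U n x) * V n x)" and e = "axis j 1"])
    show "integrable lborel (\<lambda>x. \<psi> x *\<^sub>R (cnj (U n x) * V n x))"
      by (intro int U V \<psi>) measurable
    show "integrable lborel (\<lambda>x. \<psi>' x *\<^sub>R (cnj (U n x) * V n x) + (\<psi> x *\<^sub>R (cnj (G n x) * V n x) + \<psi> x *\<^sub>R (cnj (U n x) * H n x)))"
      by (intro Bochner_Integration.integrable_add int U V \<psi>) measurable
    show "continuous_on UNIV (\<lambda>x. \<psi>' x *\<^sub>R (cnj (U n x) * V n x) + (\<psi> x *\<^sub>R (cnj (G n x) * V n x) + \<psi> x *\<^sub>R (cnj (U n x) * H n x)))"
      by (intro continuous_intros U V \<psi>)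
    fix x t
    let ?p = "\<lambda>t. x + t *\<^sub>R axis j (1::real)"
    have "((\<lambda>t. cnj (U n (?p t))) has_vector_derivative cnj (G n (?p t))) (at t)"
      by (intro has_vector_derivative_cnj U)
    then have "((\<lambda>t. cnj (U n (?p t)) * V n (?p t)) has_vector_derivative cnj (U n (?p t)) * H n (?p t) + cnj (G n (?p t)) * V n (?p t)) (at t)"
      using V(5) by (rule has_vector_derivative_mult)
    with d show "((\<lambda>t. \<psi> (?p t) *\<^sub>R (cnj (U n (?p t)) * V n (?p t))) has_vector_derivative
        \<psi>' (?p t) *\<^sub>R (cnj (U n (?p t)) * V n (?p t)) + (\<psi> (?p t) *\<^sub>R (cnj (G n (?p t)) * V n (?p t)) + \<psi> (?p t) *\<^sub>R (cnj (U n (?p t)) * H n (?p t)))) (at t)"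
      by (rule has_vector_derivative_eq_rhs[OF has_vector_derivative_scaleR]) (simp add: algebra_simps)
  qed
  have z: "(LINT x|lborel. (\<psi>' x *\<^sub>R cnj (U n x)) * V n x) + ((LINT x|lborel. (\<psi> x *\<^sub>R cnj (G n x)) * V n x) + (LINT x|lborel. (\<psi> x *\<^sub>R cnj (U n x)) * H n x)) = 0" for n
  proof -
    have i: "integrable lborel (\<lambda>x. \<psi>' x *\<^sub>R (cnj (U n x) * V n x))" "integrable lborel (\<lambda>x. \<psi> x *\<^sub>R (cnj (G n x) * V n x))"
      "integrable lborel (\<lambda>x. \<psi> x *\<^sub>R (cnj (U n x) * H n x))"
      by (intro int U V \<psi>, measurable)+
    show ?thesis using zero[of n]
      unfolding Bochner_Integration.integral_add[OF i(1) Bochner_Integration.integrable_add[OF i(2,3)]]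
        Bochner_Integration.integral_add[OF i(2,3)] mult_scaleR_left .
  qed
  have "(\<lambda>n. (LINT x|lborel. (\<psi>' x *\<^sub>R cnj (U n x)) * V n x) + ((LINT x|lborel. (\<psi> x *\<^sub>R cnj (G n x)) * V n x) + (LINT x|lborel. (\<psi> x *\<^sub>R cnj (U n x)) * H n x)))
     \<longlonglongrightarrow> (LINT x|lborel. (\<psi>' x *\<^sub>R cnj (u x)) * v x) + ((LINT x|lborel. (\<psi> x *\<^sub>R cnj (g x)) * v x) + (LINT x|lborel. (\<psi> x *\<^sub>R cnj (u x)) * h x))"
    by (intro tendsto_add L2_tendsto_integral_mult L2_tendsto_scaleR_cnj[where C = C] U V \<psi>) measurable
  then have "(LINT x|lborel. (\<psi>' x *\<^sub>R cnj (u x)) * v x) + ((LINT x|lborel. (\<psi> x *\<^sub>R cnj (g x)) * v x) + (LINT x|lborel. (\<psi> x *\<^sub>R cnj (u x)) * h x)) = 0"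
    unfolding z by (simp add: LIMSEQ_const_iff)
  moreover have "(LINT x|lborel. \<psi> x *\<^sub>R (cnj (g x) * v x + cnj (u x) * h x)) = (LINT x|lborel. (\<psi> x *\<^sub>R cnj (g x)) * v x) + (LINT x|lborel. (\<psi> x *\<^sub>R cnj (u x)) * h x)"
    using int[of g v \<psi>] int[of u h \<psi>] weak_deriv_L2[OF u] weak_deriv_L2[OF v] \<psi>
    by (simp add: scaleR_add_right)
  ultimately show ?thesis by (simp only: eq_neg_iff_add_eq_0 mult_scaleR_left)
qed

text \<open>The case \<open>v = u\<close> of the Leibniz rule, where
  \<open>cnj g * u + cnj u * g\<close> is twice the real number
  \<open>u \<bullet> g\<close>.\<close>

lemma weak_deriv_norm_squared:
  fixes \<psi> \<psi>' :: "real^2 \<Rightarrow> real"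
  assumes u: "weak_deriv j u g"
    and \<psi>: "continuous_on UNIV \<psi>" "continuous_on UNIV \<psi>'" "\<And>x. \<bar>\<psi> x\<bar> \<le> C" "\<And>x. \<bar>\<psi>' x\<bar> \<le> C"
    and d: "\<And>x t. ((\<lambda>t. \<psi> (x + t *\<^sub>R axis j 1)) has_real_derivative \<psi>' (x + t *\<^sub>R axis j 1)) (at t)"
  shows "(LINT x|lborel. \<psi>' x * (norm (u x))\<^sup>2) = - 2 * (LINT x|lborel. \<psi> x * (u x \<bullet> g x))"
proof -
  have cnj_mult_eq: "cnj z * z = complex_of_real ((norm z)\<^sup>2)" for z
    by (metis complex_norm_square mult.commute)
  have "complex_of_real (LINT x|lborel. \<psi>' x * (norm (u x))\<^sup>2) = (LINT x|lborel. \<psi>' x *\<^sub>R (cnj (u x) * u x))"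
    unfolding integral_complex_of_real[symmetric]
    by (intro Bochner_Integration.integral_cong refl)
      (simp only: cnj_mult_eq scaleR_conv_of_real of_real_mult)
  also have "\<dots> = - (LINT x|lborel. \<psi> x *\<^sub>R (cnj (g x) * u x + cnj (u x) * g x))"
    by (rule weak_deriv_product[OF u u \<psi> d])
  also have "(LINT x|lborel. \<psi> x *\<^sub>R (cnj (g x) * u x + cnj (u x) * g x)) = complex_of_real (2 * (LINT x|lborel. \<psi> x * (u x \<bullet> g x)))"
    unfolding integral_complex_of_real[symmetric] integral_mult_right_zero[symmetric]
    by (intro Bochner_Integration.integral_cong) (auto simp: inner_complex_def complex_eq_iff algebra_simps)
  finally have "complex_of_real (LINT x|lborel. \<psi>' x * (norm (u x))\<^sup>2) = complex_of_real (- 2 * (LINT x|lborel. \<psi> x * (u x \<bullet> g x)))"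
    by simp
  then show ?thesis using of_real_eq_iff by blast
qed

text \<open>Only one factor is mollified. Moving the derivative off \<open>g1\<close> turns the
  integral of \<open>cnj g1 * (mollified g2)\<close> into minus the integral of
  \<open>cnj u * W\<close>, where \<open>W\<close> is the mixed second derivative of the mollified
  \<open>u\<close>. The same \<open>W\<close> appears with the roles of \<open>g1\<close> and
  \<open>g2\<close> exchanged. In the limit the integral of \<open>cnj g1 * g2\<close> equals its
  own conjugate, hence is real.\<close>

lemma weak_deriv_Jacobian:
  assumes u1: "weak_deriv 1 u g1" and u2: "weak_deriv 2 u g2"
  shows "(LINT x|lborel. Im (cnj (g1 x) * g2 x)) = 0"
proof -
  note l = weak_deriv_L2[OF u1] weak_deriv_L2[OF u2]
  note \<eta>' = test_function_partial_deriv[OF test_function_mollifier]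
  have V: "weak_deriv j (corr (mollifier n) g) (\<lambda>x. - corr (partial_deriv (mollifier n) j) g x)" if "L2 lborel g" for j n g
  proof (rule smooth_weak_deriv)
    show "((\<lambda>t. corr (mollifier n) g (x + t *\<^sub>R axis j 1)) has_vector_derivative - corr (partial_deriv (mollifier n) j) g (x + t *\<^sub>R axis j 1)) (at t)" for x t
      by (rule corr_directional[OF test_function_mollifier that])
  qed (intro L2_uminus L2_corr corr_measurable corr_continuous continuous_intros test_function_mollifier \<eta>' that)+
  have P: "(LINT x|lborel. cnj (g x) * v x + cnj (u x) * h x) = 0" if "weak_deriv j u g" "weak_deriv j v h" for j g v h
    using weak_deriv_product[OF that, of "\<lambda>_. 1" "\<lambda>_. 0" 1] by simp
  have eq: "(LINT x|lborel. cnj (g1 x) * corr (mollifier n) g2 x) = (LINT x|lborel. cnj (g2 x) * corr (mollifier n) g1 x)" for n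
  proof -
    define W where "W = corr (partial_deriv (partial_deriv (mollifier n) 1) 2) u"
    have W1: "- corr (partial_deriv (mollifier n) 1) g2 x = W x" for x
      using corr_weak_deriv[OF u2 \<eta>', of n 1 x] by (simp add: W_def)
    have W2: "- corr (partial_deriv (mollifier n) 2) g1 x = W x" for x
      using corr_weak_deriv[OF u1 \<eta>', of n 2 x] by (simp add: W_def mollifier_mixed)
    have lW: "L2 lborel W" unfolding W_def
      by (intro L2_corr corr_measurable test_function_partial_deriv \<eta>' l)
    have lm: "L2 lborel (corr (mollifier n) g)" if "L2 lborel g" for g
      by (intro L2_corr corr_measurable test_function_mollifier that)
    have "(LINT x|lborel. cnj (g1 x) * corr (mollifier n) g2 x + cnj (u x) * W x) = 0"
      using P[OF u1 V[OF l(4), of 1 n]] unfolding W1 .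
    moreover have "(LINT x|lborel. cnj (g2 x) * corr (mollifier n) g1 x + cnj (u x) * W x) = 0"
      using P[OF u2 V[OF l(2), of 2 n]] unfolding W2 .
    ultimately show ?thesis
      using L2_mult_integrable[OF L2_cnj[OF l(1)] lW] L2_mult_integrable[OF L2_cnj[OF l(2)] lm[OF l(4)]]
        L2_mult_integrable[OF L2_cnj[OF l(4)] lm[OF l(2)]]
      by (simp add: add_eq_0_iff2)
  qed
  have "(\<lambda>n. LINT x|lborel. cnj (g1 x) * corr (mollifier n) g2 x) \<longlonglongrightarrow> (LINT x|lborel. cnj (g1 x) * g2 x)"
    by (intro L2_tendsto_integral_mult L2_tendsto_const L2_cnj mollifier_L2_tendsto l)
  moreover have "(\<lambda>n. LINT x|lborel. cnj (g2 x) * corr (mollifier n) g1 x) \<longlonglongrightarrow> (LINT x|lborel. cnj (g2 x) * g1 x)"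
    by (intro L2_tendsto_integral_mult L2_tendsto_const L2_cnj mollifier_L2_tendsto l)
  ultimately have e: "(LINT x|lborel. cnj (g1 x) * g2 x) = (LINT x|lborel. cnj (g2 x) * g1 x)"
    unfolding eq by (rule LIMSEQ_unique)
  have i: "integrable lborel (\<lambda>x. cnj (g1 x) * g2 x)" "integrable lborel (\<lambda>x. cnj (g2 x) * g1 x)"
    by (intro L2_mult_integrable L2_cnj l)+
  have "Im (LINT x|lborel. cnj (g1 x) * g2 x) = (LINT x|lborel. Im (cnj (g1 x) * g2 x))"
    "Im (LINT x|lborel. cnj (g2 x) * g1 x) = (LINT x|lborel. Im (cnj (g2 x) * g1 x))"
    using i by (simp_all only: integral_Im)
  moreover have "(LINT x|lborel. Im (cnj (g2 x) * g1 x)) = - (LINT x|lborel. Im (cnj (g1 x) * g2 x))"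
    unfolding Bochner_Integration.integral_minus[symmetric]
    by (intro Bochner_Integration.integral_cong) (auto simp: algebra_simps)
  ultimately show ?thesis using e by simp
qed

text \<open>The regularised absolute value \<open>sqrt (|a|^2 + e^2) - e\<close> is 1-Lipschitz because
  \<open>sqrt (|a|^2 + e^2)\<close> is the norm of the pair \<open>(a, e)\<close>.\<close>

definition smooth_abs :: "real \<Rightarrow> complex \<Rightarrow> real" where
  "smooth_abs e a = norm (a, e)"

lemma smooth_abs_sqrt: "smooth_abs e a = sqrt ((norm a)\<^sup>2 + e\<^sup>2)"
  by (simp add: smooth_abs_def norm_Pair)

lemma smooth_abs_lipschitz: "\<bar>smooth_abs e a - smooth_abs e b\<bar> \<le> norm (a - b)"
  using norm_triangle_ineq3[of "(a, e)" "(b, e)"] by (simp add: smooth_abs_def norm_Pair)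

lemma smooth_abs_ge: "norm a \<le> smooth_abs e a" "\<bar>e\<bar> \<le> smooth_abs e a"
  by (simp_all add: smooth_abs_sqrt real_le_rsqrt)

lemma smooth_abs_le: "0 \<le> e \<Longrightarrow> smooth_abs e a \<le> norm a + e"
  using smooth_abs_lipschitz[of e a 0] by (simp add: smooth_abs_sqrt)

text \<open>Changing the numerator costs \<open>|a - b| / s\<close>, changing the denominator at
  most the same because \<open>|b| \<le> t\<close>. The constant blows up as \<open>e\<close> tends
  to 0, which is harmless because the mollification limit is taken first, with \<open>e\<close>
  fixed.\<close>

lemma smooth_abs_quotient_lipschitz:
  assumes "0 < e"
  shows "norm (a /\<^sub>R smooth_abs e a - b /\<^sub>R smooth_abs e b) \<le> 2 / e * norm (a - b)"
proof -
  define s t where "s = smooth_abs e a" and "t = smooth_abs e b"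
  have p: "e \<le> s" "e \<le> t" "norm b \<le> t" "\<bar>t - s\<bar> \<le> norm (a - b)"
    using smooth_abs_ge[where e = e] smooth_abs_lipschitz[of e b a] assms unfolding s_def t_def
    by (auto simp: norm_minus_commute intro: order_trans[OF abs_ge_self])
  have pos: "0 < s" "0 < t" using p assms by linarith+
  have "a /\<^sub>R s - b /\<^sub>R t = (a - b) /\<^sub>R s + ((t - s) / (s * t)) *\<^sub>R b"
    using pos by (simp add: scaleR_conv_of_real field_simps)
  then have "norm (a /\<^sub>R s - b /\<^sub>R t) \<le> norm ((a - b) /\<^sub>R s) + norm (((t - s) / (s * t)) *\<^sub>R b)"
    using norm_triangle_ineq by metis
  also have "norm ((a - b) /\<^sub>R s) = norm (a - b) / s" using pos by (simp add: divide_inverse_commute)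
  also have "\<dots> \<le> norm (a - b) / e" using p assms by (intro divide_left_mono) auto
  also have "norm (((t - s) / (s * t)) *\<^sub>R b) = \<bar>t - s\<bar> / s * (norm b / t)" using pos by (simp add: abs_mult)
  also have "\<dots> \<le> norm (a - b) / e * 1" using p pos assms by (intro mult_mono frac_le) auto
  finally show ?thesis unfolding s_def t_def by simp
qed

lemma has_real_derivative_smooth_abs:
  assumes f: "(f has_vector_derivative f') (at t)" and "0 < e"
  shows "((\<lambda>t. smooth_abs e (f t)) has_real_derivative (f t \<bullet> f') / smooth_abs e (f t)) (at t)"
proof -
  have "((\<lambda>t. f t \<bullet> f t) has_vector_derivative f t \<bullet> f' + f' \<bullet> f t) (at t)"
    by (rule bounded_bilinear.has_vector_derivative[OF bounded_bilinear_inner f f])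
  then have "((\<lambda>t. f t \<bullet> f t + e\<^sup>2) has_real_derivative 2 * (f t \<bullet> f')) (at t)"
    unfolding has_real_derivative_iff_has_vector_derivative[symmetric]
    by (auto intro!: derivative_eq_intros simp: inner_commute)
  moreover have "0 < f t \<bullet> f t + e\<^sup>2" using assms(2) by (simp add: add_nonneg_pos)
  ultimately have d: "((\<lambda>t. sqrt (f t \<bullet> f t + e\<^sup>2)) has_real_derivative inverse (sqrt (f t \<bullet> f t + e\<^sup>2)) / 2 * (2 * (f t \<bullet> f'))) (at t)"
    by (intro DERIV_chain2[OF DERIV_real_sqrt]) auto
  have eq: "smooth_abs e a = sqrt (a \<bullet> a + e\<^sup>2)" for a
    by (simp add: smooth_abs_sqrt power2_norm_eq_inner)
  have "inverse s / 2 * (2 * r) = r / s" for r s :: real by (cases "s = 0") (auto simp: field_simps)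
  with d show ?thesis unfolding eq by simp
qed

lemma continuous_on_smooth_abs[continuous_intros]:
  "continuous_on A f \<Longrightarrow> continuous_on A (\<lambda>x. smooth_abs e (f x))"
  unfolding smooth_abs_sqrt by (intro continuous_intros)

lemma smooth_abs_measurable[measurable (raw)]:
  "f \<in> borel_measurable M \<Longrightarrow> (\<lambda>x. smooth_abs e (f x)) \<in> borel_measurable M"
  by (rule borel_measurable_continuous_on[OF continuous_on_smooth_abs[OF continuous_on_id]])

text \<open>Chain rule for the mollified functions, then passage to the limit. Subtracting the
  constant \<open>e\<close> keeps the function square integrable, since
  \<open>smooth_abs e (u x)\<close> is at least \<open>e\<close> everywhere.\<close>

lemma weak_deriv_smooth_abs:
  assumes u: "weak_deriv j u g" and e: "0 < e" and \<phi>: "test_function \<phi>"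
  shows "(LINT x|lborel. partial_deriv \<phi> j x * (smooth_abs e (u x) - e)) = - (LINT x|lborel. \<phi> x * ((u x \<bullet> g x) / smooth_abs e (u x)))"
proof -
  let ?s = "smooth_abs e"
  note l = weak_deriv_L2[OF u]
  note U = corr_mollifier_smooth[OF u]
  define U' G where "U' n = corr (mollifier n) u" and "G n = corr (mollifier n) g" for n
  note U = U[folded U'_def G_def]
  note \<phi>' = test_function_partial_deriv[OF \<phi>, of j]
  note [measurable] = test_function_measurable[OF \<phi>] test_function_measurable[OF \<phi>']
  obtain C where C: "\<And>x. \<bar>\<phi> x\<bar> \<le> C"
  proof -
    obtain C R where "0 < C" "\<And>x. \<bar>\<phi> x\<bar> \<le> C * indicator (cball 0 R) x" using test_function_bounds[OF \<phi>] by metis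
    then have "\<bar>\<phi> x\<bar> \<le> C" for x
      using order_trans[OF \<open>\<bar>\<phi> x\<bar> \<le> C * indicator (cball 0 R) x\<close>, of C] by (simp add: indicator_def split: if_splits)
    then show thesis by (rule that)
  qed
  have sp: "0 < ?s a" for a using smooth_abs_ge(2)[of e a] e by linarith
  have L2s: "L2 lborel (\<lambda>x. ?s (f x) - e)" if "L2 lborel f" for f :: "real^2 \<Rightarrow> complex"
  proof (rule L2_bound[OF that, of _ 1])
    have [measurable]: "f \<in> borel_measurable borel" using that by (simp add: L2_def)
    show "(\<lambda>x. ?s (f x) - e) \<in> borel_measurable lborel" by measurable
    show "norm (?s (f x) - e) \<le> 1 * norm (f x)" for x
      using smooth_abs_le[of e "f x"] smooth_abs_ge(2)[of e "f x"] e by simp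
  qed
  have L2q: "L2 lborel (\<lambda>x. \<phi> x *\<^sub>R cnj (f x /\<^sub>R ?s (f x)))" if "L2 lborel f" for f :: "real^2 \<Rightarrow> complex"
  proof (rule L2_bound[OF test_function_L2[OF \<phi>], of _ 1])
    show "(\<lambda>x. \<phi> x *\<^sub>R cnj (f x /\<^sub>R ?s (f x))) \<in> borel_measurable lborel" using that by (auto simp: L2_def)
    fix x
    have "norm (f x) / ?s (f x) \<le> 1" using smooth_abs_ge(1)[of "f x" e] sp[of "f x"] by simp
    then have "\<bar>\<phi> x\<bar> * (norm (f x) / ?s (f x)) \<le> \<bar>\<phi> x\<bar> * 1" by (intro mult_left_mono) auto
    moreover have "norm (cnj (f x /\<^sub>R ?s (f x))) = norm (f x) / ?s (f x)"
      using sp[of "f x"] by (simp add: divide_inverse_commute)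
    ultimately show "norm (\<phi> x *\<^sub>R cnj (f x /\<^sub>R ?s (f x))) \<le> 1 * norm (\<phi> x)"
      by (simp only: norm_scaleR) simp
  qed
  \<comment> \<open>The limit theorem for integrals of products is stated for an algebra, so the
    inner product is written as the real part of a complex product.\<close>
  have pr: "\<phi> x * ((f x \<bullet> h x) / ?s (f x)) = Re ((\<phi> x *\<^sub>R cnj (f x /\<^sub>R ?s (f x))) * h x)" for f h x
    by (simp add: inner_complex_def algebra_simps divide_inverse)
  have iq: "integrable lborel (\<lambda>x. (\<phi> x *\<^sub>R cnj (f x /\<^sub>R ?s (f x))) * h x)" if "L2 lborel f" "L2 lborel h" for f h
    by (intro L2_mult_integrable L2q that)
  have iq': "integrable lborel (\<lambda>x. \<phi> x * ((f x \<bullet> h x) / ?s (f x)))" if "L2 lborel f" "L2 lborel h" for f h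
    unfolding pr using iq[OF that] by (rule integrable_Re)
  have eq: "(LINT x|lborel. partial_deriv \<phi> j x * (?s (U' n x) - e)) = - (LINT x|lborel. \<phi> x * ((U' n x \<bullet> G n x) / ?s (U' n x)))" for n
  proof -
    have i: "integrable lborel (\<lambda>x. partial_deriv \<phi> j x * (?s (U' n x) - e))"
      by (intro L2_mult_integrable test_function_L2 \<phi>' L2s U)
    have "(LINT x|lborel. partial_deriv \<phi> j x * (?s (U' n x) - e) + \<phi> x * ((U' n x \<bullet> G n x) / ?s (U' n x))) = 0"
    proof (rule integral_directional_derivative_eq_0[where f = "\<lambda>x. \<phi> x * (?s (U' n x) - e)" and e = "axis j 1"])
      show "integrable lborel (\<lambda>x. \<phi> x * (?s (U' n x) - e))"
        by (intro L2_mult_integrable test_function_L2 \<phi> L2s U)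
      show "integrable lborel (\<lambda>x. partial_deriv \<phi> j x * (?s (U' n x) - e) + \<phi> x * ((U' n x \<bullet> G n x) / ?s (U' n x)))"
        by (intro Bochner_Integration.integrable_add i iq' U)
      show "continuous_on UNIV (\<lambda>x. partial_deriv \<phi> j x * (?s (U' n x) - e) + \<phi> x * ((U' n x \<bullet> G n x) / ?s (U' n x)))"
        using sp by (intro continuous_intros test_function_continuous \<phi> \<phi>' U) (auto simp: less_imp_neq[THEN not_sym])
      fix x t
      let ?p = "\<lambda>t. x + t *\<^sub>R axis j (1::real)"
      have "((\<lambda>t. \<phi> (?p t)) has_real_derivative partial_deriv \<phi> j (?p t)) (at t)"
        unfolding has_real_derivative_iff_has_vector_derivative by (rule test_function_directional[OF \<phi>])
      moreover have "((\<lambda>t. ?s (U' n (?p t)) - e) has_real_derivative (U' n (?p t) \<bullet> G n (?p t)) / ?s (U' n (?p t)) - 0) (at t)"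
        by (intro DERIV_diff DERIV_const has_real_derivative_smooth_abs U e)
      ultimately have "((\<lambda>t. \<phi> (?p t) * (?s (U' n (?p t)) - e)) has_real_derivative
          partial_deriv \<phi> j (?p t) * (?s (U' n (?p t)) - e) + ((U' n (?p t) \<bullet> G n (?p t)) / ?s (U' n (?p t)) - 0) * \<phi> (?p t)) (at t)"
        by (rule DERIV_mult)
      then show "((\<lambda>t. \<phi> (?p t) * (?s (U' n (?p t)) - e)) has_vector_derivative
          partial_deriv \<phi> j (?p t) * (?s (U' n (?p t)) - e) + \<phi> (?p t) * ((U' n (?p t) \<bullet> G n (?p t)) / ?s (U' n (?p t)))) (at t)"
        unfolding has_real_derivative_iff_has_vector_derivative by (simp add: mult.commute)
    qed
    then show ?thesis
      unfolding Bochner_Integration.integral_add[OF i iq'[OF U(6,7)]] by simp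
  qed
  have "(\<lambda>n. LINT x|lborel. partial_deriv \<phi> j x * (?s (U' n x) - e)) \<longlonglongrightarrow> (LINT x|lborel. partial_deriv \<phi> j x * (?s (u x) - e))"
    by (intro L2_tendsto_integral_mult L2_tendsto_const test_function_L2 \<phi>' L2_tendsto_dominated[OF U(1), of _ _ 1] L2s U l)
      (use smooth_abs_lipschitz in simp)
  moreover have "(\<lambda>n. - (LINT x|lborel. \<phi> x * ((U' n x \<bullet> G n x) / ?s (U' n x)))) \<longlonglongrightarrow> - (LINT x|lborel. \<phi> x * ((u x \<bullet> g x) / ?s (u x)))"
  proof -
    have "L2_tendsto lborel (\<lambda>n x. \<phi> x *\<^sub>R cnj (U' n x /\<^sub>R ?s (U' n x))) (\<lambda>x. \<phi> x *\<^sub>R cnj (u x /\<^sub>R ?s (u x)))"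
    proof (rule L2_tendsto_dominated[OF U(1), of _ _ "C * (2 / e)"])
      fix n x
      have "norm (\<phi> x *\<^sub>R cnj (U' n x /\<^sub>R ?s (U' n x)) - \<phi> x *\<^sub>R cnj (u x /\<^sub>R ?s (u x)))
          = \<bar>\<phi> x\<bar> * norm (U' n x /\<^sub>R ?s (U' n x) - u x /\<^sub>R ?s (u x))"
        by (metis complex_cnj_diff complex_mod_cnj norm_scaleR scaleR_diff_right)
      also have "\<dots> \<le> C * (2 / e * norm (U' n x - u x))"
        by (intro mult_mono C smooth_abs_quotient_lipschitz e norm_ge_zero order_trans[OF abs_ge_zero C])
      finally show "norm (\<phi> x *\<^sub>R cnj (U' n x /\<^sub>R ?s (U' n x)) - \<phi> x *\<^sub>R cnj (u x /\<^sub>R ?s (u x))) \<le> C * (2 / e) * norm (U' n x - u x)"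
        by simp
    qed (intro L2q U l)+
    then have "(\<lambda>n. LINT x|lborel. (\<phi> x *\<^sub>R cnj (U' n x /\<^sub>R ?s (U' n x))) * G n x) \<longlonglongrightarrow> (LINT x|lborel. (\<phi> x *\<^sub>R cnj (u x /\<^sub>R ?s (u x))) * g x)"
      by (rule L2_tendsto_integral_mult[OF _ U(2)])
    then show ?thesis
      unfolding pr integral_Re[OF iq[OF l]] integral_Re[OF iq[OF U(6,7)]] by (intro tendsto_minus tendsto_Re)
  qed
  ultimately show ?thesis unfolding eq by (rule LIMSEQ_unique)
qed

text \<open>The regularisation is removed along \<open>e = 1 / Suc k\<close>, with majorants
  \<open>|u|\<close> and \<open>|g|\<close> times the weights. Where \<open>u = 0\<close> the
  regularised quotients are 0 already, and so is the limit, as division by 0 gives 0.\<close>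

lemma weak_deriv_norm:
  assumes u: "weak_deriv j u g"
  shows "weak_deriv j (\<lambda>x. complex_of_real (norm (u x))) (\<lambda>x. complex_of_real ((u x \<bullet> g x) / norm (u x)))"
  unfolding weak_deriv_def
proof (intro conjI allI impI)
  note l = weak_deriv_L2[OF u]
  have [measurable]: "u \<in> borel_measurable borel" "g \<in> borel_measurable borel" using l by (auto simp: L2_def)
  have qb: "\<bar>(u x \<bullet> g x) / norm (u x)\<bar> \<le> norm (g x)" for x
    using Cauchy_Schwarz_ineq2[of "u x" "g x"] by (cases "u x = 0") (auto simp: divide_le_eq abs_divide mult.commute)
  show "L2 lborel (\<lambda>x. complex_of_real (norm (u x)))"
    by (rule L2_bound[OF l(1), of _ 1]) auto
  show "L2 lborel (\<lambda>x. complex_of_real ((u x \<bullet> g x) / norm (u x)))"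
    by (rule L2_bound[OF l(2), of _ 1]) (use qb in \<open>auto simp del: of_real_divide\<close>)
  fix \<phi> assume \<phi>: "test_function \<phi>"
  note \<phi>' = test_function_partial_deriv[OF \<phi>, of j]
  note [measurable] = test_function_measurable[OF \<phi>] test_function_measurable[OF \<phi>']
  let ?e = "\<lambda>k. 1 / real (Suc k)"
  have e0: "?e \<longlonglongrightarrow> 0" using LIMSEQ_inverse_real_of_nat by (simp add: inverse_eq_divide)
  have slim: "(\<lambda>k. smooth_abs (?e k) a) \<longlonglongrightarrow> norm a" for a
  proof -
    have "(\<lambda>k. sqrt ((norm a)\<^sup>2 + (?e k)\<^sup>2)) \<longlonglongrightarrow> sqrt ((norm a)\<^sup>2 + 0\<^sup>2)"
      by (intro tendsto_intros e0)
    then show ?thesis by (simp add: smooth_abs_sqrt)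
  qed
  have dlim: "(\<lambda>k. smooth_abs (?e k) a - ?e k) \<longlonglongrightarrow> norm a" for a
    using tendsto_diff[OF slim e0, of a] by (simp only: diff_zero)
  have left: "(\<lambda>k. LINT x|lborel. partial_deriv \<phi> j x * (smooth_abs (?e k) (u x) - ?e k)) \<longlonglongrightarrow> (LINT x|lborel. partial_deriv \<phi> j x * norm (u x))"
  proof (rule integral_dominated_convergence[where w = "\<lambda>x. norm (partial_deriv \<phi> j x) * norm (u x)"])
    show "integrable lborel (\<lambda>x. norm (partial_deriv \<phi> j x) * norm (u x))"
      by (intro L2_norm_mult_integrable test_function_L2 \<phi>' l)
    show "AE x in lborel. (\<lambda>k. partial_deriv \<phi> j x * (smooth_abs (?e k) (u x) - ?e k)) \<longlonglongrightarrow> partial_deriv \<phi> j x * norm (u x)"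
      by (intro AE_I2 tendsto_mult tendsto_const dlim)
    show "AE x in lborel. norm (partial_deriv \<phi> j x * (smooth_abs (?e k) (u x) - ?e k)) \<le> norm (partial_deriv \<phi> j x) * norm (u x)" for k
    proof (rule AE_I2)
      fix x
      have "0 \<le> smooth_abs (?e k) (u x) - ?e k" "smooth_abs (?e k) (u x) - ?e k \<le> norm (u x)"
        using smooth_abs_le[of "?e k" "u x"] smooth_abs_ge(2)[of "?e k" "u x"] by simp_all
      then show "norm (partial_deriv \<phi> j x * (smooth_abs (?e k) (u x) - ?e k)) \<le> norm (partial_deriv \<phi> j x) * norm (u x)"
        unfolding norm_mult by (intro mult_left_mono) auto
    qed
  qed measurable
  have right: "(\<lambda>k. - (LINT x|lborel. \<phi> x * ((u x \<bullet> g x) / smooth_abs (?e k) (u x)))) \<longlonglongrightarrow> - (LINT x|lborel. \<phi> x * ((u x \<bullet> g x) / norm (u x)))"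
  proof (intro tendsto_minus, rule integral_dominated_convergence[where w = "\<lambda>x. norm (\<phi> x) * norm (g x)"])
    show "integrable lborel (\<lambda>x. norm (\<phi> x) * norm (g x))"
      by (intro L2_norm_mult_integrable test_function_L2 \<phi> l)
    show "AE x in lborel. (\<lambda>k. \<phi> x * ((u x \<bullet> g x) / smooth_abs (?e k) (u x))) \<longlonglongrightarrow> \<phi> x * ((u x \<bullet> g x) / norm (u x))"
    proof (rule AE_I2)
      fix x
      show "(\<lambda>k. \<phi> x * ((u x \<bullet> g x) / smooth_abs (?e k) (u x))) \<longlonglongrightarrow> \<phi> x * ((u x \<bullet> g x) / norm (u x))"
      proof (cases "u x = 0")
        case False
        then show ?thesis by (intro tendsto_intros slim) auto
      qed simp
    qed
    show "AE x in lborel. norm (\<phi> x * ((u x \<bullet> g x) / smooth_abs (?e k) (u x))) \<le> norm (\<phi> x) * norm (g x)" for k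
    proof (rule AE_I2)
      fix x
      have "\<bar>u x \<bullet> g x\<bar> \<le> smooth_abs (?e k) (u x) * norm (g x)"
        using Cauchy_Schwarz_ineq2[of "u x" "g x"] mult_right_mono[OF smooth_abs_ge(1) norm_ge_zero, of "u x" "g x" "?e k"] by linarith
      moreover have "0 < smooth_abs (?e k) (u x)" using smooth_abs_ge(2)[of "?e k" "u x"] by (smt (verit) of_nat_0_less_iff zero_less_Suc zero_less_divide_1_iff)
      ultimately have "\<bar>(u x \<bullet> g x) / smooth_abs (?e k) (u x)\<bar> \<le> norm (g x)"
        by (simp add: abs_divide divide_le_eq mult.commute)
      then show "norm (\<phi> x * ((u x \<bullet> g x) / smooth_abs (?e k) (u x))) \<le> norm (\<phi> x) * norm (g x)"
        unfolding norm_mult[of "\<phi> x"] real_norm_def[of "_ / _"] by (intro mult_left_mono) auto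
    qed
  qed measurable
  have eq: "(LINT x|lborel. partial_deriv \<phi> j x * (smooth_abs (?e k) (u x) - ?e k)) = - (LINT x|lborel. \<phi> x * ((u x \<bullet> g x) / smooth_abs (?e k) (u x)))" for k
    by (intro weak_deriv_smooth_abs u \<phi>) simp
  have real: "(LINT x|lborel. partial_deriv \<phi> j x * norm (u x)) = - (LINT x|lborel. \<phi> x * ((u x \<bullet> g x) / norm (u x)))"
    by (rule LIMSEQ_unique[OF left]) (unfold eq, rule right)
  have "(LINT x|lborel. partial_deriv \<phi> j x *\<^sub>R complex_of_real (norm (u x))) = complex_of_real (LINT x|lborel. partial_deriv \<phi> j x * norm (u x))"
    unfolding integral_complex_of_real[symmetric] by (simp add: scaleR_conv_of_real)
  also have "\<dots> = - complex_of_real (LINT x|lborel. \<phi> x * ((u x \<bullet> g x) / norm (u x)))" unfolding real by simp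
  also have "complex_of_real (LINT x|lborel. \<phi> x * ((u x \<bullet> g x) / norm (u x))) = (LINT x|lborel. \<phi> x *\<^sub>R complex_of_real ((u x \<bullet> g x) / norm (u x)))"
    unfolding integral_complex_of_real[symmetric] by (simp add: scaleR_conv_of_real)
  finally show "(LINT x|lborel. partial_deriv \<phi> j x *\<^sub>R complex_of_real (norm (u x))) = - (LINT x|lborel. \<phi> x *\<^sub>R complex_of_real ((u x \<bullet> g x) / norm (u x)))" .
qed

section \<open>The Newtonian field of the density\<close>

lemma norm_power2_plane: "(norm (x::real^2))\<^sup>2 = (x $ 1)\<^sup>2 + (x $ 2)\<^sup>2"
  by (simp add: norm_vec_def L2_set_def sum_2 real_sqrt_pow2)

text \<open>The gradient is a parameter, so that the same theory applies to \<open>u\<close> and to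
  its modulus with an explicitly given gradient.\<close>

locale H1_function =
  fixes u g1 g2 :: "real^2 \<Rightarrow> complex"
  assumes weak1: "weak_deriv 1 u g1" and weak2: "weak_deriv 2 u g2"
begin

definition rho :: "real^2 \<Rightarrow> real" where "rho x = (norm (u x))\<^sup>2"

text \<open>As a finite measure, \<open>rho\<close> makes bounded measurable functions integrable,
  and three-body integrals become integrals over a product measure.\<close>

definition mu :: "(real^2) measure" where "mu = density lborel (\<lambda>x. ennreal (rho x))"

text \<open>\<open>(d1, d2)\<close> is half the gradient of \<open>rho\<close>.\<close>

definition d1 :: "real^2 \<Rightarrow> real" where "d1 x = u x \<bullet> g1 x"

definition d2 :: "real^2 \<Rightarrow> real" where "d2 x = u x \<bullet> g2 x"

lemma L2_u: "L2 lborel u" and L2_g1: "L2 lborel g1" and L2_g2: "L2 lborel g2"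
  using weak_deriv_L2 weak1 weak2 by blast+

lemma measurable_u[measurable]: "u \<in> borel_measurable borel"
  and measurable_g1[measurable]: "g1 \<in> borel_measurable borel"
  and measurable_g2[measurable]: "g2 \<in> borel_measurable borel"
  using L2_u L2_g1 L2_g2 by (simp_all add: L2_def)

lemma measurable_rho[measurable]: "rho \<in> borel_measurable borel"
  unfolding rho_def[abs_def] by measurable

lemma measurable_d1[measurable]: "d1 \<in> borel_measurable borel"
  and measurable_d2[measurable]: "d2 \<in> borel_measurable borel"
  unfolding d1_def[abs_def] d2_def[abs_def] by measurable

lemma rho_nonneg: "0 \<le> rho x"
  by (simp add: rho_def)

lemma integrable_rho: "integrable lborel rho"
  using L2_u by (simp add: L2_def rho_def[abs_def])

lemma integrable_d1: "integrable lborel d1" and integrable_d2: "integrable lborel d2"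
proof -
  have "integrable lborel (\<lambda>x. u x \<bullet> g x)" if g: "L2 lborel g" for g
  proof (rule Bochner_Integration.integrable_bound[OF L2_norm_mult_integrable[OF L2_u g]])
    show "(\<lambda>x. u x \<bullet> g x) \<in> borel_measurable lborel" using g by (auto simp: L2_def)
  qed (auto simp: Cauchy_Schwarz_ineq2)
  then show "integrable lborel d1" "integrable lborel d2"
    using L2_g1 L2_g2 by (auto simp: d1_def[abs_def] d2_def[abs_def])
qed

lemma sets_mu[measurable_cong, simp]: "sets mu = sets borel"
  and space_mu[simp]: "space mu = UNIV"
  by (simp_all add: mu_def)

lemma nn_integral_mu:
  "f \<in> borel_measurable borel \<Longrightarrow> (\<integral>\<^sup>+x. f x \<partial>mu) = (\<integral>\<^sup>+x. ennreal (rho x) * f x \<partial>lborel)"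
  by (simp add: mu_def nn_integral_density)

lemma integral_mu:
  fixes f :: "real^2 \<Rightarrow> 'b::{banach, second_countable_topology}"
  shows "f \<in> borel_measurable borel \<Longrightarrow> (LINT x|mu. f x) = (LINT x|lborel. rho x *\<^sub>R f x)"
  unfolding mu_def by (subst integral_density) (auto simp: rho_nonneg)

lemma integrable_mu_iff:
  fixes f :: "real^2 \<Rightarrow> 'b::{banach, second_countable_topology}"
  shows "f \<in> borel_measurable borel \<Longrightarrow> integrable mu f \<longleftrightarrow> integrable lborel (\<lambda>x. rho x *\<^sub>R f x)"
  unfolding mu_def by (subst integrable_density) (auto simp: rho_nonneg)

sublocale mu: finite_measure mu
proof
  have "emeasure mu (space mu) = (\<integral>\<^sup>+x. ennreal (rho x) \<partial>lborel)"
    by (simp add: mu_def emeasure_density)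
  also have "\<dots> < \<infinity>" using integrable_rho by (simp add: integrable_iff_bounded rho_nonneg)
  finally show "emeasure mu (space mu) \<noteq> \<infinity>" by simp
qed

lemma integrable_mu_bounded:
  fixes f :: "real^2 \<Rightarrow> real"
  assumes [measurable]: "f \<in> borel_measurable borel" and "\<And>x. \<bar>f x\<bar> \<le> C"
  shows "integrable mu f"
  by (rule mu.integrable_const_bound[where B = C]) (use assms in auto)

text \<open>Each component is an instance of the Leibniz rule for \<open>|u|^2\<close>; the factor 2
  compensates for the half in \<open>d1\<close> and \<open>d2\<close>. Fields are given as functions
  of two real coordinates so that partial derivatives are one-variable derivatives. Three fields
  will be inserted: a regularised unit radial field, the regularised kernel and the Hardy
  field.\<close>

lemma divergence_identity:
  fixes p q p' q' :: "real \<Rightarrow> real \<Rightarrow> real"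
  assumes p: "\<And>a b. ((\<lambda>a. p a b) has_real_derivative p' a b) (at a)"
    and q: "\<And>a b. ((\<lambda>b. q a b) has_real_derivative q' a b) (at b)"
    and c: "continuous_on UNIV (\<lambda>x::real^2. p (x $ 1) (x $ 2))" "continuous_on UNIV (\<lambda>x::real^2. p' (x $ 1) (x $ 2))"
      "continuous_on UNIV (\<lambda>x::real^2. q (x $ 1) (x $ 2))" "continuous_on UNIV (\<lambda>x::real^2. q' (x $ 1) (x $ 2))"
    and b: "\<And>a b. \<bar>p a b\<bar> \<le> C" "\<And>a b. \<bar>p' a b\<bar> \<le> C" "\<And>a b. \<bar>q a b\<bar> \<le> C" "\<And>a b. \<bar>q' a b\<bar> \<le> C"
  shows "(LINT x|mu. p' (x $ 1) (x $ 2) + q' (x $ 1) (x $ 2)) =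
    - 2 * (LINT x|lborel. p (x $ 1) (x $ 2) * d1 x + q (x $ 1) (x $ 2) * d2 x)"
proof -
  note [measurable] = borel_measurable_continuous_onI[OF c(1)] borel_measurable_continuous_onI[OF c(2)]
     borel_measurable_continuous_onI[OF c(3)] borel_measurable_continuous_onI[OF c(4)]
  have P: "(LINT x|lborel. p' (x $ 1) (x $ 2) * (norm (u x))\<^sup>2) = - 2 * (LINT x|lborel. p (x $ 1) (x $ 2) * (u x \<bullet> g1 x))"
  proof (rule weak_deriv_norm_squared[OF weak1, where C = C])
    fix x :: "real^2" and t
    have "((\<lambda>t. p (x $ 1 + t) (x $ 2)) has_real_derivative p' (x $ 1 + t) (x $ 2)) (at t)"
      using DERIV_shift[THEN iffD1, OF p[where b = "x $ 2" and a = "t + x $ 1"]] by (simp add: add.commute)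
    then show "((\<lambda>t. p ((x + t *\<^sub>R axis 1 1) $ 1) ((x + t *\<^sub>R axis 1 1) $ 2)) has_real_derivative p' ((x + t *\<^sub>R axis 1 1) $ 1) ((x + t *\<^sub>R axis 1 1) $ 2)) (at t)"
      by (simp add: axis_def)
  qed (use c b in auto)
  have Q: "(LINT x|lborel. q' (x $ 1) (x $ 2) * (norm (u x))\<^sup>2) = - 2 * (LINT x|lborel. q (x $ 1) (x $ 2) * (u x \<bullet> g2 x))"
  proof (rule weak_deriv_norm_squared[OF weak2, where C = C])
    fix x :: "real^2" and t
    have "((\<lambda>t. q (x $ 1) (x $ 2 + t)) has_real_derivative q' (x $ 1) (x $ 2 + t)) (at t)"
      using DERIV_shift[THEN iffD1, OF q[where a = "x $ 1" and b = "t + x $ 2"]] by (simp add: add.commute)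
    then show "((\<lambda>t. q ((x + t *\<^sub>R axis 2 1) $ 1) ((x + t *\<^sub>R axis 2 1) $ 2)) has_real_derivative q' ((x + t *\<^sub>R axis 2 1) $ 1) ((x + t *\<^sub>R axis 2 1) $ 2)) (at t)"
      by (simp add: axis_def)
  qed (use c b in auto)
  have C: "\<bar>r\<bar> * \<bar>s\<bar> \<le> \<bar>C\<bar> * \<bar>s\<bar>" if "\<bar>r\<bar> \<le> C" for r s :: real
    using that by (intro mult_right_mono) auto
  have "integrable mu (\<lambda>x. p' (x $ 1) (x $ 2))" "integrable mu (\<lambda>x. q' (x $ 1) (x $ 2))"
    by (rule integrable_mu_bounded[where C = C]; use b in simp)+
  then have "(LINT x|mu. p' (x $ 1) (x $ 2) + q' (x $ 1) (x $ 2)) = (LINT x|mu. p' (x $ 1) (x $ 2)) + (LINT x|mu. q' (x $ 1) (x $ 2))"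
    by (rule Bochner_Integration.integral_add)
  also have "(LINT x|mu. p' (x $ 1) (x $ 2)) = - 2 * (LINT x|lborel. p (x $ 1) (x $ 2) * d1 x)"
    using P by (simp add: integral_mu rho_def d1_def mult.commute)
  also have "(LINT x|mu. q' (x $ 1) (x $ 2)) = - 2 * (LINT x|lborel. q (x $ 1) (x $ 2) * d2 x)"
    using Q by (simp add: integral_mu rho_def d2_def mult.commute)
  also have "- 2 * (LINT x|lborel. p (x $ 1) (x $ 2) * d1 x) + - 2 * (LINT x|lborel. q (x $ 1) (x $ 2) * d2 x)
      = - 2 * ((LINT x|lborel. p (x $ 1) (x $ 2) * d1 x) + (LINT x|lborel. q (x $ 1) (x $ 2) * d2 x))" by simp
  also have "(LINT x|lborel. p (x $ 1) (x $ 2) * d1 x) + (LINT x|lborel. q (x $ 1) (x $ 2) * d2 x) =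
      (LINT x|lborel. p (x $ 1) (x $ 2) * d1 x + q (x $ 1) (x $ 2) * d2 x)"
  proof (rule Bochner_Integration.integral_add[symmetric])
    show "integrable lborel (\<lambda>x. p (x $ 1) (x $ 2) * d1 x)"
      by (rule Bochner_Integration.integrable_bound[of _ "\<lambda>x. C * d1 x"])
        (use integrable_d1 b in \<open>auto simp: abs_mult intro!: AE_I2 C\<close>)
    show "integrable lborel (\<lambda>x. q (x $ 1) (x $ 2) * d2 x)"
      by (rule Bochner_Integration.integrable_bound[of _ "\<lambda>x. C * d2 x"])
        (use integrable_d2 b in \<open>auto simp: abs_mult intro!: AE_I2 C\<close>)
  qed
  finally show ?thesis .
qed

text \<open>The \<open>L1\<close> norm of the gradient of \<open>rho\<close>, with the absolute
  values of its components added. It serves as the uniform bound for the singular integrals of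
  \<open>rho\<close>.\<close>

definition grad_mass :: real where
  "grad_mass = 2 * (LINT x|lborel. \<bar>d1 x\<bar> + \<bar>d2 x\<bar>)"

text \<open>In the plane the unit radial field around \<open>x\<close> has divergence
  \<open>1 / |x - y|\<close>. With \<open>s\<close> for the regularised distance, its regularisation
  has length below 1 and divergence \<open>2 / s - (s^2 - e^2) / s^3\<close>, at least
  \<open>1 / s\<close>; so the integral of \<open>1 / s\<close> against \<open>rho\<close> is at
  most the \<open>L1\<close> norm of the gradient.\<close>

lemma regularised_potential_bound:
  assumes e: "0 < e"
  shows "(LINT y|mu. 1 / sqrt ((norm (x - y))\<^sup>2 + e\<^sup>2)) \<le> grad_mass"
proof -
  define s where "s a b = sqrt ((a - x $ 1)\<^sup>2 + (b - x $ 2)\<^sup>2 + e\<^sup>2)" for a b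
  define p where "p a b = (a - x $ 1) / s a b" for a b
  define q where "q a b = (b - x $ 2) / s a b" for a b
  define p' where "p' a b = 1 / s a b - (a - x $ 1)\<^sup>2 / (s a b) ^ 3" for a b
  define q' where "q' a b = 1 / s a b - (b - x $ 2)\<^sup>2 / (s a b) ^ 3" for a b
  have s2: "(s a b)\<^sup>2 = (a - x $ 1)\<^sup>2 + (b - x $ 2)\<^sup>2 + e\<^sup>2" for a b
    unfolding s_def by (simp add: real_sqrt_pow2)
  have se: "e \<le> s a b" for a b unfolding s_def by (rule real_le_rsqrt) (use e in auto)
  have sp: "0 < s a b" for a b using se[of a b] e by linarith
  have ds1: "((\<lambda>a. s a b) has_real_derivative (a - x $ 1) / s a b) (at a)" for a b
  proof -
    have "0 < (a - x $ 1)\<^sup>2 + (b - x $ 2)\<^sup>2 + e\<^sup>2" using e by (simp add: add_nonneg_pos)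
    then show ?thesis unfolding s_def by (auto intro!: derivative_eq_intros simp: field_simps)
  qed
  have ds2: "((\<lambda>b. s a b) has_real_derivative (b - x $ 2) / s a b) (at b)" for a b
  proof -
    have "0 < (a - x $ 1)\<^sup>2 + (b - x $ 2)\<^sup>2 + e\<^sup>2" using e by (simp add: add_nonneg_pos)
    then show ?thesis unfolding s_def by (auto intro!: derivative_eq_intros simp: field_simps)
  qed
  have bnd: "\<bar>v / r\<bar> \<le> 1" "0 \<le> 1 / r - v\<^sup>2 / r ^ 3" "1 / r - v\<^sup>2 / r ^ 3 \<le> 1 / e" if "v\<^sup>2 \<le> r\<^sup>2" "e \<le> r" for v r :: real
  proof -
    have r: "0 < r" using that e by linarith
    have "\<bar>v\<bar> \<le> r" using that r by (simp add: abs_le_square_iff[symmetric])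
    then show "\<bar>v / r\<bar> \<le> 1" using r by (simp add: abs_divide)
    have "v\<^sup>2 / r ^ 3 \<le> r\<^sup>2 / r ^ 3" using that r by (intro divide_right_mono) auto
    also have "\<dots> = 1 / r" using r by (simp add: power3_eq_cube power2_eq_square)
    finally show "0 \<le> 1 / r - v\<^sup>2 / r ^ 3" by simp
    have "1 / r \<le> 1 / e" using that e by (intro frac_le) auto
    moreover have "0 \<le> v\<^sup>2 / r ^ 3" using r by simp
    ultimately show "1 / r - v\<^sup>2 / r ^ 3 \<le> 1 / e" by linarith
  qed
  have v: "(a - x $ 1)\<^sup>2 \<le> (s a b)\<^sup>2" "(b - x $ 2)\<^sup>2 \<le> (s a b)\<^sup>2" for a b
    unfolding s2 by simp_all
  have cs: "continuous_on UNIV (\<lambda>y::real^2. s (y $ 1) (y $ 2))"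
    unfolding s_def by (intro continuous_intros)
  note sn = less_imp_neq[OF sp, THEN not_sym]
  have c: "continuous_on UNIV (\<lambda>y::real^2. p (y $ 1) (y $ 2))" "continuous_on UNIV (\<lambda>y::real^2. p' (y $ 1) (y $ 2))"
      "continuous_on UNIV (\<lambda>y::real^2. q (y $ 1) (y $ 2))" "continuous_on UNIV (\<lambda>y::real^2. q' (y $ 1) (y $ 2))"
    unfolding p_def q_def p'_def q'_def by (intro continuous_intros cs; simp add: sn)+
  \<comment> \<open>\<open>1 + 1 / e\<close> is a common bound for the field, which is at most 1,
    and for its derivatives, at most \<open>1 / e\<close>.\<close>
  have b: "\<bar>p a b\<bar> \<le> 1 + 1 / e" "\<bar>q a b\<bar> \<le> 1 + 1 / e" "\<bar>p' a b\<bar> \<le> 1 + 1 / e" "\<bar>q' a b\<bar> \<le> 1 + 1 / e" for a b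
    using bnd[OF v(1)[of a b] se] bnd[OF v(2)[where a = a and b = b] se] e unfolding p_def q_def p'_def q'_def
    by (auto simp: abs_of_nonneg intro: order_trans add_increasing add_increasing2)
  have div: "(LINT y|mu. p' (y $ 1) (y $ 2) + q' (y $ 1) (y $ 2)) =
    - 2 * (LINT y|lborel. p (y $ 1) (y $ 2) * d1 y + q (y $ 1) (y $ 2) * d2 y)"
  proof (rule divergence_identity[OF _ _ c b(1,3,2,4)])
    show "((\<lambda>a. p a b) has_real_derivative p' a b) (at a)" for a b
      unfolding p_def p'_def using sp[of a b]
      by (auto intro!: derivative_eq_intros ds1 simp: power2_eq_square power3_eq_cube field_simps)
    show "((\<lambda>b. q a b) has_real_derivative q' a b) (at b)" for a b
      unfolding q_def q'_def using sp[of a b]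
      by (auto intro!: derivative_eq_intros ds2 simp: power2_eq_square power3_eq_cube field_simps)
  qed
  note [measurable] = borel_measurable_continuous_onI[OF c(1)] borel_measurable_continuous_onI[OF c(2)]
     borel_measurable_continuous_onI[OF c(3)] borel_measurable_continuous_onI[OF c(4)] borel_measurable_continuous_onI[OF cs]
  have "(LINT y|mu. 1 / sqrt ((norm (x - y))\<^sup>2 + e\<^sup>2)) = (LINT y|mu. 1 / s (y $ 1) (y $ 2))"
    by (simp add: s_def norm_power2_plane power2_commute)
  also have "\<dots> \<le> (LINT y|mu. p' (y $ 1) (y $ 2) + q' (y $ 1) (y $ 2))"
  proof (rule integral_mono)
    show "integrable mu (\<lambda>y. 1 / s (y $ 1) (y $ 2))"
      by (rule integrable_mu_bounded[where C = "1 / e"]) (use se sp e in \<open>auto intro!: divide_left_mono simp: abs_of_pos less_imp_le\<close>)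
    show "integrable mu (\<lambda>y. p' (y $ 1) (y $ 2) + q' (y $ 1) (y $ 2))"
      by (intro Bochner_Integration.integrable_add; rule integrable_mu_bounded[where C = "1 + 1 / e"]; use b in simp)
    fix y :: "real^2"
    let ?a = "y $ 1" and ?b = "y $ 2"
    have "(?a - x $ 1)\<^sup>2 / (s ?a ?b) ^ 3 + (?b - x $ 2)\<^sup>2 / (s ?a ?b) ^ 3 = ((?a - x $ 1)\<^sup>2 + (?b - x $ 2)\<^sup>2) / (s ?a ?b) ^ 3"
      by (simp add: add_divide_distrib)
    also have "\<dots> \<le> (s ?a ?b)\<^sup>2 / (s ?a ?b) ^ 3"
      unfolding s2 using sp[of ?a ?b] by (intro divide_right_mono) auto
    also have "\<dots> = 1 / s ?a ?b" using sp[of ?a ?b] by (simp add: power3_eq_cube power2_eq_square)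
    finally show "1 / s ?a ?b \<le> p' ?a ?b + q' ?a ?b" unfolding p'_def q'_def by simp
  qed
  also have "\<dots> \<le> 2 * (LINT y|lborel. \<bar>p (y $ 1) (y $ 2) * d1 y + q (y $ 1) (y $ 2) * d2 y\<bar>)"
    unfolding div using integral_abs_bound[of lborel "\<lambda>y. p (y $ 1) (y $ 2) * d1 y + q (y $ 1) (y $ 2) * d2 y"] by linarith
  also have "\<dots> \<le> grad_mass"
    unfolding grad_mass_def
  proof (intro mult_left_mono integral_mono')
    show "integrable lborel (\<lambda>y. \<bar>d1 y\<bar> + \<bar>d2 y\<bar>)" using integrable_d1 integrable_d2 by auto
    fix y :: "real^2"
    have "\<bar>p (y $ 1) (y $ 2)\<bar> \<le> 1" "\<bar>q (y $ 1) (y $ 2)\<bar> \<le> 1"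
      unfolding p_def q_def using bnd(1)[OF v(1) se] bnd(1)[OF v(2) se] by auto
    then have "\<bar>p (y $ 1) (y $ 2)\<bar> * \<bar>d1 y\<bar> \<le> 1 * \<bar>d1 y\<bar>" "\<bar>q (y $ 1) (y $ 2)\<bar> * \<bar>d2 y\<bar> \<le> 1 * \<bar>d2 y\<bar>"
      by (intro mult_right_mono; simp)+
    then show "\<bar>p (y $ 1) (y $ 2) * d1 y + q (y $ 1) (y $ 2) * d2 y\<bar> \<le> \<bar>d1 y\<bar> + \<bar>d2 y\<bar>"
      using abs_triangle_ineq[of "p (y $ 1) (y $ 2) * d1 y" "q (y $ 1) (y $ 2) * d2 y"] by (simp add: abs_mult)
  qed auto
  finally show ?thesis .
qed

lemma nn_potential_bound: "(\<integral>\<^sup>+y. ennreal (1 / norm (x - y)) \<partial>mu) \<le> ennreal grad_mass"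
proof -
  let ?e = "\<lambda>k. 1 / real (Suc k)"
  have e0: "?e \<longlonglongrightarrow> 0" using LIMSEQ_inverse_real_of_nat by (simp add: inverse_eq_divide)
  have bd: "(\<integral>\<^sup>+y. ennreal (1 / sqrt ((norm (x - y))\<^sup>2 + (?e k)\<^sup>2)) \<partial>mu) \<le> ennreal grad_mass" for k
  proof -
    have "integrable mu (\<lambda>y. 1 / sqrt ((norm (x - y))\<^sup>2 + (?e k)\<^sup>2))"
    proof (rule integrable_mu_bounded[where C = "1 / ?e k"])
      fix y
      have "?e k \<le> sqrt ((norm (x - y))\<^sup>2 + (?e k)\<^sup>2)" by (rule real_le_rsqrt) auto
      then show "\<bar>1 / sqrt ((norm (x - y))\<^sup>2 + (?e k)\<^sup>2)\<bar> \<le> 1 / ?e k"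
        by (simp only: abs_divide abs_one) (rule frac_le, auto)
    qed measurable
    then have "(\<integral>\<^sup>+y. ennreal (1 / sqrt ((norm (x - y))\<^sup>2 + (?e k)\<^sup>2)) \<partial>mu) = ennreal (LINT y|mu. 1 / sqrt ((norm (x - y))\<^sup>2 + (?e k)\<^sup>2))"
      by (rule nn_integral_eq_integral) auto
    also have "\<dots> \<le> ennreal grad_mass" by (intro ennreal_leI regularised_potential_bound) simp
    finally show ?thesis .
  qed
  have "(\<integral>\<^sup>+y. ennreal (1 / norm (x - y)) \<partial>mu) \<le> (\<integral>\<^sup>+y. liminf (\<lambda>k. ennreal (1 / sqrt ((norm (x - y))\<^sup>2 + (?e k)\<^sup>2))) \<partial>mu)"
  proof (rule nn_integral_mono)
    fix y
    show "ennreal (1 / norm (x - y)) \<le> liminf (\<lambda>k. ennreal (1 / sqrt ((norm (x - y))\<^sup>2 + (?e k)\<^sup>2)))"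
    \<comment> \<open>At \<open>y = x\<close> the left side is \<open>1 / 0 = 0\<close>.\<close>
    proof (cases "x = y")
      case False
      have "(\<lambda>k. 1 / sqrt ((norm (x - y))\<^sup>2 + (?e k)\<^sup>2)) \<longlonglongrightarrow> 1 / sqrt ((norm (x - y))\<^sup>2 + 0\<^sup>2)"
        by (intro tendsto_intros e0) (use False in auto)
      then have "(\<lambda>k. ennreal (1 / sqrt ((norm (x - y))\<^sup>2 + (?e k)\<^sup>2))) \<longlonglongrightarrow> ennreal (1 / norm (x - y))"
        by (intro tendsto_ennrealI) simp
      then show ?thesis using lim_imp_Liminf[OF trivial_limit_sequentially] by (metis order_refl)
    qed simp
  qed
  also have "\<dots> \<le> liminf (\<lambda>k. \<integral>\<^sup>+y. ennreal (1 / sqrt ((norm (x - y))\<^sup>2 + (?e k)\<^sup>2)) \<partial>mu)"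
    by (rule nn_integral_liminf) measurable
  also have "\<dots> \<le> ennreal grad_mass"
    using Liminf_mono[OF always_eventually[OF allI[OF bd]], of sequentially] by (simp add: Liminf_const)
  finally show ?thesis .
qed

lemma grad_mass_nonneg: "0 \<le> grad_mass"
  unfolding grad_mass_def by simp

lemma integrable_potential: "integrable mu (\<lambda>y. 1 / norm (x - y))"
proof (rule integrableI_bounded)
  have "(\<integral>\<^sup>+y. ennreal (norm (1 / norm (x - y))) \<partial>mu) \<le> ennreal grad_mass"
    using nn_potential_bound[of x] by simp
  then show "(\<integral>\<^sup>+y. ennreal (norm (1 / norm (x - y))) \<partial>mu) < \<infinity>"
    using le_less_trans ennreal_less_top infinity_ennreal_def by metis
qed measurable

lemma potential_bound: "(LINT y|mu. 1 / norm (x - y)) \<le> grad_mass"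
  using nn_potential_bound[of x] grad_mass_nonneg
  by (subst (asm) nn_integral_eq_integral[OF integrable_potential]) (auto simp: ennreal_le_iff)

end

text \<open>\<open>r\<close> is only integrable, so \<open>r^2\<close> may have infinite integral
  and the estimate stays in \<open>ennreal\<close>. For the truncation \<open>t = min r m\<close>
  the shift costs at most \<open>m\<close> times the \<open>L1\<close> distance between
  \<open>t\<close> and its translate, which tends to 0; letting \<open>m\<close> grow recovers
  \<open>r\<close>.\<close>

lemma nn_integral_square_le_liminf_autocorrelation:
  fixes r :: "'a::euclidean_space \<Rightarrow> real"
  assumes r: "integrable lborel r" and nonneg: "\<And>x. 0 \<le> r x" and h: "h \<longlonglongrightarrow> 0"
  shows "(\<integral>\<^sup>+y. ennreal ((r y)\<^sup>2) \<partial>lborel) \<le> liminf (\<lambda>n. \<integral>\<^sup>+y. ennreal (r y * r (h n + y)) \<partial>lborel)" (is "_ \<le> ?L")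
proof -
  have [measurable]: "r \<in> borel_measurable borel" using r by (auto dest: borel_measurable_integrable)
  define t where "t m x = min (r x) (real m)" for m :: nat and x
  have t: "0 \<le> t m x" "t m x \<le> real m" "t m x \<le> r x" for m x using nonneg by (auto simp: t_def)
  have [measurable]: "t m \<in> borel_measurable borel" for m unfolding t_def[abs_def] by measurable
  have ti: "integrable lborel (t m)" for m
    by (rule Bochner_Integration.integrable_bound[OF r]) (use t nonneg in auto)
  have ti2: "integrable lborel (\<lambda>x. t m x * t m (k + x))" for m k
  proof (rule Bochner_Integration.integrable_bound)
    show "integrable lborel (\<lambda>x. real m * t m x)" using ti by simp
    show "AE x in lborel. norm (t m x * t m (k + x)) \<le> norm (real m * t m x)"
      using t by (auto simp: abs_mult mult.commute[of "real m"] intro!: mult_left_mono)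
  qed measurable
  have tdi: "integrable lborel (\<lambda>x. \<bar>t m (k + x) - t m x\<bar>)" for m k
    using ti lborel_integrable_translate_iff[of "t m" k] by (intro integrable_abs Bochner_Integration.integrable_diff) auto
  have "(\<integral>\<^sup>+y. ennreal ((t m y)\<^sup>2) \<partial>lborel) \<le> ?L" for m
  proof -
    have t2: "integrable lborel (\<lambda>x. (t m x)\<^sup>2)" using ti2[of m 0] by (simp add: power2_eq_square)
    have lim: "(\<lambda>n. (LINT x|lborel. (t m x)\<^sup>2) - real m * (LINT x|lborel. \<bar>t m (h n + x) - t m x\<bar>)) \<longlonglongrightarrow> (LINT x|lborel. (t m x)\<^sup>2) - real m * 0"
      using translation_continuous_L1[OF ti h, of m] by (intro tendsto_intros) simp
    have le: "ennreal ((LINT x|lborel. (t m x)\<^sup>2) - real m * (LINT x|lborel. \<bar>t m (h n + x) - t m x\<bar>)) \<le> (\<integral>\<^sup>+y. ennreal (r y * r (h n + y)) \<partial>lborel)" for n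
    proof -
      have "(LINT x|lborel. (t m x)\<^sup>2) - real m * (LINT x|lborel. \<bar>t m (h n + x) - t m x\<bar>) = (LINT x|lborel. (t m x)\<^sup>2 - real m * \<bar>t m (h n + x) - t m x\<bar>)"
        using t2 tdi by simp
      also have "\<dots> \<le> (LINT x|lborel. t m x * t m (h n + x))"
      proof (rule integral_mono)
        show "integrable lborel (\<lambda>x. (t m x)\<^sup>2 - real m * \<bar>t m (h n + x) - t m x\<bar>)" using t2 tdi by simp
        fix x
        have "t m x * (t m x - t m (h n + x)) \<le> t m x * \<bar>t m (h n + x) - t m x\<bar>" using t by (intro mult_left_mono) auto
        also have "\<dots> \<le> real m * \<bar>t m (h n + x) - t m x\<bar>" using t by (intro mult_right_mono) auto
        finally show "(t m x)\<^sup>2 - real m * \<bar>t m (h n + x) - t m x\<bar> \<le> t m x * t m (h n + x)" by (simp add: power2_eq_square algebra_simps)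
      qed (rule ti2)
      finally have "ennreal ((LINT x|lborel. (t m x)\<^sup>2) - real m * (LINT x|lborel. \<bar>t m (h n + x) - t m x\<bar>)) \<le> ennreal (LINT x|lborel. t m x * t m (h n + x))"
        by (rule ennreal_leI)
      also have "\<dots> = (\<integral>\<^sup>+y. ennreal (t m y * t m (h n + y)) \<partial>lborel)"
        using t by (intro nn_integral_eq_integral[symmetric] ti2) auto
      also have "\<dots> \<le> (\<integral>\<^sup>+y. ennreal (r y * r (h n + y)) \<partial>lborel)"
        using t nonneg by (intro nn_integral_mono ennreal_leI mult_mono) auto
      finally show ?thesis .
    qed
    have "(\<integral>\<^sup>+y. ennreal ((t m y)\<^sup>2) \<partial>lborel) = ennreal (LINT x|lborel. (t m x)\<^sup>2)"
      by (intro nn_integral_eq_integral t2) auto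
    also have "\<dots> = liminf (\<lambda>n. ennreal ((LINT x|lborel. (t m x)\<^sup>2) - real m * (LINT x|lborel. \<bar>t m (h n + x) - t m x\<bar>)))"
      using lim_imp_Liminf[OF trivial_limit_sequentially tendsto_ennrealI[OF lim]] by simp
    also have "\<dots> \<le> ?L" by (intro Liminf_mono always_eventually allI le)
    finally show ?thesis .
  qed
  note tle = this
  have "(\<integral>\<^sup>+y. ennreal ((r y)\<^sup>2) \<partial>lborel) = (\<integral>\<^sup>+y. liminf (\<lambda>m. ennreal ((t m y)\<^sup>2)) \<partial>lborel)"
  proof (rule nn_integral_cong)
    fix y
    obtain M where M: "r y \<le> real M" using real_arch_simple by blast
    have "(\<lambda>m. ennreal ((t m y)\<^sup>2)) \<longlonglongrightarrow> ennreal ((r y)\<^sup>2)"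
      by (rule tendsto_eventually) (use M in \<open>auto simp: eventually_sequentially t_def min_def intro!: exI[of _ M]\<close>)
    then show "ennreal ((r y)\<^sup>2) = liminf (\<lambda>m. ennreal ((t m y)\<^sup>2))"
      using lim_imp_Liminf[OF trivial_limit_sequentially] by metis
  qed
  also have "\<dots> \<le> liminf (\<lambda>m. \<integral>\<^sup>+y. ennreal ((t m y)\<^sup>2) \<partial>lborel)"
    by (rule nn_integral_liminf) measurable
  also have "\<dots> \<le> ?L"
    using Liminf_mono[OF always_eventually[OF allI[OF tle]], of sequentially] by (simp add: Liminf_const)
  finally show ?thesis .
qed

lemma nn_integral_scale_plane:
  fixes f :: "real^2 \<Rightarrow> ennreal"
  assumes [measurable]: "f \<in> borel_measurable borel" and c: "0 < c"
  shows "(\<integral>\<^sup>+x. f x \<partial>lborel) = ennreal (c\<^sup>2) * (\<integral>\<^sup>+z. f (y + c *\<^sub>R z) \<partial>lborel)"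
proof -
  have "(\<integral>\<^sup>+x. f x \<partial>lborel) = (\<integral>\<^sup>+x. f x \<partial>(density (distr lborel borel (\<lambda>x. y + c *\<^sub>R x)) (\<lambda>_. ennreal (\<bar>c\<bar> ^ DIM(real^2)))))"
    using lborel_affine[of c y] c by simp
  also have "\<dots> = (\<integral>\<^sup>+z. ennreal (\<bar>c\<bar> ^ DIM(real^2)) * f (y + c *\<^sub>R z) \<partial>lborel)"
    by (simp add: nn_integral_density nn_integral_distr)
  also have "\<dots> = ennreal (\<bar>c\<bar> ^ DIM(real^2)) * (\<integral>\<^sup>+z. f (y + c *\<^sub>R z) \<partial>lborel)"
    by (rule nn_integral_cmult) measurable
  finally show ?thesis using c by (simp add: power2_eq_square)
qed

text \<open>Layer-cake: \<open>1 / (1 + |z|^2)^2\<close> is the integral of \<open>2 / (1 + t)^3\<close> over \<open>t \<ge> |z|^2\<close>.\<close>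

lemma nn_integral_plane_kernel: "(\<integral>\<^sup>+z. ennreal (1 / (1 + (norm (z::real^2))\<^sup>2)\<^sup>2) \<partial>lborel) = ennreal pi"
proof -
  have l1: "((\<lambda>t::real. - 1 / (1 + t)\<^sup>2) \<longlongrightarrow> 0) at_top" by real_asymp
  have l2: "((\<lambda>t::real. pi * (t\<^sup>2 / (1 + t)\<^sup>2)) \<longlongrightarrow> pi) at_top" by real_asymp
  have a: "(\<integral>\<^sup>+t. ennreal (2 / (1 + t) ^ 3) * indicator {s ..} t \<partial>lborel) = ennreal (1 / (1 + s)\<^sup>2)" if "0 \<le> s" for s :: real
  proof -
    have "(\<integral>\<^sup>+t. ennreal (2 / (1 + t) ^ 3) * indicator {s ..} t \<partial>lborel) = ennreal (0 - (- 1 / (1 + s)\<^sup>2))"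
    proof (rule nn_integral_FTC_atLeast[OF _ _ _ l1])
      fix t assume "s \<le> t"
      then have p: "0 < 1 + t" using that by linarith
      then show "0 \<le> 2 / (1 + t) ^ 3" by simp
      show "((\<lambda>t. - 1 / (1 + t)\<^sup>2) has_real_derivative 2 / (1 + t) ^ 3) (at t)"
        using p by (auto intro!: derivative_eq_intros) (simp add: divide_simps, simp add: power2_eq_square power3_eq_cube power4_eq_xxxx algebra_simps)
    qed measurable
    then show ?thesis by simp
  qed
  \<comment> \<open>The area \<open>pi t\<close> of the disc of radius \<open>sqrt t\<close> turns
    the layer-cake weight into this integrand, with antiderivative
    \<open>pi t^2 / (1 + t)^2\<close>.\<close>
  have b: "(\<integral>\<^sup>+t. ennreal (2 * pi * t / (1 + t) ^ 3) * indicator {0 ..} t \<partial>lborel) = ennreal pi"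
  proof -
    have "(\<integral>\<^sup>+t. ennreal (2 * pi * t / (1 + t) ^ 3) * indicator {0 ..} t \<partial>lborel) = ennreal (pi - pi * (0\<^sup>2 / (1 + 0)\<^sup>2))"
    proof (rule nn_integral_FTC_atLeast[OF _ _ _ l2])
      fix t :: real assume t: "0 \<le> t"
      then show "0 \<le> 2 * pi * t / (1 + t) ^ 3" by simp
      show "((\<lambda>t. pi * (t\<^sup>2 / (1 + t)\<^sup>2)) has_real_derivative 2 * pi * t / (1 + t) ^ 3) (at t)"
        using t by (auto intro!: derivative_eq_intros) (simp add: divide_simps, simp add: algebra_simps power2_eq_square power3_eq_cube power4_eq_xxxx)
    qed measurable
    then show ?thesis by simp
  qed
  have "(\<integral>\<^sup>+z. ennreal (1 / (1 + (norm (z::real^2))\<^sup>2)\<^sup>2) \<partial>lborel) = (\<integral>\<^sup>+z. \<integral>\<^sup>+t. ennreal (2 / (1 + t) ^ 3) * indicator {(norm (z::real^2))\<^sup>2 ..} t \<partial>lborel \<partial>lborel)"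
    by (simp add: a)
  also have "\<dots> = (\<integral>\<^sup>+z. \<integral>\<^sup>+t. ennreal (2 / (1 + t) ^ 3) * (if (norm (z::real^2))\<^sup>2 \<le> t then 1 else 0) \<partial>lborel \<partial>lborel)"
    by (simp add: indicator_def of_bool_def)
  also have "\<dots> = (\<integral>\<^sup>+t. \<integral>\<^sup>+z. ennreal (2 / (1 + t) ^ 3) * (if (norm (z::real^2))\<^sup>2 \<le> t then 1 else 0) \<partial>lborel \<partial>lborel)"
    by (rule lborel_pair.Fubini'[symmetric]) measurable
  also have "\<dots> = (\<integral>\<^sup>+t. ennreal (2 * pi * t / (1 + t) ^ 3) * indicator {0 ..} t \<partial>lborel)"
  proof (rule nn_integral_cong)
    fix t :: real
    have "(\<integral>\<^sup>+z. ennreal (2 / (1 + t) ^ 3) * (if (norm (z::real^2))\<^sup>2 \<le> t then 1 else 0) \<partial>lborel)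
       = ennreal (2 / (1 + t) ^ 3) * (\<integral>\<^sup>+z. (if (norm (z::real^2))\<^sup>2 \<le> t then 1 else 0) \<partial>lborel)"
      by (rule nn_integral_cmult) measurable
    also have "\<dots> = ennreal (2 * pi * t / (1 + t) ^ 3) * indicator {0 ..} t"
    proof (cases "0 \<le> t")
      case True
      have "(\<lambda>z::real^2. (if (norm z)\<^sup>2 \<le> t then 1 else 0 :: ennreal)) = indicator (cball 0 (sqrt t))"
      proof
        fix z :: "real^2"
        have "(norm z)\<^sup>2 \<le> t \<longleftrightarrow> norm z \<le> sqrt t"
          using True real_sqrt_le_iff[of "(norm z)\<^sup>2" t] by simp
        then show "(if (norm z)\<^sup>2 \<le> t then 1 else 0 :: ennreal) = indicator (cball 0 (sqrt t)) z"
          by (simp add: indicator_def)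
      qed
      then have "(\<integral>\<^sup>+z. (if (norm (z::real^2))\<^sup>2 \<le> t then 1 else 0) \<partial>lborel) = emeasure lborel (cball (0::real^2) (sqrt t))"
        by simp
      also have "\<dots> = ennreal (pi * t)"
        using True by (simp add: emeasure_cball unit_ball_vol_2)
      finally show ?thesis using True by (simp add: ennreal_mult[symmetric] algebra_simps)
    next
      case False
      then have "(\<lambda>z::real^2. (if (norm z)\<^sup>2 \<le> t then 1 else 0 :: ennreal)) = (\<lambda>_. 0)"
        using order_trans[OF zero_le_power2, of _ t] by (auto simp: fun_eq_iff)
      then show ?thesis using False by simp
    qed
    finally show "(\<integral>\<^sup>+z. ennreal (2 / (1 + t) ^ 3) * (if (norm (z::real^2))\<^sup>2 \<le> t then 1 else 0) \<partial>lborel) = ennreal (2 * pi * t / (1 + t) ^ 3) * indicator {0 ..} t" .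
  qed
  also have "\<dots> = ennreal pi" by (rule b)
  finally show ?thesis .
qed

section \<open>The kernel of the vector potential\<close>

lemma linear_perp: "linear perp"
  by (rule linearI) (simp_all add: perp_def vec_eq_iff forall_2)

lemma norm_perp: "norm (perp x) = norm x"
proof -
  have "(norm (perp x))\<^sup>2 = (norm x)\<^sup>2" unfolding norm_power2_plane by (simp add: perp_def)
  then show ?thesis by (simp add: power2_eq_iff_nonneg)
qed

lemma perp_measurable[measurable]: "perp \<in> borel_measurable borel"
  by (intro borel_measurable_continuous_onI linear_continuous_on) (simp add: linear_perp linear_conv_bounded_linear[symmetric])

text \<open>The gradient of \<open>log |z|\<close>, that is, \<open>2 pi\<close> times the gradient
  of the fundamental solution of the Laplacian in the plane; it takes the value 0 at the
  origin.\<close>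

definition kern :: "2 \<Rightarrow> real^2 \<Rightarrow> real" where "kern j z = z $ j / (norm z)\<^sup>2"

lemma kern_measurable[measurable]: "kern j \<in> borel_measurable borel"
  unfolding kern_def[abs_def] by measurable

lemma kern_bound: "\<bar>kern j z\<bar> \<le> 1 / norm z"
proof (cases "z = 0")
  case False
  have "\<bar>z $ j\<bar> * norm z \<le> norm z * norm z" using component_le_norm_cart[of z j] by (intro mult_right_mono) auto
  then show ?thesis using False by (simp add: kern_def abs_divide power2_eq_square divide_simps)
qed (simp add: kern_def)

context H1_function
begin

definition V :: "2 \<Rightarrow> real^2 \<Rightarrow> real" where "V j x = (LINT y|mu. kern j (x - y))"

lemma integrable_kern: "integrable mu (\<lambda>y. kern j (x - y))"
  by (rule Bochner_Integration.integrable_bound[OF integrable_potential[of x]]) (use kern_bound in auto)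

lemma sigma_finite_mu: "sigma_finite_measure mu" ..

lemma V_measurable[measurable]: "V j \<in> borel_measurable borel"
  unfolding V_def[abs_def] by (rule sigma_finite_measure.borel_measurable_lebesgue_integral[OF sigma_finite_mu]) measurable

lemma V_bound: "\<bar>V j x\<bar> \<le> grad_mass"
proof -
  have "\<bar>V j x\<bar> \<le> (LINT y|mu. \<bar>kern j (x - y)\<bar>)" unfolding V_def by (rule integral_abs_bound)
  also have "\<dots> \<le> (LINT y|mu. 1 / norm (x - y))"
    by (intro integral_mono integrable_abs integrable_kern integrable_potential kern_bound)
  finally show ?thesis using potential_bound[of x] by linarith
qed

text \<open>The principal value is in fact an absolutely convergent integral at every point: the
  truncated integrands are dominated by \<open>rho y / |x - y|\<close>, which is integrable by the
  potential bound. Rotating the kernel by a quarter turn permutes the components of \<open>V\<close>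
  up to sign.\<close>

lemma magnetic_potential_eq: "magnetic_potential rho x = vector [- V 2 x, V 1 x]"
proof -
  let ?f = "\<lambda>y. (rho y / (norm (x - y))\<^sup>2) *\<^sub>R perp (x - y)"
  have dom: "integrable lborel (\<lambda>y. rho y * (1 / norm (x - y)))"
    using integrable_potential[of x] by (subst (asm) integrable_mu_iff) auto
  have fb: "norm (?f y) \<le> rho y * (1 / norm (x - y))" for y
    by (simp add: norm_perp rho_nonneg power2_eq_square)
  have fi: "integrable lborel ?f"
    by (rule Bochner_Integration.integrable_bound[OF dom]) (use fb rho_nonneg in \<open>auto intro!: AE_I2 order_trans[OF fb]\<close>)
  have "((\<lambda>\<epsilon>. LINT y:{y. \<epsilon> < norm (x - y)}|lebesgue. ?f y) \<longlongrightarrow> (LINT y|lborel. ?f y)) (at_right 0)"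
    unfolding tendsto_at_iff_sequentially
  proof (intro allI impI)
    fix e :: "nat \<Rightarrow> real" assume e: "\<forall>i. e i \<in> {0<..} - {0}" "e \<longlonglongrightarrow> 0"
    have eq: "(LINT y:{y. e n < norm (x - y)}|lebesgue. ?f y) = (LINT y|lborel. indicator {y. e n < norm (x - y)} y *\<^sub>R ?f y)" for n
      unfolding set_lebesgue_integral_def by (rule integral_completion) measurable
    have "(\<lambda>n. LINT y|lborel. indicator {y. e n < norm (x - y)} y *\<^sub>R ?f y) \<longlonglongrightarrow> (LINT y|lborel. ?f y)"
    proof (rule integral_dominated_convergence[OF _ _ dom])
      show "AE y in lborel. (\<lambda>n. indicator {y. e n < norm (x - y)} y *\<^sub>R ?f y) \<longlonglongrightarrow> ?f y"
      proof (rule AE_I2)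
        fix y
        show "(\<lambda>n. indicator {y. e n < norm (x - y)} y *\<^sub>R ?f y) \<longlonglongrightarrow> ?f y"
        proof (cases "x = y")
          case False
          then have "\<forall>\<^sub>F n in sequentially. e n < norm (x - y)" using order_tendstoD(2)[OF e(2)] by auto
          then show ?thesis by (intro tendsto_eventually) (auto elim: eventually_mono)
        qed simp
      qed
      show "AE y in lborel. norm (indicator {y. e n < norm (x - y)} y *\<^sub>R ?f y) \<le> rho y * (1 / norm (x - y))" for n
        using fb rho_nonneg by (intro AE_I2) (auto simp: indicator_def simp del: norm_scaleR)
    qed measurable
    then show "((\<lambda>\<epsilon>. LINT y:{y. \<epsilon> < norm (x - y)}|lebesgue. ?f y) \<circ> e) \<longlonglongrightarrow> (LINT y|lborel. ?f y)"
      unfolding o_def eq .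
  qed
  then have "magnetic_potential rho x = (LINT y|lborel. ?f y)"
    unfolding magnetic_potential_def by (intro tendsto_Lim) auto
  also have "\<dots> = vector [- V 2 x, V 1 x]"
  proof -
    have c: "(LINT y|lborel. ?f y) $ j = (LINT y|lborel. ?f y $ j)" for j
      by (rule integral_bounded_linear[OF bounded_linear_vec_nth fi, symmetric])
    have "(\<lambda>y. ?f y $ 1) = (\<lambda>y. - (rho y * kern 2 (x - y)))" "(\<lambda>y. ?f y $ 2) = (\<lambda>y. rho y * kern 1 (x - y))"
      by (auto simp: perp_def kern_def fun_eq_iff minus_divide_left algebra_simps)
    then have "(LINT y|lborel. ?f y $ 1) = - V 2 x" "(LINT y|lborel. ?f y $ 2) = V 1 x"
      by (simp_all add: V_def integral_mu)
    then show ?thesis by (simp add: vec_eq_iff forall_2 c)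
  qed
  finally show ?thesis .
qed

end

text \<open>The gradient of \<open>1/2 * log (|z|^2 + e^2)\<close>, a smooth field for
  \<open>e > 0\<close>, with the same majorant \<open>1 / |z|\<close> as \<open>kern\<close> and a
  divergence known in closed form.\<close>

definition kern_reg :: "real \<Rightarrow> 2 \<Rightarrow> real^2 \<Rightarrow> real" where "kern_reg e j z = z $ j / ((norm z)\<^sup>2 + e\<^sup>2)"

lemma kern_reg_measurable[measurable]: "kern_reg e j \<in> borel_measurable borel"
  unfolding kern_reg_def[abs_def] by measurable

lemma kern_reg_bound: "\<bar>kern_reg e j z\<bar> \<le> 1 / norm z"
proof (cases "z = 0")
  case False
  have "\<bar>z $ j\<bar> * norm z \<le> norm z * norm z" using component_le_norm_cart[of z j] by (intro mult_right_mono) auto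
  then have "\<bar>z $ j\<bar> * norm z \<le> (norm z)\<^sup>2 + e\<^sup>2" by (simp add: power2_eq_square add_increasing2)
  moreover have "0 < (norm z)\<^sup>2 + e\<^sup>2" using False by (simp add: add_pos_nonneg)
  ultimately show ?thesis using False by (simp add: kern_reg_def abs_divide divide_simps)
qed (simp add: kern_reg_def)

lemma abs_divide_sum_squares_bound:
  fixes v r e :: real
  assumes "v\<^sup>2 + e\<^sup>2 \<le> r" and e: "0 < e"
  shows "\<bar>v / r\<bar> \<le> 1 / e"
proof -
  have r: "0 < r" using assms by (smt (verit) zero_le_power2 zero_less_power)
  have "2 * (\<bar>v\<bar> * e) \<le> v\<^sup>2 + e\<^sup>2" using zero_le_power2[of "\<bar>v\<bar> - e"] by (simp add: power2_eq_square algebra_simps)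
  then have "\<bar>v\<bar> * e \<le> r" using assms by (smt (verit) mult_nonneg_nonneg)
  then show ?thesis using r e by (simp add: abs_divide divide_simps)
qed

context H1_function
begin

lemma regularised_flux:
  assumes e: "0 < e"
  shows "(LINT x|mu. 2 * e\<^sup>2 / ((norm (x - y))\<^sup>2 + e\<^sup>2)\<^sup>2) =
    - 2 * (LINT x|lborel. kern_reg e 1 (x - y) * d1 x + kern_reg e 2 (x - y) * d2 x)"
proof -
  define r where "r a b = (a - y $ 1)\<^sup>2 + (b - y $ 2)\<^sup>2 + e\<^sup>2" for a b
  define p where "p a b = (a - y $ 1) / r a b" for a b
  define q where "q a b = (b - y $ 2) / r a b" for a b
  define p' where "p' a b = 1 / r a b - 2 * (a - y $ 1)\<^sup>2 / (r a b)\<^sup>2" for a b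
  define q' where "q' a b = 1 / r a b - 2 * (b - y $ 2)\<^sup>2 / (r a b)\<^sup>2" for a b
  have re: "e\<^sup>2 \<le> r a b" for a b unfolding r_def by simp
  have e2: "0 < e\<^sup>2" using e by simp
  have rp: "0 < r a b" for a b using re[of a b] e2 by linarith
  note rn = less_imp_neq[OF rp, THEN not_sym]
  have dr: "((\<lambda>a. r a b) has_real_derivative 2 * (a - y $ 1)) (at a)" "((\<lambda>b. r a b) has_real_derivative 2 * (b - y $ 2)) (at b)" for a b
    unfolding r_def by (auto intro!: derivative_eq_intros)
  have cr: "continuous_on UNIV (\<lambda>x::real^2. r (x $ 1) (x $ 2))" unfolding r_def by (intro continuous_intros)
  have c: "continuous_on UNIV (\<lambda>x::real^2. p (x $ 1) (x $ 2))" "continuous_on UNIV (\<lambda>x::real^2. p' (x $ 1) (x $ 2))"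
      "continuous_on UNIV (\<lambda>x::real^2. q (x $ 1) (x $ 2))" "continuous_on UNIV (\<lambda>x::real^2. q' (x $ 1) (x $ 2))"
    unfolding p_def q_def p'_def q'_def by (intro continuous_intros cr; simp add: rn)+
  have bnd: "\<bar>1 / s - 2 * v\<^sup>2 / s\<^sup>2\<bar> \<le> 1 / e\<^sup>2" if "v\<^sup>2 \<le> s" "e\<^sup>2 \<le> s" for v s :: real
  proof -
    have s: "0 < s" using that e2 by linarith
    have "2 * v\<^sup>2 / s\<^sup>2 \<le> 2 * s / s\<^sup>2" using that s by (intro divide_right_mono mult_left_mono) auto
    also have "\<dots> = 2 * (1 / s)" using s by (simp add: power2_eq_square)
    finally have "2 * v\<^sup>2 / s\<^sup>2 \<le> 2 * (1 / s)" .
    moreover have "0 \<le> 2 * v\<^sup>2 / s\<^sup>2" by simp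
    moreover have "1 / s \<le> 1 / e\<^sup>2" using that e2 by (intro frac_le) auto
    ultimately show ?thesis by linarith
  qed
  have sq: "(a - y $ 1)\<^sup>2 \<le> r a b" "(b - y $ 2)\<^sup>2 \<le> r a b" for a b unfolding r_def by simp_all
  have ie: "0 \<le> 1 / e" "0 \<le> 1 / e\<^sup>2" using e by auto
  have b: "\<bar>p a b\<bar> \<le> 1 / e + 1 / e\<^sup>2" "\<bar>p' a b\<bar> \<le> 1 / e + 1 / e\<^sup>2" "\<bar>q a b\<bar> \<le> 1 / e + 1 / e\<^sup>2" "\<bar>q' a b\<bar> \<le> 1 / e + 1 / e\<^sup>2" for a b
  proof -
    have "\<bar>p a b\<bar> \<le> 1 / e" "\<bar>q a b\<bar> \<le> 1 / e"
      unfolding p_def q_def by (intro abs_divide_sum_squares_bound e; simp add: r_def)+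
    moreover have "\<bar>p' a b\<bar> \<le> 1 / e\<^sup>2" "\<bar>q' a b\<bar> \<le> 1 / e\<^sup>2"
      unfolding p'_def q'_def by (intro bnd sq re)+
    ultimately show "\<bar>p a b\<bar> \<le> 1 / e + 1 / e\<^sup>2" "\<bar>p' a b\<bar> \<le> 1 / e + 1 / e\<^sup>2" "\<bar>q a b\<bar> \<le> 1 / e + 1 / e\<^sup>2" "\<bar>q' a b\<bar> \<le> 1 / e + 1 / e\<^sup>2"
      using ie by linarith+
  qed
  have div: "(LINT x|mu. p' (x $ 1) (x $ 2) + q' (x $ 1) (x $ 2)) =
    - 2 * (LINT x|lborel. p (x $ 1) (x $ 2) * d1 x + q (x $ 1) (x $ 2) * d2 x)"
  proof (rule divergence_identity[OF _ _ c b])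
    show "((\<lambda>a. p a b) has_real_derivative p' a b) (at a)" for a b
      unfolding p_def p'_def using rn[of a b]
      by (auto intro!: derivative_eq_intros dr simp: field_simps power2_eq_square)
    show "((\<lambda>b. q a b) has_real_derivative q' a b) (at b)" for a b
      unfolding q_def q'_def using rn[of a b]
      by (auto intro!: derivative_eq_intros dr simp: field_simps power2_eq_square)
  qed
  have n: "(norm (x - y))\<^sup>2 + e\<^sup>2 = r (x $ 1) (x $ 2)" for x by (simp add: norm_power2_plane r_def)
  have "2 * e\<^sup>2 / ((norm (x - y))\<^sup>2 + e\<^sup>2)\<^sup>2 = p' (x $ 1) (x $ 2) + q' (x $ 1) (x $ 2)" for x
  proof -
    let ?r = "r (x $ 1) (x $ 2)"
    have "p' (x $ 1) (x $ 2) + q' (x $ 1) (x $ 2) = 2 / ?r - 2 * ((x $ 1 - y $ 1)\<^sup>2 + (x $ 2 - y $ 2)\<^sup>2) / ?r\<^sup>2"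
      unfolding p'_def q'_def by (simp add: add_divide_distrib algebra_simps)
    also have "(x $ 1 - y $ 1)\<^sup>2 + (x $ 2 - y $ 2)\<^sup>2 = ?r - e\<^sup>2" by (simp add: r_def)
    also have "2 / ?r - 2 * (?r - e\<^sup>2) / ?r\<^sup>2 = 2 * e\<^sup>2 / ?r\<^sup>2"
      using rn[of "x $ 1" "x $ 2"] by (simp add: divide_simps power2_eq_square)
    finally show ?thesis unfolding n by simp
  qed
  moreover have "kern_reg e 1 (x - y) = p (x $ 1) (x $ 2)" "kern_reg e 2 (x - y) = q (x $ 1) (x $ 2)" for x
    unfolding kern_reg_def n by (simp_all add: p_def q_def)
  ultimately show ?thesis using div by simp
qed

text \<open>Formally the integral of \<open>rho div V\<close> after an integration by parts, that
  is, \<open>2 pi\<close> times the integral of \<open>rho^2\<close>. Of this identity the lower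
  bound for \<open>flux\<close> is derived, the direction that Fatou provides.\<close>

definition flux :: real where
  "flux = - 2 * (LINT x|lborel. V 1 x * d1 x + V 2 x * d2 x)"

lemma pair_mu_lborel: "pair_sigma_finite mu (lborel :: (real^2) measure)"
  by (intro pair_sigma_finite.intro sigma_finite_mu sigma_finite_lborel)

lemma integrable_pair_mu_lborel:
  fixes f :: "(real^2) \<times> (real^2) \<Rightarrow> real"
  assumes [measurable]: "f \<in> borel_measurable (borel \<Otimes>\<^sub>M borel)" and h: "integrable lborel h" and b: "\<And>y x. \<bar>f (y, x)\<bar> \<le> h x"
  shows "integrable (mu \<Otimes>\<^sub>M lborel) f"
proof -
  interpret ml: pair_sigma_finite mu "lborel :: (real^2) measure" by (rule pair_mu_lborel)
  have [measurable]: "h \<in> borel_measurable borel" using h by (auto dest: borel_measurable_integrable)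
  have "integrable (mu \<Otimes>\<^sub>M lborel) (\<lambda>(y, x). h x)"
    by (rule ml.Fubini_integrable) (use h in auto)
  then show ?thesis
    by (rule Bochner_Integration.integrable_bound) (use b in \<open>auto intro!: AE_I2 intro: order_trans[OF _ abs_ge_self]\<close>)
qed

text \<open>Fubini collects the regularised kernels into a field \<open>W n\<close>, which converges
  pointwise to \<open>V\<close>. All these fields share the bound \<open>grad_mass\<close>, so the
  integrands are dominated by a multiple of the modulus of the gradient.\<close>

lemma regularised_flux_tendsto:
  "(\<lambda>n. LINT y|mu. LINT x|mu. 2 * (1 / real (Suc n))\<^sup>2 / ((norm (x - y))\<^sup>2 + (1 / real (Suc n))\<^sup>2)\<^sup>2) \<longlonglongrightarrow> flux"
proof -
  interpret ml: pair_sigma_finite mu "lborel :: (real^2) measure" by (rule pair_mu_lborel)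
  let ?e = "\<lambda>k. 1 / real (Suc k)"
  have e0: "?e \<longlonglongrightarrow> 0" using LIMSEQ_inverse_real_of_nat by (simp add: inverse_eq_divide)
  define W where "W n j x = (LINT y|mu. kern_reg (?e n) j (x - y))" for n j x
  have ki: "integrable mu (\<lambda>y. kern_reg e j (x - y))" for e j x
    by (rule Bochner_Integration.integrable_bound[OF integrable_potential[of x]]) (use kern_reg_bound in auto)
  have Wm[measurable]: "W n j \<in> borel_measurable borel" for n j
    unfolding W_def[abs_def] by (rule sigma_finite_measure.borel_measurable_lebesgue_integral[OF sigma_finite_mu]) measurable
  have Wb: "\<bar>W n j x\<bar> \<le> grad_mass" for n j x
  proof -
    have "\<bar>W n j x\<bar> \<le> (LINT y|mu. \<bar>kern_reg (?e n) j (x - y)\<bar>)" unfolding W_def by (rule integral_abs_bound)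
    also have "\<dots> \<le> (LINT y|mu. 1 / norm (x - y))"
      by (intro integral_mono integrable_abs ki integrable_potential kern_reg_bound)
    finally show ?thesis using potential_bound[of x] by linarith
  qed
  have Wlim: "(\<lambda>n. W n j x) \<longlonglongrightarrow> V j x" for j x
    unfolding W_def V_def
  proof (rule integral_dominated_convergence[where w = "\<lambda>y. 1 / norm (x - y)"])
    show "AE y in mu. (\<lambda>n. kern_reg (?e n) j (x - y)) \<longlonglongrightarrow> kern j (x - y)"
    proof (rule AE_I2)
      fix y
      show "(\<lambda>n. kern_reg (?e n) j (x - y)) \<longlonglongrightarrow> kern j (x - y)"
      proof (cases "x = y")
        case False
        have "(\<lambda>n. (x - y) $ j / ((norm (x - y))\<^sup>2 + (?e n)\<^sup>2)) \<longlonglongrightarrow> (x - y) $ j / ((norm (x - y))\<^sup>2 + 0\<^sup>2)"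
          by (intro tendsto_intros e0) (use False in simp)
        then show ?thesis by (simp add: kern_reg_def kern_def)
      qed (simp add: kern_reg_def kern_def)
    qed
    show "AE y in mu. norm (kern_reg (?e n) j (x - y)) \<le> 1 / norm (x - y)" for n using kern_reg_bound by simp
  qed (use integrable_potential in simp_all)
  have di: "integrable lborel (\<lambda>x. c * (\<bar>d1 x\<bar> + \<bar>d2 x\<bar>))" for c :: real using integrable_d1 integrable_d2 by simp
  have eq: "(LINT y|mu. LINT x|mu. 2 * (?e n)\<^sup>2 / ((norm (x - y))\<^sup>2 + (?e n)\<^sup>2)\<^sup>2) = - 2 * (LINT x|lborel. W n 1 x * d1 x + W n 2 x * d2 x)" for n
  proof -
    \<comment> \<open>This bound depends on \<open>n\<close>; it serves Fubini for fixed
      \<open>n\<close>, while the passage to the limit rests on \<open>grad_mass\<close>.\<close>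
    let ?C = "1 / ?e n"
    have kb: "\<bar>kern_reg (?e n) j z\<bar> \<le> ?C" for j z
      unfolding kern_reg_def
    proof (rule abs_divide_sum_squares_bound)
      show "(z $ j)\<^sup>2 + (?e n)\<^sup>2 \<le> (norm z)\<^sup>2 + (?e n)\<^sup>2"
        using component_le_norm_cart[of z j] by (simp add: abs_le_square_iff[symmetric])
    qed simp
    have int: "integrable (mu \<Otimes>\<^sub>M lborel) (\<lambda>(y, x). kern_reg (?e n) 1 (x - y) * d1 x + kern_reg (?e n) 2 (x - y) * d2 x)"
    proof (rule integrable_pair_mu_lborel[OF _ di[of ?C]])
      fix y x
      have "\<bar>kern_reg (?e n) 1 (x - y)\<bar> * \<bar>d1 x\<bar> \<le> ?C * \<bar>d1 x\<bar>" "\<bar>kern_reg (?e n) 2 (x - y)\<bar> * \<bar>d2 x\<bar> \<le> ?C * \<bar>d2 x\<bar>"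
        by (intro mult_right_mono kb abs_ge_zero)+
      then show "\<bar>case (y, x) of (y, x) \<Rightarrow> kern_reg (?e n) 1 (x - y) * d1 x + kern_reg (?e n) 2 (x - y) * d2 x\<bar> \<le> ?C * (\<bar>d1 x\<bar> + \<bar>d2 x\<bar>)"
        unfolding prod.case distrib_left abs_mult[symmetric]
        using abs_triangle_ineq[of "kern_reg (?e n) 1 (x - y) * d1 x" "kern_reg (?e n) 2 (x - y) * d2 x"] by (simp only: abs_mult)
    qed measurable
    have "(LINT y|mu. LINT x|mu. 2 * (?e n)\<^sup>2 / ((norm (x - y))\<^sup>2 + (?e n)\<^sup>2)\<^sup>2) =
        (LINT y|mu. - 2 * (LINT x|lborel. kern_reg (?e n) 1 (x - y) * d1 x + kern_reg (?e n) 2 (x - y) * d2 x))"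
      by (intro Bochner_Integration.integral_cong refl regularised_flux) simp
    also have "\<dots> = - 2 * (LINT y|mu. LINT x|lborel. kern_reg (?e n) 1 (x - y) * d1 x + kern_reg (?e n) 2 (x - y) * d2 x)"
      by simp
    also have "(LINT y|mu. LINT x|lborel. kern_reg (?e n) 1 (x - y) * d1 x + kern_reg (?e n) 2 (x - y) * d2 x) =
       (LINT x|lborel. LINT y|mu. kern_reg (?e n) 1 (x - y) * d1 x + kern_reg (?e n) 2 (x - y) * d2 x)"
      by (rule ml.Fubini_integral[OF int, symmetric])
    also have "\<dots> = (LINT x|lborel. W n 1 x * d1 x + W n 2 x * d2 x)"
      unfolding W_def by (intro Bochner_Integration.integral_cong refl) (simp add: ki)
    finally show ?thesis .
  qed
  have "(\<lambda>n. LINT x|lborel. W n 1 x * d1 x + W n 2 x * d2 x) \<longlonglongrightarrow> (LINT x|lborel. V 1 x * d1 x + V 2 x * d2 x)"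
  proof (rule integral_dominated_convergence[OF _ _ di[of grad_mass]])
    show "AE x in lborel. (\<lambda>n. W n 1 x * d1 x + W n 2 x * d2 x) \<longlonglongrightarrow> V 1 x * d1 x + V 2 x * d2 x"
      by (intro AE_I2 tendsto_intros Wlim)
    show "AE x in lborel. norm (W n 1 x * d1 x + W n 2 x * d2 x) \<le> grad_mass * (\<bar>d1 x\<bar> + \<bar>d2 x\<bar>)" for n
    proof (rule AE_I2)
      fix x
      have "\<bar>W n 1 x\<bar> * \<bar>d1 x\<bar> \<le> grad_mass * \<bar>d1 x\<bar>" "\<bar>W n 2 x\<bar> * \<bar>d2 x\<bar> \<le> grad_mass * \<bar>d2 x\<bar>"
        by (intro mult_right_mono Wb abs_ge_zero)+
      then show "norm (W n 1 x * d1 x + W n 2 x * d2 x) \<le> grad_mass * (\<bar>d1 x\<bar> + \<bar>d2 x\<bar>)"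
        unfolding real_norm_def distrib_left
        using abs_triangle_ineq[of "W n 1 x * d1 x" "W n 2 x * d2 x"] by (simp only: abs_mult)
    qed
  qed measurable
  then show ?thesis unfolding eq flux_def by (intro tendsto_intros)
qed

text \<open>The divergence \<open>2 e^2 / (|z|^2 + e^2)^2\<close> of the regularised kernel is \<open>2 \<pi>\<close> times an approximate
  identity; rescaling removes \<open>e\<close> from the weight.\<close>

lemma nn_regularised_flux:
  assumes e: "0 < e"
  shows "ennreal (LINT y|mu. LINT x|mu. 2 * e\<^sup>2 / ((norm (x - y))\<^sup>2 + e\<^sup>2)\<^sup>2) =
    (\<integral>\<^sup>+z. ennreal (2 / (1 + (norm z)\<^sup>2)\<^sup>2) * (\<integral>\<^sup>+y. ennreal (rho y * rho (e *\<^sub>R z + y)) \<partial>lborel) \<partial>lborel)"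
proof -
  let ?f = "\<lambda>y x. 2 * e\<^sup>2 / ((norm (x - y))\<^sup>2 + e\<^sup>2)\<^sup>2"
  have e2: "0 < e\<^sup>2" using e by simp
  have fb: "\<bar>?f y x\<bar> \<le> 2 / e\<^sup>2" for x y
  proof -
    have "2 * e\<^sup>2 / ((norm (x - y))\<^sup>2 + e\<^sup>2)\<^sup>2 \<le> 2 * e\<^sup>2 / (e\<^sup>2)\<^sup>2"
      using e e2 by (intro divide_left_mono power_mono mult_pos_pos zero_less_power) (auto intro: add_nonneg_pos)
    also have "\<dots> = 2 / e\<^sup>2" using e2 by (simp add: power2_eq_square)
    finally show ?thesis by simp
  qed
  have m[measurable]: "(\<lambda>y. LINT x|mu. ?f y x) \<in> borel_measurable borel"
    by (rule sigma_finite_measure.borel_measurable_lebesgue_integral[OF sigma_finite_mu]) measurable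
  have i1: "integrable mu (\<lambda>x. ?f y x)" for y by (rule integrable_mu_bounded[OF _ fb]) measurable
  have i2: "integrable mu (\<lambda>y. LINT x|mu. ?f y x)"
  proof (rule integrable_mu_bounded[OF m, where C = "(2 / e\<^sup>2) * measure mu (space mu)"])
    fix y
    have "\<bar>LINT x|mu. ?f y x\<bar> \<le> (LINT x|mu. \<bar>?f y x\<bar>)" by (rule integral_abs_bound)
    also have "\<dots> \<le> (LINT x|mu. 2 / e\<^sup>2)" by (intro integral_mono integrable_abs i1 fb) simp
    finally show "\<bar>LINT x|mu. ?f y x\<bar> \<le> (2 / e\<^sup>2) * measure mu (space mu)" by (simp add: mult.commute)
  qed
  have pt: "(\<integral>\<^sup>+x. ennreal (?f y x) \<partial>mu) = (\<integral>\<^sup>+z. ennreal (2 / (1 + (norm z)\<^sup>2)\<^sup>2) * ennreal (rho (e *\<^sub>R z + y)) \<partial>lborel)" for y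
  proof -
    have "(\<integral>\<^sup>+x. ennreal (?f y x) \<partial>mu) = (\<integral>\<^sup>+x. ennreal (rho x) * ennreal (?f y x) \<partial>lborel)"
      by (rule nn_integral_mu) measurable
    also have "\<dots> = ennreal (e\<^sup>2) * (\<integral>\<^sup>+z. ennreal (rho (y + e *\<^sub>R z)) * ennreal (?f y (y + e *\<^sub>R z)) \<partial>lborel)"
      by (rule nn_integral_scale_plane[OF _ e]) measurable
    also have "\<dots> = (\<integral>\<^sup>+z. ennreal (e\<^sup>2) * (ennreal (rho (y + e *\<^sub>R z)) * ennreal (?f y (y + e *\<^sub>R z))) \<partial>lborel)"
      by (rule nn_integral_cmult[symmetric]) measurable
    also have "\<dots> = (\<integral>\<^sup>+z. ennreal (2 / (1 + (norm z)\<^sup>2)\<^sup>2) * ennreal (rho (e *\<^sub>R z + y)) \<partial>lborel)"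
    proof (rule nn_integral_cong)
      fix z :: "real^2"
      have ac: "a * f = k \<Longrightarrow> a * (r * f) = k * r" for a f k r :: real by auto
      have gen: "E * (2 * E / (E * k)\<^sup>2) = 2 / k\<^sup>2" if "E \<noteq> 0" for E k :: real
        using that by (simp add: power2_eq_square)
      have "(norm (y + e *\<^sub>R z - y))\<^sup>2 + e\<^sup>2 = e\<^sup>2 * (1 + (norm z)\<^sup>2)" by (simp add: power_mult_distrib algebra_simps)
      then have "e\<^sup>2 * ?f y (y + e *\<^sub>R z) = 2 / (1 + (norm z)\<^sup>2)\<^sup>2"
        using gen[of "e\<^sup>2" "1 + (norm z)\<^sup>2"] e2 by simp
      then have "e\<^sup>2 * (rho (y + e *\<^sub>R z) * ?f y (y + e *\<^sub>R z)) = 2 / (1 + (norm z)\<^sup>2)\<^sup>2 * rho (e *\<^sub>R z + y)"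
        using ac[of "e\<^sup>2" "?f y (y + e *\<^sub>R z)" _ "rho (y + e *\<^sub>R z)"] by (simp only: add.commute)
      then show "ennreal (e\<^sup>2) * (ennreal (rho (y + e *\<^sub>R z)) * ennreal (?f y (y + e *\<^sub>R z))) = ennreal (2 / (1 + (norm z)\<^sup>2)\<^sup>2) * ennreal (rho (e *\<^sub>R z + y))"
        by (simp only: ennreal_mult[symmetric] rho_nonneg zero_le_power2 divide_nonneg_nonneg mult_nonneg_nonneg zero_le_numeral)
    qed
    finally show ?thesis .
  qed
  have "ennreal (LINT y|mu. LINT x|mu. ?f y x) = (\<integral>\<^sup>+y. ennreal (LINT x|mu. ?f y x) \<partial>mu)"
    by (intro nn_integral_eq_integral[symmetric] i2) auto
  also have "\<dots> = (\<integral>\<^sup>+y. (\<integral>\<^sup>+x. ennreal (?f y x) \<partial>mu) \<partial>mu)"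
    by (intro nn_integral_cong nn_integral_eq_integral[symmetric] i1) auto
  also have "\<dots> = (\<integral>\<^sup>+y. ennreal (rho y) * (\<integral>\<^sup>+z. ennreal (2 / (1 + (norm z)\<^sup>2)\<^sup>2) * ennreal (rho (e *\<^sub>R z + y)) \<partial>lborel) \<partial>lborel)"
    unfolding pt by (rule nn_integral_mu) measurable
  also have "\<dots> = (\<integral>\<^sup>+y. \<integral>\<^sup>+z. ennreal (rho y) * (ennreal (2 / (1 + (norm z)\<^sup>2)\<^sup>2) * ennreal (rho (e *\<^sub>R z + y))) \<partial>lborel \<partial>lborel)"
    by (intro nn_integral_cong nn_integral_cmult[symmetric]) measurable
  also have "\<dots> = (\<integral>\<^sup>+z. \<integral>\<^sup>+y. ennreal (rho y) * (ennreal (2 / (1 + (norm z)\<^sup>2)\<^sup>2) * ennreal (rho (e *\<^sub>R z + y))) \<partial>lborel \<partial>lborel)"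
    by (rule lborel_pair.Fubini'[symmetric]) measurable
  also have "\<dots> = (\<integral>\<^sup>+z. ennreal (2 / (1 + (norm z)\<^sup>2)\<^sup>2) * (\<integral>\<^sup>+y. ennreal (rho y * rho (e *\<^sub>R z + y)) \<partial>lborel) \<partial>lborel)"
    by (subst nn_integral_cmult[symmetric], measurable, intro nn_integral_cong)
      (simp add: ennreal_mult rho_nonneg mult.left_commute)
  finally show ?thesis .
qed

text \<open>For fixed \<open>z\<close> the shift \<open>e z\<close> tends to 0, so the
  autocorrelations control the integral of \<open>rho^2\<close> from above in the lower limit; Fatou
  then exchanges this limit with the integral over \<open>z\<close>, whose weight has total mass
  \<open>2 pi\<close>. The statement is in \<open>ennreal\<close> because finiteness of the left
  side is itself a consequence.\<close>

lemma nn_quartic_le_flux: "ennreal (2 * pi) * (\<integral>\<^sup>+x. ennreal ((rho x)\<^sup>2) \<partial>lborel) \<le> ennreal flux"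
proof -
  let ?e = "\<lambda>k. 1 / real (Suc k)"
  let ?Q = "\<integral>\<^sup>+x. ennreal ((rho x)\<^sup>2) \<partial>lborel"
  have e0: "?e \<longlonglongrightarrow> 0" using LIMSEQ_inverse_real_of_nat by (simp add: inverse_eq_divide)
  let ?g = "\<lambda>n z. ennreal (2 / (1 + (norm z)\<^sup>2)\<^sup>2) * (\<integral>\<^sup>+y. ennreal (rho y * rho (?e n *\<^sub>R z + y)) \<partial>lborel)"
  have [measurable]: "(\<lambda>z. \<integral>\<^sup>+y. ennreal (rho y * rho (c *\<^sub>R z + y)) \<partial>lborel) \<in> borel_measurable borel" for c
    by (rule lborel.borel_measurable_nn_integral) measurable
  have "ennreal (2 * pi) * ?Q = (ennreal 2 * (\<integral>\<^sup>+z. ennreal (1 / (1 + (norm (z::real^2))\<^sup>2)\<^sup>2) \<partial>lborel)) * ?Q"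
    unfolding nn_integral_plane_kernel by (simp add: ennreal_mult)
  also have "\<dots> = (\<integral>\<^sup>+z. ennreal (2 / (1 + (norm (z::real^2))\<^sup>2)\<^sup>2) * ?Q \<partial>lborel)"
    by (subst nn_integral_cmult[symmetric], measurable, subst nn_integral_multc[symmetric], measurable)
      (simp add: ennreal_mult[symmetric] del: ennreal_numeral)
  also have "\<dots> \<le> (\<integral>\<^sup>+z. liminf (\<lambda>n. ?g n z) \<partial>lborel)"
  proof (rule nn_integral_mono)
    fix z :: "real^2"
    have "(\<lambda>n. ?e n *\<^sub>R z) \<longlonglongrightarrow> 0 *\<^sub>R z" by (intro tendsto_intros e0)
    then have "?Q \<le> liminf (\<lambda>n. \<integral>\<^sup>+y. ennreal (rho y * rho (?e n *\<^sub>R z + y)) \<partial>lborel)"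
      by (intro nn_integral_square_le_liminf_autocorrelation integrable_rho rho_nonneg) simp
    then have "ennreal (2 / (1 + (norm z)\<^sup>2)\<^sup>2) * ?Q \<le> ennreal (2 / (1 + (norm z)\<^sup>2)\<^sup>2) * liminf (\<lambda>n. \<integral>\<^sup>+y. ennreal (rho y * rho (?e n *\<^sub>R z + y)) \<partial>lborel)"
      by (rule mult_left_mono) simp
    also have "\<dots> \<le> liminf (\<lambda>n. ?g n z)"
    proof -
      have "ennreal (2 / (1 + (norm z)\<^sup>2)\<^sup>2) * liminf (\<lambda>n. \<integral>\<^sup>+y. ennreal (rho y * rho (?e n *\<^sub>R z + y)) \<partial>lborel) = liminf (\<lambda>n. ?g n z)"
        by (intro Liminf_compose_continuous_mono[symmetric, of "\<lambda>t. ennreal (2 / (1 + (norm z)\<^sup>2)\<^sup>2) * t"])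
          (auto intro!: ennreal_continuous_on_cmult monoI mult_left_mono)
      then show ?thesis by simp
    qed
    finally show "ennreal (2 / (1 + (norm z)\<^sup>2)\<^sup>2) * ?Q \<le> liminf (\<lambda>n. ?g n z)" .
  qed
  also have "\<dots> \<le> liminf (\<lambda>n. \<integral>\<^sup>+z. ?g n z \<partial>lborel)"
    by (rule nn_integral_liminf) measurable
  also have "\<dots> = liminf (\<lambda>n. ennreal (LINT y|mu. LINT x|mu. 2 * (?e n)\<^sup>2 / ((norm (x - y))\<^sup>2 + (?e n)\<^sup>2)\<^sup>2))"
    by (subst nn_regularised_flux) simp_all
  also have "\<dots> = ennreal flux"
    by (rule lim_imp_Liminf[OF trivial_limit_sequentially tendsto_ennrealI[OF regularised_flux_tendsto]])
  finally show ?thesis .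
qed

text \<open>Membership of \<open>H1\<close> functions in \<open>L4\<close> falls out of the flux
  estimate: the flux is a real number.\<close>

lemma integrable_rho2: "integrable lborel (\<lambda>x. (rho x)\<^sup>2)"
proof (rule integrableI_bounded)
  have "ennreal (2 * pi) * (\<integral>\<^sup>+x. ennreal ((rho x)\<^sup>2) \<partial>lborel) < \<infinity>"
    using nn_quartic_le_flux le_less_trans ennreal_less_top by fastforce
  then show "(\<integral>\<^sup>+x. ennreal (norm ((rho x)\<^sup>2)) \<partial>lborel) < \<infinity>"
    by (auto simp: ennreal_mult_less_top)
qed measurable

lemma flux_nonneg: "0 \<le> flux"
proof (rule LIMSEQ_le_const[OF regularised_flux_tendsto], intro exI allI impI)
  fix n show "0 \<le> (LINT y|mu. LINT x|mu. 2 * (1 / real (Suc n))\<^sup>2 / ((norm (x - y))\<^sup>2 + (1 / real (Suc n))\<^sup>2)\<^sup>2)"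
    by (intro Bochner_Integration.integral_nonneg) simp
qed

lemma quartic_le_flux: "2 * pi * (LINT x|lborel. (rho x)\<^sup>2) \<le> flux"
proof -
  have "ennreal (2 * pi) * ennreal (LINT x|lborel. (rho x)\<^sup>2) \<le> ennreal flux"
    using nn_quartic_le_flux nn_integral_eq_integral[OF integrable_rho2] by simp
  then show ?thesis using flux_nonneg by (simp add: ennreal_mult[symmetric] ennreal_le_iff)
qed

end

section \<open>The three-body Hardy inequality\<close>

text \<open>For \<open>r \<le> q \<le> p\<close> the first two terms combine to
  \<open>(p - q) * (p * (p - r) - q * (q - r))\<close>, and both this and the last term are
  nonnegative. The other orders follow by relabelling.\<close>

lemma Schur_inequality:
  fixes p q r :: real
  assumes "0 \<le> p" "0 \<le> q" "0 \<le> r"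
  shows "0 \<le> p * (p - q) * (p - r) + q * (q - p) * (q - r) + r * (r - p) * (r - q)"
proof -
  have sorted: "0 \<le> p * (p - q) * (p - r) + q * (q - p) * (q - r) + r * (r - p) * (r - q)"
    if "r \<le> q" "q \<le> p" "0 \<le> r" for p q r :: real
  proof -
    have "q * (q - r) \<le> p * (p - r)" using that by (intro mult_mono) auto
    then have "0 \<le> (p - q) * (p * (p - r) - q * (q - r))" using that by (intro mult_nonneg_nonneg) auto
    moreover have "0 \<le> r * ((p - r) * (q - r))" using that by (intro mult_nonneg_nonneg) auto
    ultimately show ?thesis by (simp add: algebra_simps)
  qed
  consider "r \<le> q \<and> q \<le> p" | "q \<le> r \<and> r \<le> p" | "r \<le> p \<and> p \<le> q" | "p \<le> r \<and> r \<le> q" | "q \<le> p \<and> p \<le> r" | "p \<le> q \<and> q \<le> r"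
    by linarith
  then show ?thesis
    using sorted[of r q p] sorted[of q r p] sorted[of r p q] sorted[of p r q] sorted[of q p r] sorted[of p q r] assms
    by cases (simp_all add: algebra_simps)
qed

text \<open>For a nondegenerate triangle the sum on the left is \<open>1 / (2 R^2)\<close> with \<open>R\<close> the
  circumradius, and the claim is that the squared sides sum to at most \<open>9 R^2\<close>.\<close>

lemma circumradius_bound:
  fixes p q r :: real
  assumes nn: "0 \<le> p" "0 \<le> q" "0 \<le> r" and deg: "p = 0 \<Longrightarrow> q = r" "q = 0 \<Longrightarrow> p = r" "r = 0 \<Longrightarrow> p = q"
  shows "(p + q - r) / (2 * (p * q)) + (p + r - q) / (2 * (p * r)) + (q + r - p) / (2 * (q * r)) \<le> 9 / 2 * (1 / (p + q + r))"
proof -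
  \<comment> \<open>If one squared side is 0, the other two agree; since division by 0 gives 0, just
    the term \<open>1 / t\<close> survives, to be compared with \<open>9 / (4 * t)\<close>.\<close>
  have deg': "1 / t \<le> 9 / 2 * (1 / (t + t))" if "0 \<le> t" for t :: real
    using that by (cases "t = 0") (auto simp: field_simps)
  show ?thesis
  proof (cases "p = 0 \<or> q = 0 \<or> r = 0")
    case True
    then show ?thesis using deg deg'[of p] deg'[of q] deg'[of r] nn by auto
  next
    case False
    then have pos: "0 < p" "0 < q" "0 < r" using nn by auto
    let ?N = "2 * p * q + 2 * p * r + 2 * q * r - p\<^sup>2 - q\<^sup>2 - r\<^sup>2"
    have "(p + q - r) / (2 * (p * q)) + (p + r - q) / (2 * (p * r)) + (q + r - p) / (2 * (q * r)) = ?N / (2 * (p * q * r))"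
      using pos by (simp add: field_simps power2_eq_square)
    \<comment> \<open>The difference of the two sides is exactly the expression in Schur's
      inequality.\<close>
    moreover have "?N * (p + q + r) \<le> 9 * (p * q * r)"
      using Schur_inequality[OF nn] by (simp add: algebra_simps power2_eq_square)
    ultimately show ?thesis using pos by (simp add: divide_simps) (simp add: algebra_simps)
  qed
qed

lemma inner_diff_polarization:
  fixes x y z :: "'a::real_inner"
  shows "(x - y) \<bullet> (x - z) = ((norm (x - y))\<^sup>2 + (norm (x - z))\<^sup>2 - (norm (y - z))\<^sup>2) / 2"
  unfolding power2_norm_eq_inner by (simp add: inner_diff_left inner_diff_right inner_commute)

text \<open>What \<open>|V x|^2\<close> produces as a double integral over \<open>y\<close> and
  \<open>z\<close>: the inner product of the two kernels seen from the apex
  \<open>x\<close>.\<close>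

definition triple_kern :: "real^2 \<Rightarrow> real^2 \<Rightarrow> real^2 \<Rightarrow> real" where
  "triple_kern x y z = kern 1 (x - y) * kern 1 (x - z) + kern 2 (x - y) * kern 2 (x - z)"

definition side_sum :: "real^2 \<Rightarrow> real^2 \<Rightarrow> real^2 \<Rightarrow> real" where
  "side_sum x y z = (norm (x - y))\<^sup>2 + (norm (x - z))\<^sup>2 + (norm (y - z))\<^sup>2"

lemma triple_kern_measurable[measurable]:
  assumes [measurable]: "f \<in> borel_measurable M" "g \<in> borel_measurable M" "h \<in> borel_measurable M"
  shows "(\<lambda>p. triple_kern (f p) (g p) (h p)) \<in> borel_measurable M"
  unfolding triple_kern_def by measurable

lemma side_sum_measurable[measurable]:
  assumes [measurable]: "f \<in> borel_measurable M" "g \<in> borel_measurable M" "h \<in> borel_measurable M"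
  shows "(\<lambda>p. side_sum (f p) (g p) (h p)) \<in> borel_measurable M"
  unfolding side_sum_def by measurable

lemma triple_kern_inner: "triple_kern x y z = ((x - y) \<bullet> (x - z)) / ((norm (x - y))\<^sup>2 * (norm (x - z))\<^sup>2)"
  by (simp add: triple_kern_def kern_def inner_vec_def sum_2 add_divide_distrib)

lemma triple_kern_cyclic_bound:
  "triple_kern x y z + triple_kern y x z + triple_kern z x y \<le> 9 / 2 * (1 / side_sum x y z)"
proof -
  let ?p = "(norm (x - y))\<^sup>2" and ?q = "(norm (x - z))\<^sup>2" and ?r = "(norm (y - z))\<^sup>2"
  have "triple_kern x y z = (?p + ?q - ?r) / (2 * (?p * ?q))"
    "triple_kern y x z = (?p + ?r - ?q) / (2 * (?p * ?r))"
    "triple_kern z x y = (?q + ?r - ?p) / (2 * (?q * ?r))"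
    unfolding triple_kern_inner inner_diff_polarization by (simp_all add: norm_minus_commute)
  moreover have "(?p + ?q - ?r) / (2 * (?p * ?q)) + (?p + ?r - ?q) / (2 * (?p * ?r)) + (?q + ?r - ?p) / (2 * (?q * ?r)) \<le> 9 / 2 * (1 / (?p + ?q + ?r))"
    by (rule circumradius_bound) (auto simp: norm_minus_commute)
  ultimately show ?thesis by (simp add: side_sum_def)
qed

text \<open>With \<open>w = 2 x - y - z\<close> and \<open>s = side_sum + e^2\<close>, the gradient
  of \<open>s\<close> in \<open>x\<close> is \<open>2 w\<close>. So the field \<open>w / s\<close>
  has divergence \<open>4 / s - 2 |w|^2 / s^2\<close>, and subtracting its squared length turns the
  2 into 3.\<close>

definition hardy_weight :: "real \<Rightarrow> real^2 \<Rightarrow> real^2 \<Rightarrow> real^2 \<Rightarrow> real" where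
  "hardy_weight e x y z = 4 / (side_sum x y z + e\<^sup>2) - 3 * (norm (2 *\<^sub>R x - y - z))\<^sup>2 / (side_sum x y z + e\<^sup>2)\<^sup>2"

lemma hardy_weight_measurable[measurable]:
  assumes [measurable]: "f \<in> borel_measurable M" "g \<in> borel_measurable M" "h \<in> borel_measurable M"
  shows "(\<lambda>p. hardy_weight e (f p) (g p) (h p)) \<in> borel_measurable M"
  unfolding hardy_weight_def by measurable

lemma side_sum_commute: "side_sum y x z = side_sum x y z" "side_sum z x y = side_sum x y z"
  by (simp_all add: side_sum_def norm_minus_commute)

lemma side_sum_nonneg: "0 \<le> side_sum x y z"
  by (simp add: side_sum_def)

text \<open>\<open>2 x - y - z\<close> is three times the vector from the centroid to
  \<open>x\<close>, and the squared distances of the corners from the centroid add up to a third of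
  the squared sides.\<close>

lemma centroid_identity: "(norm (2 *\<^sub>R x - y - z))\<^sup>2 + (norm (2 *\<^sub>R y - x - z))\<^sup>2 + (norm (2 *\<^sub>R z - x - y))\<^sup>2 = 3 * side_sum x y z"
  unfolding side_sum_def norm_power2_plane by (simp add: power2_eq_square algebra_simps)

text \<open>\<open>2 x - y - z\<close> is twice the median from \<open>x\<close>; this is the
  theorem of Apollonius with a multiple of \<open>|y - z|^2\<close> dropped.\<close>

lemma median_bound: "(norm (2 *\<^sub>R x - y - z))\<^sup>2 \<le> 2 * side_sum x y z"
proof -
  have "(norm (2 *\<^sub>R x - y - z))\<^sup>2 + 3 * (norm (y - z))\<^sup>2 = 2 * side_sum x y z"
    unfolding side_sum_def norm_power2_plane by (simp add: power2_eq_square algebra_simps)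
  then show ?thesis using zero_le_power2[of "norm (y - z)"] by linarith
qed

text \<open>By the centroid identity the squared numerators add up to \<open>3 * side_sum\<close>,
  so the sum is \<open>12 / s - 9 * side_sum / s^2\<close> with \<open>s = side_sum + e^2\<close>.
  What remains is \<open>12 - 9 = 3\<close>.\<close>

lemma hardy_weight_cyclic:
  assumes "0 < e"
  shows "3 / (side_sum x y z + e\<^sup>2) \<le> hardy_weight e x y z + hardy_weight e y x z + hardy_weight e z x y"
proof -
  let ?s = "side_sum x y z + e\<^sup>2"
  have s: "0 < ?s" using assms side_sum_nonneg[of x y z] by (simp add: add_nonneg_pos)
  have "hardy_weight e x y z + hardy_weight e y x z + hardy_weight e z x y = 12 / ?s - 3 * (3 * side_sum x y z) / ?s\<^sup>2"
    unfolding hardy_weight_def side_sum_commute(1)[of y x z] side_sum_commute(2)[of z x y] centroid_identity[of x y z, symmetric]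
    by (simp add: add_divide_distrib distrib_left)
  moreover have "3 * (3 * side_sum x y z) / ?s\<^sup>2 \<le> 3 * (3 * ?s) / ?s\<^sup>2"
    by (intro divide_right_mono) auto
  moreover have "3 * (3 * t) / t\<^sup>2 = 9 / t" if "0 < t" for t :: real using that by (simp add: power2_eq_square)
  from this[OF s] have "3 * (3 * ?s) / ?s\<^sup>2 = 9 / ?s" .
  ultimately show ?thesis by (simp add: diff_divide_distrib[symmetric])
qed

lemma hardy_weight_bound:
  assumes "0 < e" shows "\<bar>hardy_weight e x y z\<bar> \<le> 10 / e\<^sup>2"
proof -
  let ?s = "side_sum x y z + e\<^sup>2"
  have s: "0 < ?s" "e\<^sup>2 \<le> ?s" using assms side_sum_nonneg[of x y z] by (auto simp: add_nonneg_pos)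
  have m: "(norm (2 *\<^sub>R x - y - z))\<^sup>2 \<le> 2 * ?s"
    by (rule order_trans[OF median_bound]) simp
  have "3 * (norm (2 *\<^sub>R x - y - z))\<^sup>2 / ?s\<^sup>2 \<le> 3 * (2 * ?s) / ?s\<^sup>2"
    by (intro divide_right_mono mult_left_mono m) auto
  moreover have "3 * (2 * t) / t\<^sup>2 = 6 * (1 / t)" if "0 < t" for t :: real using that by (simp add: power2_eq_square)
  from this[OF s(1)] have "3 * (2 * ?s) / ?s\<^sup>2 = 6 * (1 / ?s)" .
  ultimately have "3 * (norm (2 *\<^sub>R x - y - z))\<^sup>2 / ?s\<^sup>2 \<le> 6 * (1 / ?s)" by simp
  moreover have "0 \<le> 3 * (norm (2 *\<^sub>R x - y - z))\<^sup>2 / ?s\<^sup>2" by simp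
  moreover have "1 / ?s \<le> 1 / e\<^sup>2" "0 < 1 / ?s" using s assms by (auto intro!: frac_le)
  ultimately show ?thesis unfolding hardy_weight_def by linarith
qed

context H1_function
begin

text \<open>\<open>|grad |u||^2\<close> in terms of \<open>rho\<close>: a quarter of
  \<open>|grad rho|^2 / rho\<close>, with value 0 where \<open>u\<close> vanishes.\<close>

definition dens :: "real^2 \<Rightarrow> real" where "dens x = ((d1 x)\<^sup>2 + (d2 x)\<^sup>2) / rho x"

definition D :: real where "D = (LINT x|lborel. dens x)"

lemma dens_measurable[measurable]: "dens \<in> borel_measurable borel"
  unfolding dens_def[abs_def] by measurable

lemma dens_nonneg: "0 \<le> dens x"
  by (simp add: dens_def rho_nonneg)

lemma dens_bound: "dens x \<le> (norm (g1 x))\<^sup>2 + (norm (g2 x))\<^sup>2"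
proof (cases "u x = 0")
  case False
  have "(d1 x)\<^sup>2 \<le> rho x * (norm (g1 x))\<^sup>2" "(d2 x)\<^sup>2 \<le> rho x * (norm (g2 x))\<^sup>2"
    using Cauchy_Schwarz_ineq[of "u x" "g1 x"] Cauchy_Schwarz_ineq[of "u x" "g2 x"]
    by (simp_all add: d1_def d2_def rho_def power2_norm_eq_inner)
  moreover have "0 < rho x" using False by (simp add: rho_def)
  ultimately show ?thesis by (simp add: dens_def divide_le_eq algebra_simps)
qed (simp add: dens_def rho_def)

lemma integrable_dens: "integrable lborel dens"
proof (rule Bochner_Integration.integrable_bound)
  show "integrable lborel (\<lambda>x. (norm (g1 x))\<^sup>2 + (norm (g2 x))\<^sup>2)" using L2_g1 L2_g2 by (simp add: L2_def)
qed (use dens_bound dens_nonneg in auto)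

lemma D_nonneg: "0 \<le> D"
  unfolding D_def by (simp add: dens_nonneg)

text \<open>The weighted Young inequality that turns the divergence identity into a Hardy
  inequality: after integration the term \<open>rho |F|^2\<close> is subtracted from the divergence,
  leaving the kinetic energy on the right. Where \<open>rho = 0\<close>, \<open>d1\<close> and
  \<open>d2\<close> vanish too.\<close>

lemma completing_square: "- 2 * (p * d1 x + q * d2 x) \<le> rho x *\<^sub>R (p\<^sup>2 + q\<^sup>2) + dens x"
proof (cases "rho x = 0")
  case True
  then have "d1 x = 0" "d2 x = 0" by (simp_all add: rho_def d1_def d2_def)
  then show ?thesis using True by (simp add: dens_def)
next
  case False
  then have r: "0 < rho x" using rho_nonneg[of x] by simp
  have sq: "- 2 * (p * d) \<le> rho x * p\<^sup>2 + d\<^sup>2 / rho x" for p d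
  proof -
    have "0 \<le> (rho x * p + d)\<^sup>2 / rho x" using r by simp
    also have "\<dots> = rho x * p\<^sup>2 + d\<^sup>2 / rho x + 2 * (p * d)" using r by (simp add: field_simps power2_eq_square)
    finally show ?thesis by simp
  qed
  from sq[of p "d1 x"] sq[of q "d2 x"] show ?thesis
    by (simp add: dens_def add_divide_distrib algebra_simps)
qed

text \<open>The Hardy weight is \<open>div F - |F|^2\<close> for \<open>F = (2 x - y - z) / (side_sum + e^2)\<close>, the \<open>x\<close>-component of the
  regularised radial field of the Hardy inequality in the relative coordinates of three particles.\<close>

lemma hardy_section:
  assumes e: "0 < e"
  shows "(LINT x|mu. hardy_weight e x y z) \<le> D"
proof -
  define s where "s a b = (a - y $ 1)\<^sup>2 + (b - y $ 2)\<^sup>2 + ((a - z $ 1)\<^sup>2 + (b - z $ 2)\<^sup>2) + ((norm (y - z))\<^sup>2 + e\<^sup>2)" for a b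
  define P Q where "P a = 2 * a - y $ 1 - z $ 1" and "Q b = 2 * b - y $ 2 - z $ 2" for a b :: real
  define p where "p a b = P a / s a b" for a b
  define q where "q a b = Q b / s a b" for a b
  define p' where "p' a b = 2 / s a b - 2 * (P a)\<^sup>2 / (s a b)\<^sup>2" for a b
  define q' where "q' a b = 2 / s a b - 2 * (Q b)\<^sup>2 / (s a b)\<^sup>2" for a b
  have e2: "0 < e\<^sup>2" using e by simp
  have se: "e\<^sup>2 \<le> s a b" for a b unfolding s_def by simp
  have sp: "0 < s a b" for a b using se[of a b] e2 by linarith
  note sn = less_imp_neq[OF sp, THEN not_sym]
  have ss: "side_sum x y z + e\<^sup>2 = s (x $ 1) (x $ 2)" for x
    by (simp add: side_sum_def s_def norm_power2_plane)
  have W: "(norm (2 *\<^sub>R x - y - z))\<^sup>2 = (P (x $ 1))\<^sup>2 + (Q (x $ 2))\<^sup>2" for x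
    by (simp add: P_def Q_def norm_power2_plane)
  have PQ: "(P a)\<^sup>2 \<le> 2 * s a b" "(Q b)\<^sup>2 \<le> 2 * s a b" for a b
  proof -
    \<comment> \<open>Any two reals are the coordinates of a point, so the geometric bound for
      medians applies to \<open>P\<close> and \<open>Q\<close>.\<close>
    define x :: "real^2" where "x = vector [a, b]"
    have "(P a)\<^sup>2 + (Q b)\<^sup>2 \<le> 2 * s a b"
      using median_bound[of x y z] W[of x] ss[of x] e2 unfolding x_def vector_2 by linarith
    then show "(P a)\<^sup>2 \<le> 2 * s a b" "(Q b)\<^sup>2 \<le> 2 * s a b"
      using zero_le_power2[of "P a"] zero_le_power2[of "Q b"] by linarith+
  qed
  have ds: "((\<lambda>a. s a b) has_real_derivative 2 * P a) (at a)" "((\<lambda>b. s a b) has_real_derivative 2 * Q b) (at b)" for a b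
    unfolding s_def P_def Q_def by (auto intro!: derivative_eq_intros)
  have cs: "continuous_on UNIV (\<lambda>x::real^2. s (x $ 1) (x $ 2))" unfolding s_def by (intro continuous_intros)
  have c: "continuous_on UNIV (\<lambda>x::real^2. p (x $ 1) (x $ 2))" "continuous_on UNIV (\<lambda>x::real^2. p' (x $ 1) (x $ 2))"
      "continuous_on UNIV (\<lambda>x::real^2. q (x $ 1) (x $ 2))" "continuous_on UNIV (\<lambda>x::real^2. q' (x $ 1) (x $ 2))"
    unfolding p_def q_def p'_def q'_def P_def Q_def by (intro continuous_intros cs; simp add: sn)+
  \<comment> \<open>\<open>C\<close> dominates both \<open>2 + 1 / e^2\<close>, the bound for the
    field that \<open>2 * |v| \<le> v^2 + 1\<close> yields, and the bound of order
    \<open>1 / e^2\<close> for its derivatives.\<close>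
  define C where "C = 2 + 7 / e\<^sup>2"
  have bnd: "\<bar>v / r\<bar> \<le> C" "\<bar>2 / r - 2 * v\<^sup>2 / r\<^sup>2\<bar> \<le> C" if "v\<^sup>2 \<le> 2 * r" "e\<^sup>2 \<le> r" for v r :: real
  proof -
    have r: "0 < r" using that e2 by linarith
    have i: "1 / r \<le> 1 / e\<^sup>2" "0 < 1 / r" using that e2 r by (auto intro!: frac_le)
    have C: "C = 2 + 7 * (1 / e\<^sup>2)" by (simp add: C_def)
    have "2 * \<bar>v\<bar> \<le> v\<^sup>2 + 1" using zero_le_power2[of "\<bar>v\<bar> - 1"] by (simp add: power2_eq_square algebra_simps)
    then have "\<bar>v\<bar> \<le> 2 * r + 1" using that r by (smt (verit))
    then have "\<bar>v / r\<bar> \<le> (2 * r + 1) / r" using r by (simp add: abs_divide divide_right_mono)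
    also have "\<dots> = 2 + 1 / r" using r by (simp add: add_divide_distrib)
    finally show "\<bar>v / r\<bar> \<le> C" using i unfolding C by linarith
    have "2 * v\<^sup>2 / r\<^sup>2 \<le> 2 * (2 * r) / r\<^sup>2" using that by (intro divide_right_mono) auto
    also have "\<dots> = 4 * (1 / r)" using r by (simp add: power2_eq_square)
    finally have "2 * v\<^sup>2 / r\<^sup>2 \<le> 4 * (1 / r)" .
    moreover have "0 \<le> 2 * v\<^sup>2 / r\<^sup>2" by simp
    ultimately show "\<bar>2 / r - 2 * v\<^sup>2 / r\<^sup>2\<bar> \<le> C" using i unfolding C by linarith
  qed
  have b: "\<bar>p a b\<bar> \<le> C" "\<bar>p' a b\<bar> \<le> C" "\<bar>q a b\<bar> \<le> C" "\<bar>q' a b\<bar> \<le> C" for a b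
    unfolding p_def q_def p'_def q'_def by (intro bnd PQ se)+
  have div: "(LINT x|mu. p' (x $ 1) (x $ 2) + q' (x $ 1) (x $ 2)) =
    - 2 * (LINT x|lborel. p (x $ 1) (x $ 2) * d1 x + q (x $ 1) (x $ 2) * d2 x)"
  proof (rule divergence_identity[OF _ _ c b])
    have dP: "(P has_real_derivative 2) (at a)" "(Q has_real_derivative 2) (at a)" for a
      unfolding P_def Q_def by (auto intro!: derivative_eq_intros)
    show "((\<lambda>a. p a b) has_real_derivative p' a b) (at a)" for a b
      unfolding p_def p'_def using sn[of a b]
      by (auto intro!: derivative_eq_intros dP ds simp: field_simps power2_eq_square)
    show "((\<lambda>b. q a b) has_real_derivative q' a b) (at b)" for a b
      unfolding q_def q'_def using sn[of a b]
      by (auto intro!: derivative_eq_intros dP ds simp: field_simps power2_eq_square)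
  qed
  note [measurable] = borel_measurable_continuous_onI[OF c(1)] borel_measurable_continuous_onI[OF c(2)]
     borel_measurable_continuous_onI[OF c(3)] borel_measurable_continuous_onI[OF c(4)]
  have ipq: "integrable mu (\<lambda>x. (p (x $ 1) (x $ 2))\<^sup>2 + (q (x $ 1) (x $ 2))\<^sup>2)"
  proof (rule integrable_mu_bounded[where C = "C\<^sup>2 + C\<^sup>2"])
    fix x
    show "\<bar>(p (x $ 1) (x $ 2))\<^sup>2 + (q (x $ 1) (x $ 2))\<^sup>2\<bar> \<le> C\<^sup>2 + C\<^sup>2"
      using power_mono[OF b(1) abs_ge_zero, of "x $ 1" "x $ 2" 2] power_mono[OF b(3) abs_ge_zero, of "x $ 1" "x $ 2" 2] by simp
  qed measurable
  have idiv: "integrable mu (\<lambda>x. p' (x $ 1) (x $ 2) + q' (x $ 1) (x $ 2))"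
    by (intro Bochner_Integration.integrable_add; rule integrable_mu_bounded[where C = C]; use b in simp)
  have il: "integrable lborel (\<lambda>x. rho x *\<^sub>R ((p (x $ 1) (x $ 2))\<^sup>2 + (q (x $ 1) (x $ 2))\<^sup>2))"
    using ipq by (subst (asm) integrable_mu_iff) auto
  have id: "integrable lborel (\<lambda>x. p (x $ 1) (x $ 2) * d1 x + q (x $ 1) (x $ 2) * d2 x)"
  proof (rule Bochner_Integration.integrable_bound)
    show "integrable lborel (\<lambda>x. C * (\<bar>d1 x\<bar> + \<bar>d2 x\<bar>))" using integrable_d1 integrable_d2 by simp
    show "AE x in lborel. norm (p (x $ 1) (x $ 2) * d1 x + q (x $ 1) (x $ 2) * d2 x) \<le> norm (C * (\<bar>d1 x\<bar> + \<bar>d2 x\<bar>))"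
    proof (rule AE_I2)
      fix x :: "real^2"
      have "\<bar>p (x $ 1) (x $ 2) * d1 x\<bar> \<le> C * \<bar>d1 x\<bar>" "\<bar>q (x $ 1) (x $ 2) * d2 x\<bar> \<le> C * \<bar>d2 x\<bar>"
        unfolding abs_mult by (intro mult_right_mono b abs_ge_zero)+
      then have "\<bar>p (x $ 1) (x $ 2) * d1 x + q (x $ 1) (x $ 2) * d2 x\<bar> \<le> C * (\<bar>d1 x\<bar> + \<bar>d2 x\<bar>)"
        unfolding distrib_left by linarith
      then show "norm (p (x $ 1) (x $ 2) * d1 x + q (x $ 1) (x $ 2) * d2 x) \<le> norm (C * (\<bar>d1 x\<bar> + \<bar>d2 x\<bar>))"
        by (simp only: real_norm_def)
    qed
  qed measurable
  have "(LINT x|mu. p' (x $ 1) (x $ 2) + q' (x $ 1) (x $ 2)) = (LINT x|lborel. - 2 * (p (x $ 1) (x $ 2) * d1 x + q (x $ 1) (x $ 2) * d2 x))"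
    unfolding div by (rule integral_mult_right_zero[symmetric])
  also have "\<dots> \<le> (LINT x|lborel. rho x *\<^sub>R ((p (x $ 1) (x $ 2))\<^sup>2 + (q (x $ 1) (x $ 2))\<^sup>2) + dens x)"
    by (intro integral_mono Bochner_Integration.integrable_add il integrable_dens completing_square integrable_mult_right id)
  also have "\<dots> = (LINT x|mu. (p (x $ 1) (x $ 2))\<^sup>2 + (q (x $ 1) (x $ 2))\<^sup>2) + D"
    unfolding D_def by (subst Bochner_Integration.integral_add[OF il integrable_dens]) (simp add: integral_mu)
  finally have "(LINT x|mu. (p' (x $ 1) (x $ 2) + q' (x $ 1) (x $ 2)) - ((p (x $ 1) (x $ 2))\<^sup>2 + (q (x $ 1) (x $ 2))\<^sup>2)) \<le> D"
    by (subst Bochner_Integration.integral_diff[OF idiv ipq]) simp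
  moreover have "(p' (x $ 1) (x $ 2) + q' (x $ 1) (x $ 2)) - ((p (x $ 1) (x $ 2))\<^sup>2 + (q (x $ 1) (x $ 2))\<^sup>2) = hardy_weight e x y z" for x
    unfolding hardy_weight_def ss W p_def q_def p'_def q'_def
    by (simp add: add_divide_distrib power_divide distrib_left)
  ultimately show ?thesis by simp
qed

section \<open>Exchange symmetry of the three-particle measure\<close>

sublocale mm: pair_sigma_finite mu mu ..

abbreviation mu3 :: "((real^2) \<times> (real^2) \<times> (real^2)) measure" where
  "mu3 \<equiv> mu \<Otimes>\<^sub>M (mu \<Otimes>\<^sub>M mu)"

lemma nn_integral_mu3:
  assumes [measurable]: "g \<in> borel_measurable mu3"
  shows "(\<integral>\<^sup>+p. g p \<partial>mu3) = (\<integral>\<^sup>+x. \<integral>\<^sup>+y. \<integral>\<^sup>+z. g (x, y, z) \<partial>mu \<partial>mu \<partial>mu)"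
proof -
  have "(\<integral>\<^sup>+p. g p \<partial>mu3) = (\<integral>\<^sup>+x. \<integral>\<^sup>+q. g (x, q) \<partial>(mu \<Otimes>\<^sub>M mu) \<partial>mu)"
    by (rule sigma_finite_measure.nn_integral_fst[symmetric]) (use mm.sigma_finite_measure_axioms in measurable)
  also have "\<dots> = (\<integral>\<^sup>+x. \<integral>\<^sup>+y. \<integral>\<^sup>+z. g (x, y, z) \<partial>mu \<partial>mu \<partial>mu)"
    by (intro nn_integral_cong mu.nn_integral_fst[symmetric]) measurable
  finally show ?thesis .
qed

lemma distr_mu3_swap12: "distr mu3 mu3 (\<lambda>(x, y, z). (y, x, z)) = mu3"
proof (rule measure_eqI)
  fix A assume A: "A \<in> sets (distr mu3 mu3 (\<lambda>(x, y, z). (y, x, z)))"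
  then have [measurable]: "A \<in> sets mu3" by simp
  have "emeasure (distr mu3 mu3 (\<lambda>(x, y, z). (y, x, z))) A = (\<integral>\<^sup>+p. indicator A p \<partial>(distr mu3 mu3 (\<lambda>(x, y, z). (y, x, z))))"
    by (rule nn_integral_indicator[OF A, symmetric])
  also have "\<dots> = (\<integral>\<^sup>+p. indicator A (case p of (x, y, z) \<Rightarrow> (y, x, z)) \<partial>mu3)"
    by (rule nn_integral_distr) measurable
  also have "\<dots> = (\<integral>\<^sup>+x. \<integral>\<^sup>+y. \<integral>\<^sup>+z. indicator A (y, x, z) \<partial>mu \<partial>mu \<partial>mu)"
    by (subst nn_integral_mu3) simp_all
  also have "\<dots> = (\<integral>\<^sup>+y. \<integral>\<^sup>+x. \<integral>\<^sup>+z. indicator A (y, x, z) \<partial>mu \<partial>mu \<partial>mu)"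
    by (rule mm.Fubini') measurable
  also have "\<dots> = (\<integral>\<^sup>+p. indicator A p \<partial>mu3)"
    by (subst nn_integral_mu3) simp_all
  also have "\<dots> = emeasure mu3 A" by (rule nn_integral_indicator) fact
  finally show "emeasure (distr mu3 mu3 (\<lambda>(x, y, z). (y, x, z))) A = emeasure mu3 A" .
qed simp

lemma distr_mu3_swap23: "distr mu3 mu3 (\<lambda>(x, y, z). (x, z, y)) = mu3"
proof (rule measure_eqI)
  fix A assume A: "A \<in> sets (distr mu3 mu3 (\<lambda>(x, y, z). (x, z, y)))"
  then have [measurable]: "A \<in> sets mu3" by simp
  have "emeasure (distr mu3 mu3 (\<lambda>(x, y, z). (x, z, y))) A = (\<integral>\<^sup>+p. indicator A p \<partial>(distr mu3 mu3 (\<lambda>(x, y, z). (x, z, y))))"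
    by (rule nn_integral_indicator[OF A, symmetric])
  also have "\<dots> = (\<integral>\<^sup>+p. indicator A (case p of (x, y, z) \<Rightarrow> (x, z, y)) \<partial>mu3)"
    by (rule nn_integral_distr) measurable
  also have "\<dots> = (\<integral>\<^sup>+x. \<integral>\<^sup>+y. \<integral>\<^sup>+z. indicator A (x, z, y) \<partial>mu \<partial>mu \<partial>mu)"
    by (subst nn_integral_mu3) simp_all
  also have "\<dots> = (\<integral>\<^sup>+x. \<integral>\<^sup>+z. \<integral>\<^sup>+y. indicator A (x, z, y) \<partial>mu \<partial>mu \<partial>mu)"
    by (intro nn_integral_cong mm.Fubini') measurable
  also have "\<dots> = (\<integral>\<^sup>+p. indicator A p \<partial>mu3)"
    by (subst nn_integral_mu3) simp_all
  also have "\<dots> = emeasure mu3 A" by (rule nn_integral_indicator) fact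
  finally show "emeasure (distr mu3 mu3 (\<lambda>(x, y, z). (x, z, y))) A = emeasure mu3 A" .
qed simp

text \<open>The two transpositions above generate all permutations; the argument order
  \<open>(z, x, y)\<close> arises from exchanging \<open>x\<close> with \<open>y\<close> and then
  \<open>y\<close> with \<open>z\<close>.\<close>

lemma mu3_cyclic:
  fixes f :: "real^2 \<Rightarrow> real^2 \<Rightarrow> real^2 \<Rightarrow> real"
  assumes i: "integrable mu3 (\<lambda>(x, y, z). f x y z)"
  shows "integrable mu3 (\<lambda>(x, y, z). f y x z)" "integrable mu3 (\<lambda>(x, y, z). f z x y)"
    "(LINT (x, y, z)|mu3. f y x z) = (LINT (x, y, z)|mu3. f x y z)"
    "(LINT (x, y, z)|mu3. f z x y) = (LINT (x, y, z)|mu3. f x y z)"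
proof -
  have s12: "integrable mu3 (\<lambda>(x, y, z). f y x z)" "(LINT (x, y, z)|mu3. f y x z) = (LINT (x, y, z)|mu3. f x y z)"
    if i: "integrable mu3 (\<lambda>(x, y, z). f x y z)" for f :: "real^2 \<Rightarrow> real^2 \<Rightarrow> real^2 \<Rightarrow> real"
  proof -
    have m: "(\<lambda>(x, y, z). f x y z) \<in> borel_measurable mu3" using i by (rule borel_measurable_integrable)
    have T: "(\<lambda>(x, y, z). (y, x, z)) \<in> mu3 \<rightarrow>\<^sub>M mu3" by measurable
    show "integrable mu3 (\<lambda>(x, y, z). f y x z)"
      using integrable_distr[OF T, of "\<lambda>(x, y, z). f x y z"] i unfolding distr_mu3_swap12 by (simp add: case_prod_beta')
    show "(LINT (x, y, z)|mu3. f y x z) = (LINT (x, y, z)|mu3. f x y z)"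
      using integral_distr[OF T m] unfolding distr_mu3_swap12 by (simp add: case_prod_beta')
  qed
  have s23: "integrable mu3 (\<lambda>(x, y, z). f x z y)" "(LINT (x, y, z)|mu3. f x z y) = (LINT (x, y, z)|mu3. f x y z)"
    if i: "integrable mu3 (\<lambda>(x, y, z). f x y z)" for f :: "real^2 \<Rightarrow> real^2 \<Rightarrow> real^2 \<Rightarrow> real"
  proof -
    have m: "(\<lambda>(x, y, z). f x y z) \<in> borel_measurable mu3" using i by (rule borel_measurable_integrable)
    have T: "(\<lambda>(x, y, z). (x, z, y)) \<in> mu3 \<rightarrow>\<^sub>M mu3" by measurable
    show "integrable mu3 (\<lambda>(x, y, z). f x z y)"
      using integrable_distr[OF T, of "\<lambda>(x, y, z). f x y z"] i unfolding distr_mu3_swap23 by (simp add: case_prod_beta')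
    show "(LINT (x, y, z)|mu3. f x z y) = (LINT (x, y, z)|mu3. f x y z)"
      using integral_distr[OF T m] unfolding distr_mu3_swap23 by (simp add: case_prod_beta')
  qed
  show "integrable mu3 (\<lambda>(x, y, z). f y x z)" "(LINT (x, y, z)|mu3. f y x z) = (LINT (x, y, z)|mu3. f x y z)"
    by (rule s12[OF i])+
  show "integrable mu3 (\<lambda>(x, y, z). f z x y)" "(LINT (x, y, z)|mu3. f z x y) = (LINT (x, y, z)|mu3. f x y z)"
    using s23[OF s12(1)[OF i]] s12(2)[OF i] by simp_all
qed

end

locale normalized_H1_function = H1_function +
  assumes normalized: "(LINT x|lborel. rho x) = 1"
begin

lemma emeasure_mu: "emeasure mu UNIV = 1"
proof -
  have "emeasure mu UNIV = (\<integral>\<^sup>+x. ennreal (rho x) \<partial>lborel)"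
    by (simp add: mu_def emeasure_density)
  also have "\<dots> = ennreal (LINT x|lborel. rho x)"
    by (intro nn_integral_eq_integral integrable_rho) (simp add: rho_nonneg)
  finally show ?thesis using normalized by simp
qed

lemma emeasure_mu2: "emeasure (mu \<Otimes>\<^sub>M mu) UNIV = 1"
  using mu.emeasure_pair_measure_Times[of UNIV mu UNIV] by (simp add: emeasure_mu)

sublocale mu2: finite_measure "mu \<Otimes>\<^sub>M mu"
  by (rule finite_measure_pair_measure; rule mu.finite_measure_axioms)

sublocale m3: pair_sigma_finite mu "mu \<Otimes>\<^sub>M mu" ..

sublocale mu3: finite_measure mu3
  by (rule finite_measure_pair_measure; (rule mu.finite_measure_axioms mu2.finite_measure_axioms))

lemma hardy_weight_integrable:
  assumes "0 < e" shows "integrable mu3 (\<lambda>(x, y, z). hardy_weight e x y z)"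
  by (rule mu3.integrable_const_bound[where B = "10 / e\<^sup>2"]) (use hardy_weight_bound[OF assms] in \<open>auto\<close>)

text \<open>\<open>hardy_section\<close> bounds the integral over \<open>x\<close> for each fixed
  pair \<open>(y, z)\<close>; integrating over the pair, of total mass 1, keeps the bound
  \<open>D\<close>. By symmetry the three weights have equal integrals, and their sum dominates
  \<open>3 / (side_sum + e^2)\<close>.\<close>

lemma hardy_triple:
  assumes e: "0 < e"
  shows "(LINT (x, y, z)|mu3. 1 / (side_sum x y z + e\<^sup>2)) \<le> D"
    and "integrable mu3 (\<lambda>(x, y, z). 1 / (side_sum x y z + e\<^sup>2))"
proof -
  have e2: "0 < e\<^sup>2" using e by simp
  note i = hardy_weight_integrable[OF e]
  have sb: "0 \<le> 1 / (side_sum x y z + e\<^sup>2)" "1 / (side_sum x y z + e\<^sup>2) \<le> 1 / e\<^sup>2" for x y z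
    using side_sum_nonneg[of x y z] e2 by (auto intro!: frac_le)
  show si: "integrable mu3 (\<lambda>(x, y, z). 1 / (side_sum x y z + e\<^sup>2))"
    by (rule mu3.integrable_const_bound[where B = "1 / e\<^sup>2"]) (use sb in auto)
  have "(LINT (x, y, z)|mu3. hardy_weight e x y z) = (LINT q|(mu \<Otimes>\<^sub>M mu). LINT x|mu. (case (x, q) of (x, y, z) \<Rightarrow> hardy_weight e x y z))"
    using m3.integral_snd[of "\<lambda>x q. case (x, q) of (x, y, z) \<Rightarrow> hardy_weight e x y z"] i
    by (simp add: case_prod_beta')
  also have "\<dots> \<le> (LINT q|(mu \<Otimes>\<^sub>M mu). D)"
  proof (rule integral_mono)
    show "integrable (mu \<Otimes>\<^sub>M mu) (\<lambda>q. LINT x|mu. (case (x, q) of (x, y, z) \<Rightarrow> hardy_weight e x y z))"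
      using m3.integrable_snd[of "\<lambda>x q. case (x, q) of (x, y, z) \<Rightarrow> hardy_weight e x y z"] i by (simp add: case_prod_beta')
    show "(LINT x|mu. (case (x, q) of (x, y, z) \<Rightarrow> hardy_weight e x y z)) \<le> D" for q
      using hardy_section[OF e] by (cases q) simp
  qed simp
  also have "\<dots> = D" by (simp add: measure_def space_pair_measure emeasure_mu2)
  finally have h: "(LINT (x, y, z)|mu3. hardy_weight e x y z) \<le> D" .
  note c = mu3_cyclic[OF i]
  have "3 * (LINT (x, y, z)|mu3. 1 / (side_sum x y z + e\<^sup>2)) = (LINT (x, y, z)|mu3. 3 * (1 / (side_sum x y z + e\<^sup>2)))"
    by (simp add: case_prod_beta' flip: integral_mult_right_zero)
  also have "\<dots> \<le> (LINT p|mu3. ((case p of (x, y, z) \<Rightarrow> hardy_weight e x y z) + (case p of (x, y, z) \<Rightarrow> hardy_weight e y x z)) + (case p of (x, y, z) \<Rightarrow> hardy_weight e z x y))"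
  proof (rule integral_mono)
    show "integrable mu3 (\<lambda>(x, y, z). 3 * (1 / (side_sum x y z + e\<^sup>2)))"
      using integrable_mult_right[OF si, of 3] by (simp add: case_prod_beta')
    show "integrable mu3 (\<lambda>p. ((case p of (x, y, z) \<Rightarrow> hardy_weight e x y z) + (case p of (x, y, z) \<Rightarrow> hardy_weight e y x z)) + (case p of (x, y, z) \<Rightarrow> hardy_weight e z x y))"
      by (intro Bochner_Integration.integrable_add i c)
    show "(case p of (x, y, z) \<Rightarrow> 3 * (1 / (side_sum x y z + e\<^sup>2))) \<le> ((case p of (x, y, z) \<Rightarrow> hardy_weight e x y z) + (case p of (x, y, z) \<Rightarrow> hardy_weight e y x z)) + (case p of (x, y, z) \<Rightarrow> hardy_weight e z x y)" for p
      using hardy_weight_cyclic[OF e] by (cases p) simp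
  qed
  also have "\<dots> = (LINT (x, y, z)|mu3. hardy_weight e x y z) + (LINT (x, y, z)|mu3. hardy_weight e y x z) + (LINT (x, y, z)|mu3. hardy_weight e z x y)"
    by (subst Bochner_Integration.integral_add[OF Bochner_Integration.integrable_add[OF i c(1)] c(2)], subst Bochner_Integration.integral_add[OF i c(1)]) (rule refl)
  also have "\<dots> \<le> 3 * D" unfolding c(3,4) using h by simp
  finally show "(LINT (x, y, z)|mu3. 1 / (side_sum x y z + e\<^sup>2)) \<le> D" by simp
qed

text \<open>The bound \<open>D\<close> does not depend on the regularisation, so Fatou yields
  integrability across the singularity together with the bound.\<close>

lemma side_sum_inverse_integrable:
  "integrable mu3 (\<lambda>(x, y, z). 1 / side_sum x y z)" "(LINT (x, y, z)|mu3. 1 / side_sum x y z) \<le> D"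
proof -
  let ?e = "\<lambda>k. 1 / real (Suc k)"
  have e0: "?e \<longlonglongrightarrow> 0" using LIMSEQ_inverse_real_of_nat by (simp add: inverse_eq_divide)
  have nn: "(\<integral>\<^sup>+p. ennreal (case p of (x, y, z) \<Rightarrow> 1 / side_sum x y z) \<partial>mu3) \<le> ennreal D"
  proof -
    have bd: "(\<integral>\<^sup>+p. ennreal (case p of (x, y, z) \<Rightarrow> 1 / (side_sum x y z + (?e k)\<^sup>2)) \<partial>mu3) \<le> ennreal D" for k
      by (subst nn_integral_eq_integral[OF hardy_triple(2)]) (auto intro!: ennreal_leI hardy_triple(1) simp: side_sum_nonneg)
    have "(\<integral>\<^sup>+p. ennreal (case p of (x, y, z) \<Rightarrow> 1 / side_sum x y z) \<partial>mu3) \<le>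
        (\<integral>\<^sup>+p. liminf (\<lambda>k. ennreal (case p of (x, y, z) \<Rightarrow> 1 / (side_sum x y z + (?e k)\<^sup>2))) \<partial>mu3)"
    proof (rule nn_integral_mono)
      fix p :: "(real^2) \<times> (real^2) \<times> (real^2)"
      obtain x y z where p: "p = (x, y, z)" by (cases p) auto
      show "ennreal (case p of (x, y, z) \<Rightarrow> 1 / side_sum x y z) \<le> liminf (\<lambda>k. ennreal (case p of (x, y, z) \<Rightarrow> 1 / (side_sum x y z + (?e k)\<^sup>2)))"
      \<comment> \<open>For three coinciding points the left side is
        \<open>1 / 0 = 0\<close>.\<close>
      proof (cases "side_sum x y z = 0")
        case False
        have "(\<lambda>k. 1 / (side_sum x y z + (?e k)\<^sup>2)) \<longlonglongrightarrow> 1 / (side_sum x y z + 0\<^sup>2)"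
          by (intro tendsto_intros e0) (use False in simp)
        then have "(\<lambda>k. ennreal (1 / (side_sum x y z + (?e k)\<^sup>2))) \<longlonglongrightarrow> ennreal (1 / side_sum x y z)"
          by (intro tendsto_ennrealI) simp
        from lim_imp_Liminf[OF trivial_limit_sequentially this] show ?thesis unfolding p prod.case by (simp only: order_refl)
      qed (simp add: p)
    qed
    also have "\<dots> \<le> liminf (\<lambda>k. \<integral>\<^sup>+p. ennreal (case p of (x, y, z) \<Rightarrow> 1 / (side_sum x y z + (?e k)\<^sup>2)) \<partial>mu3)"
      by (rule nn_integral_liminf) measurable
    also have "\<dots> \<le> ennreal D"
      using Liminf_mono[OF always_eventually[OF allI[OF bd]], of sequentially] by (simp add: Liminf_const)
    finally show ?thesis .
  qed
  have nonneg: "0 \<le> (case p of (x, y, z) \<Rightarrow> 1 / side_sum x y z)" for p :: "(real^2) \<times> (real^2) \<times> (real^2)" by (cases p) (simp add: side_sum_nonneg)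
  show i: "integrable mu3 (\<lambda>(x, y, z). 1 / side_sum x y z)"
  proof (rule integrableI_nonneg)
    show "(\<integral>\<^sup>+p. ennreal (case p of (x, y, z) \<Rightarrow> 1 / side_sum x y z) \<partial>mu3) < \<infinity>"
      using le_less_trans[OF nn ennreal_less_top] by simp
  qed (use nonneg in \<open>measurable, simp\<close>)
  show "(LINT (x, y, z)|mu3. 1 / side_sum x y z) \<le> D"
    using nn nn_integral_eq_integral[OF i] nonneg D_nonneg by (simp add: ennreal_le_iff)
qed

text \<open>\<open>triple_kern\<close> has no sign, so integrability must precede symmetrisation.
  The inverse distances to \<open>z\<close> and to \<open>y\<close> are integrated one after the
  other, each time at the cost of \<open>grad_mass\<close>.\<close>

lemma triple_kern_integrable: "integrable mu3 (\<lambda>(x, y, z). triple_kern x y z)"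
proof (rule integrableI_bounded)
  have b: "\<bar>triple_kern x y z\<bar> \<le> 2 * (1 / norm (x - y) * (1 / norm (x - z)))" for x y z
  proof -
    have "\<bar>kern j (x - y) * kern j (x - z)\<bar> \<le> 1 / norm (x - y) * (1 / norm (x - z))" for j
      unfolding abs_mult by (intro mult_mono kern_bound) auto
    from this[of 1] this[of 2] show ?thesis unfolding triple_kern_def by linarith
  qed
  have em: "ennreal (2 * (a * b)) = 2 * ennreal a * ennreal b" if "0 \<le> a" "0 \<le> b" for a b
    using that by (simp add: ennreal_mult mult.assoc)
  have m: "(\<lambda>p. ennreal (norm (case p of (x, y, z) \<Rightarrow> triple_kern x y z))) \<in> borel_measurable mu3" by measurable
  have "(\<integral>\<^sup>+p. ennreal (norm (case p of (x, y, z) \<Rightarrow> triple_kern x y z)) \<partial>mu3) =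
     (\<integral>\<^sup>+x. \<integral>\<^sup>+y. \<integral>\<^sup>+z. ennreal \<bar>triple_kern x y z\<bar> \<partial>mu \<partial>mu \<partial>mu)"
    by (subst nn_integral_mu3[OF m]) simp
  also have "\<dots> \<le> (\<integral>\<^sup>+x. \<integral>\<^sup>+y. \<integral>\<^sup>+z. 2 * ennreal (1 / norm (x - y)) * ennreal (1 / norm (x - z)) \<partial>mu \<partial>mu \<partial>mu)"
  proof (intro nn_integral_mono)
    fix x y z
    have "ennreal \<bar>triple_kern x y z\<bar> \<le> ennreal (2 * (1 / norm (x - y) * (1 / norm (x - z))))" by (intro ennreal_leI b)
    also have "\<dots> = 2 * ennreal (1 / norm (x - y)) * ennreal (1 / norm (x - z))"
      by (rule em) simp_all
    finally show "ennreal \<bar>triple_kern x y z\<bar> \<le> 2 * ennreal (1 / norm (x - y)) * ennreal (1 / norm (x - z))" .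
  qed
  also have "\<dots> = (\<integral>\<^sup>+x. \<integral>\<^sup>+y. 2 * ennreal (1 / norm (x - y)) * (\<integral>\<^sup>+z. ennreal (1 / norm (x - z)) \<partial>mu) \<partial>mu \<partial>mu)"
    by (intro nn_integral_cong nn_integral_cmult) measurable
  also have "\<dots> \<le> (\<integral>\<^sup>+x. \<integral>\<^sup>+y. 2 * ennreal (1 / norm (x - y)) * ennreal grad_mass \<partial>mu \<partial>mu)"
    by (intro nn_integral_mono mult_left_mono nn_potential_bound) simp
  also have "\<dots> = (\<integral>\<^sup>+x. 2 * (\<integral>\<^sup>+y. ennreal (1 / norm (x - y)) \<partial>mu) * ennreal grad_mass \<partial>mu)"
    by (intro nn_integral_cong) (subst nn_integral_multc, measurable, subst nn_integral_cmult, measurable)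
  also have "\<dots> \<le> (\<integral>\<^sup>+x. 2 * ennreal grad_mass * ennreal grad_mass \<partial>mu)"
    by (intro nn_integral_mono mult_right_mono mult_left_mono nn_potential_bound) simp_all
  also have "\<dots> < \<infinity>" by (simp add: emeasure_mu ennreal_mult_less_top)
  finally show "(\<integral>\<^sup>+p. ennreal (norm (case p of (x, y, z) \<Rightarrow> triple_kern x y z)) \<partial>mu3) < \<infinity>" .
qed measurable

lemma integral_triple_kern: "(LINT (x, y, z)|mu3. triple_kern x y z) = (LINT x|mu. (V 1 x)\<^sup>2 + (V 2 x)\<^sup>2)"
proof -
  have sec: "integrable (mu \<Otimes>\<^sub>M mu) (\<lambda>q. kern j (x - fst q) * kern j (x - snd q))" for j x
  proof (rule mm.Fubini_integrable)
    show "integrable mu (\<lambda>y. LINT z|mu. norm (kern j (x - fst (y, z)) * kern j (x - snd (y, z))))"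
      using integrable_abs[OF integrable_kern] by (simp add: abs_mult)
    show "AE y in mu. integrable mu (\<lambda>z. kern j (x - fst (y, z)) * kern j (x - snd (y, z)))"
      using integrable_kern by simp
  qed measurable
  have V2: "(LINT q|(mu \<Otimes>\<^sub>M mu). kern j (x - fst q) * kern j (x - snd q)) = (V j x)\<^sup>2" for j x
  proof -
    have "(LINT q|(mu \<Otimes>\<^sub>M mu). kern j (x - fst q) * kern j (x - snd q)) = (LINT y|mu. LINT z|mu. kern j (x - y) * kern j (x - z))"
      using mm.integral_fst'[OF sec[of j x]] by simp
    then show ?thesis by (simp add: V_def power2_eq_square)
  qed
  have "(LINT (x, y, z)|mu3. triple_kern x y z) = (LINT x|mu. LINT q|(mu \<Otimes>\<^sub>M mu). (case (x, q) of (x, y, z) \<Rightarrow> triple_kern x y z))"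
    by (rule m3.integral_fst'[OF triple_kern_integrable, symmetric])
  also have "\<dots> = (LINT x|mu. (V 1 x)\<^sup>2 + (V 2 x)\<^sup>2)"
  proof (rule Bochner_Integration.integral_cong[OF refl])
    fix x
    have "(LINT q|(mu \<Otimes>\<^sub>M mu). (case (x, q) of (x, y, z) \<Rightarrow> triple_kern x y z)) =
      (LINT q|(mu \<Otimes>\<^sub>M mu). kern 1 (x - fst q) * kern 1 (x - snd q) + kern 2 (x - fst q) * kern 2 (x - snd q))"
      by (simp add: case_prod_beta' triple_kern_def)
    then show "(LINT q|(mu \<Otimes>\<^sub>M mu). (case (x, q) of (x, y, z) \<Rightarrow> triple_kern x y z)) = (V 1 x)\<^sup>2 + (V 2 x)\<^sup>2"
      by (simp add: sec V2)
  qed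
  finally show ?thesis .
qed

text \<open>Averaging over the three choices of the apex replaces \<open>triple_kern\<close> by a
  third of the cyclic sum. A single term is not controlled by the inverse side sum, as two close
  points and a distant third show, but the cyclic sum is, because the singular parts cancel.\<close>

lemma potential_energy_bound: "(LINT x|mu. (V 1 x)\<^sup>2 + (V 2 x)\<^sup>2) \<le> 3 / 2 * D"
proof -
  note i = triple_kern_integrable
  note c = mu3_cyclic[OF i]
  note s = side_sum_inverse_integrable
  have "3 * (LINT (x, y, z)|mu3. triple_kern x y z) = (LINT (x, y, z)|mu3. triple_kern x y z) + (LINT (x, y, z)|mu3. triple_kern y x z) + (LINT (x, y, z)|mu3. triple_kern z x y)"
    unfolding c(3,4) by simp
  also have "\<dots> = (LINT p|mu3. ((case p of (x, y, z) \<Rightarrow> triple_kern x y z) + (case p of (x, y, z) \<Rightarrow> triple_kern y x z)) + (case p of (x, y, z) \<Rightarrow> triple_kern z x y))"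
    by (subst Bochner_Integration.integral_add[OF Bochner_Integration.integrable_add[OF i c(1)] c(2)], subst Bochner_Integration.integral_add[OF i c(1)]) (rule refl)
  also have "\<dots> \<le> (LINT p|mu3. 9 / 2 * (case p of (x, y, z) \<Rightarrow> 1 / side_sum x y z))"
  proof (rule integral_mono)
    show "integrable mu3 (\<lambda>p. ((case p of (x, y, z) \<Rightarrow> triple_kern x y z) + (case p of (x, y, z) \<Rightarrow> triple_kern y x z)) + (case p of (x, y, z) \<Rightarrow> triple_kern z x y))"
      by (intro Bochner_Integration.integrable_add i c)
    show "integrable mu3 (\<lambda>p. 9 / 2 * (case p of (x, y, z) \<Rightarrow> 1 / side_sum x y z))"
      by (intro integrable_mult_right s)
    show "((case p of (x, y, z) \<Rightarrow> triple_kern x y z) + (case p of (x, y, z) \<Rightarrow> triple_kern y x z)) + (case p of (x, y, z) \<Rightarrow> triple_kern z x y)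
        \<le> 9 / 2 * (case p of (x, y, z) \<Rightarrow> 1 / side_sum x y z)" for p
      using triple_kern_cyclic_bound by (cases p) auto
  qed
  also have "\<dots> = 9 / 2 * (LINT (x, y, z)|mu3. 1 / side_sum x y z)" by (rule integral_mult_right_zero)
  also have "\<dots> \<le> 9 / 2 * D" using s(2) by simp
  finally show ?thesis unfolding integral_triple_kern by simp
qed

end

section \<open>Energies and their infimum\<close>

context normalized_H1_function
begin

definition quartic :: real where "quartic = (LINT x|lborel. (rho x)\<^sup>2)"

text \<open>The magnetic energy density with the potential written through \<open>V\<close> instead
  of the limit, so that Borel measurability is visible.\<close>

definition energy_density :: "real \<Rightarrow> real^2 \<Rightarrow> real" where
  "energy_density \<beta> x = (norm (g1 x + \<i> * of_real (\<beta> * - V 2 x) * u x))\<^sup>2 + (norm (g2 x + \<i> * of_real (\<beta> * V 1 x) * u x))\<^sup>2"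

definition energy :: "real \<Rightarrow> real" where "energy \<beta> = (LINT x|lborel. energy_density \<beta> x)"

lemma quartic_pos: "0 < quartic"
proof -
  have "quartic \<noteq> 0"
  proof
    assume "quartic = 0"
    then have "AE x in lborel. (rho x)\<^sup>2 = 0"
      using integral_nonneg_eq_0_iff_AE[OF integrable_rho2] by (simp add: quartic_def)
    then have "AE x in lborel. rho x = 0" by simp
    then have "(LINT x|lborel. rho x) = 0" by (intro integral_eq_zero_AE)
    then show False using normalized by simp
  qed
  moreover have "0 \<le> quartic" unfolding quartic_def by simp
  ultimately show ?thesis by simp
qed

lemma L2_potential_term: "L2 lborel (\<lambda>x. \<i> * of_real (\<beta> * V j x) * u x)" "L2 lborel (\<lambda>x. \<i> * of_real (\<beta> * - V j x) * u x)"
proof -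
  have b: "\<bar>\<beta>\<bar> * \<bar>V j x\<bar> * norm (u x) \<le> \<bar>\<beta>\<bar> * grad_mass * norm (u x)" for x
    by (intro mult_right_mono mult_left_mono V_bound) auto
  show "L2 lborel (\<lambda>x. \<i> * of_real (\<beta> * V j x) * u x)" "L2 lborel (\<lambda>x. \<i> * of_real (\<beta> * - V j x) * u x)"
    by (rule L2_bound[OF L2_u, where C = "\<bar>\<beta>\<bar> * grad_mass"]; use b in \<open>simp add: norm_mult abs_mult\<close>)+
qed

lemma energy_density_measurable[measurable]: "energy_density \<beta> \<in> borel_measurable borel"
  unfolding energy_density_def[abs_def] by measurable

lemma energy_density_nonneg: "0 \<le> energy_density \<beta> x"
  by (simp add: energy_density_def)

lemma integrable_energy_density: "integrable lborel (energy_density \<beta>)"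
  unfolding energy_density_def[abs_def]
  by (intro Bochner_Integration.integrable_add L2_integrable L2_add L2_g1 L2_g2 L2_potential_term)

lemma energy_nonneg: "0 \<le> energy \<beta>"
  unfolding energy_def by (simp add: energy_density_nonneg)

text \<open>With the unit phase \<open>e = u / |u|\<close> the energy splits into the real parts \<open>a\<close> and imaginary
  parts \<open>b\<close> of \<open>cnj e * (grad + i \<beta> A) u\<close>. The cross product of \<open>a\<close> and \<open>b\<close> is the Jacobian of \<open>u\<close>,
  which integrates to 0, plus a multiple of the flux of the potential through the gradient of the
  density. On \<open>{u = 0}\<close> any phase will do, so the vanishing of the gradient there is not needed.\<close>

lemma energy_splitting:
  assumes "0 \<le> \<beta>"
  obtains D' R' where "energy \<beta> = D' + R'" "D \<le> D'" "0 \<le> R'" "(pi * \<beta> * quartic)\<^sup>2 \<le> D' * R'"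
proof -
  define e where "e x = (if u x = 0 then 1 else u x / of_real (norm (u x)))" for x
  have [measurable]: "e \<in> borel_measurable borel" unfolding e_def[abs_def] by measurable
  have e1: "norm (e x) = 1" for x by (simp add: e_def norm_divide)
  have eu: "cnj (e x) * u x = of_real (norm (u x))" for x
  proof (cases "u x = 0")
    case False
    have "cnj (u x) * u x = of_real (norm (u x)) * of_real (norm (u x))"
      by (metis complex_norm_square mult.commute of_real_mult power2_eq_square)
    then show ?thesis using False by (simp add: e_def)
  qed simp
  define h1 h2 where "h1 x = cnj (e x) * (g1 x + \<i> * of_real (\<beta> * - V 2 x) * u x)"
    and "h2 x = cnj (e x) * (g2 x + \<i> * of_real (\<beta> * V 1 x) * u x)" for x
  have [measurable]: "h1 \<in> borel_measurable borel" "h2 \<in> borel_measurable borel"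
    unfolding h1_def[abs_def] h2_def[abs_def] by measurable
  have L2h: "L2 lborel h1" "L2 lborel h2"
    unfolding h1_def[abs_def] h2_def[abs_def]
    by (rule L2_bound[OF L2_add[OF L2_g1 L2_potential_term(2)], where C = 1],
        auto simp: norm_mult e1,
        rule L2_bound[OF L2_add[OF L2_g2 L2_potential_term(1)], where C = 1], auto simp: norm_mult e1)
  \<comment> \<open>Pairs of reals are packed into complex numbers, so that the cross product of the
    vectors of real and of imaginary parts is \<open>Im (cnj a * b)\<close>, bounded by the product
    of the moduli.\<close>
  define a b where "a x = Complex (Re (h1 x)) (Re (h2 x))" and "b x = Complex (Im (h1 x)) (Im (h2 x))" for x
  have na: "(norm (a x))\<^sup>2 = (Re (h1 x))\<^sup>2 + (Re (h2 x))\<^sup>2" and nb: "(norm (b x))\<^sup>2 = (Im (h1 x))\<^sup>2 + (Im (h2 x))\<^sup>2" for x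
    by (simp_all add: a_def b_def cmod_power2)
  have ed: "energy_density \<beta> x = (norm (a x))\<^sup>2 + (norm (b x))\<^sup>2" for x
  proof -
    have "energy_density \<beta> x = (norm (h1 x))\<^sup>2 + (norm (h2 x))\<^sup>2"
      by (simp add: energy_density_def h1_def h2_def norm_mult e1)
    then show ?thesis unfolding na nb by (simp add: cmod_power2)
  qed
  have aeq: "a x = of_real (Re (h1 x)) + \<i> * of_real (Re (h2 x))" "b x = of_real (Im (h1 x)) + \<i> * of_real (Im (h2 x))" for x
    by (simp_all add: a_def b_def complex_eq_iff)
  have [measurable]: "a \<in> borel_measurable borel" "b \<in> borel_measurable borel"
    unfolding aeq[abs_def] by measurable
  have le: "(norm (a x))\<^sup>2 \<le> energy_density \<beta> x" "(norm (b x))\<^sup>2 \<le> energy_density \<beta> x" for x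
    by (simp_all add: ed)
  have "integrable lborel (\<lambda>x. (norm (a x))\<^sup>2)" "integrable lborel (\<lambda>x. (norm (b x))\<^sup>2)"
    by (rule Bochner_Integration.integrable_bound[OF integrable_energy_density[of \<beta>]]; use le energy_density_nonneg in simp)+
  then have L2a: "L2 lborel a" and L2b: "L2 lborel b" by (simp_all add: L2_def)
  define D' R' where "D' = (LINT x|lborel. (norm (a x))\<^sup>2)" and "R' = (LINT x|lborel. (norm (b x))\<^sup>2)"
  have "energy \<beta> = D' + R'"
    unfolding energy_def D'_def R'_def ed using L2a L2b by (simp add: L2_def)
  moreover have ua: "norm (u x) * Re (h1 x) = d1 x" "norm (u x) * Re (h2 x) = d2 x" for x
  proof -
    have c: "norm (u x) * Re (cnj (e x) * g) = u x \<bullet> g" for g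
      by (cases "u x = 0") (simp_all add: e_def inner_complex_def field_simps)
    have "h1 x = cnj (e x) * g1 x + \<i> * of_real (\<beta> * - V 2 x) * (cnj (e x) * u x)"
      "h2 x = cnj (e x) * g2 x + \<i> * of_real (\<beta> * V 1 x) * (cnj (e x) * u x)"
      by (simp_all add: h1_def h2_def algebra_simps)
    then have "Re (h1 x) = Re (cnj (e x) * g1 x)" "Re (h2 x) = Re (cnj (e x) * g2 x)"
      unfolding eu by simp_all
    then show "norm (u x) * Re (h1 x) = d1 x" "norm (u x) * Re (h2 x) = d2 x"
      using c by (simp_all only: d1_def d2_def)
  qed
  have "D \<le> D'"
    unfolding D_def D'_def
  proof (rule integral_mono[OF integrable_dens])
    show "integrable lborel (\<lambda>x. (norm (a x))\<^sup>2)" using L2a by (simp add: L2_def)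
    fix x
    show "dens x \<le> (norm (a x))\<^sup>2"
    proof (cases "u x = 0")
      case False
      then show ?thesis
        unfolding dens_def na ua[symmetric] rho_def by (simp add: power_mult_distrib flip: distrib_left)
    qed (simp add: dens_def rho_def)
  qed
  moreover have "0 \<le> R'" unfolding R'_def by simp
  moreover have "(pi * \<beta> * quartic)\<^sup>2 \<le> D' * R'"
  proof -
    have cross: "Im (cnj (a x) * b x) = Im (cnj (g1 x) * g2 x) + \<beta> * (V 1 x * d1 x + V 2 x * d2 x)" for x
    proof -
      have n: "cnj (e x) * e x = 1"
        using complex_norm_square[of "e x"] e1[of x] by (simp add: mult.commute)
      have "cnj (h1 x) * h2 x = (e x * cnj (e x)) * (cnj (g1 x) * g2 x) + cnj (g1 x) * (\<i> * of_real (\<beta> * V 1 x) * u x) * (e x * cnj (e x))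
          + cnj (\<i> * of_real (\<beta> * - V 2 x) * u x) * g2 x * (e x * cnj (e x))
          + cnj (\<i> * of_real (\<beta> * - V 2 x) * u x) * (\<i> * of_real (\<beta> * V 1 x) * u x) * (e x * cnj (e x))"
        by (simp add: h1_def h2_def algebra_simps)
      \<comment> \<open>The last product is real, namely \<open>- \<beta>^2 V1 V2 |u|^2\<close>; the
        two before it contribute \<open>\<beta> V1 d1\<close> and \<open>\<beta> V2 d2\<close> to
        the imaginary part.\<close>
      then have eqn: "cnj (h1 x) * h2 x = cnj (g1 x) * g2 x + cnj (g1 x) * (\<i> * of_real (\<beta> * V 1 x) * u x)
          + cnj (\<i> * of_real (\<beta> * - V 2 x) * u x) * g2 x
          + cnj (\<i> * of_real (\<beta> * - V 2 x) * u x) * (\<i> * of_real (\<beta> * V 1 x) * u x)"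
        using n by (simp add: mult.commute[of "e x"])
      have "Im (cnj (h1 x) * h2 x) = Im (cnj (g1 x) * g2 x) + \<beta> * (V 1 x * d1 x + V 2 x * d2 x)"
        unfolding eqn by (simp add: d1_def d2_def inner_complex_def algebra_simps)
      moreover have "Im (cnj (a x) * b x) = Im (cnj (h1 x) * h2 x)"
        by (simp add: a_def b_def algebra_simps)
      ultimately show ?thesis by simp
    qed
    have iJ: "integrable lborel (\<lambda>x. Im (cnj (g1 x) * g2 x))"
      by (intro integrable_Im L2_mult_integrable L2_cnj L2_g1 L2_g2)
    have iV: "integrable lborel (\<lambda>x. V 1 x * d1 x + V 2 x * d2 x)"
    proof (rule Bochner_Integration.integrable_bound)
      show "integrable lborel (\<lambda>x. grad_mass * (\<bar>d1 x\<bar> + \<bar>d2 x\<bar>))" using integrable_d1 integrable_d2 by simp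
      show "AE x in lborel. norm (V 1 x * d1 x + V 2 x * d2 x) \<le> norm (grad_mass * (\<bar>d1 x\<bar> + \<bar>d2 x\<bar>))"
      proof (rule AE_I2)
        fix x
        have "\<bar>V 1 x * d1 x\<bar> \<le> grad_mass * \<bar>d1 x\<bar>" "\<bar>V 2 x * d2 x\<bar> \<le> grad_mass * \<bar>d2 x\<bar>"
          unfolding abs_mult by (intro mult_right_mono V_bound abs_ge_zero)+
        then have "\<bar>V 1 x * d1 x + V 2 x * d2 x\<bar> \<le> grad_mass * (\<bar>d1 x\<bar> + \<bar>d2 x\<bar>)"
          unfolding distrib_left by linarith
        then show "norm (V 1 x * d1 x + V 2 x * d2 x) \<le> norm (grad_mass * (\<bar>d1 x\<bar> + \<bar>d2 x\<bar>))"
          by (simp add: abs_of_nonneg grad_mass_nonneg)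
      qed
    qed measurable
    have "(LINT x|lborel. Im (cnj (a x) * b x)) = (LINT x|lborel. Im (cnj (g1 x) * g2 x)) + (LINT x|lborel. \<beta> * (V 1 x * d1 x + V 2 x * d2 x))"
      unfolding cross by (rule Bochner_Integration.integral_add[OF iJ integrable_mult_right[OF iV]])
    also have "\<dots> = \<beta> * (- flux / 2)"
      unfolding weak_deriv_Jacobian[OF weak1 weak2] flux_def by simp
    finally have c: "(LINT x|lborel. Im (cnj (a x) * b x)) = \<beta> * (- flux / 2)" .
    have "pi * \<beta> * quartic \<le> \<beta> * (flux / 2)"
      using mult_left_mono[OF quartic_le_flux assms] by (simp add: quartic_def algebra_simps)
    also have "\<dots> = \<bar>LINT x|lborel. Im (cnj (a x) * b x)\<bar>"
      unfolding c using assms flux_nonneg by (simp add: abs_mult)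
    also have "\<dots> \<le> (LINT x|lborel. \<bar>Im (cnj (a x) * b x)\<bar>)" by (rule integral_abs_bound)
    also have "\<dots> \<le> (LINT x|lborel. norm (a x) * norm (b x))"
    proof (rule integral_mono)
      show "integrable lborel (\<lambda>x. \<bar>Im (cnj (a x) * b x)\<bar>)"
        by (intro integrable_abs integrable_Im L2_mult_integrable L2_cnj L2a L2b)
      show "integrable lborel (\<lambda>x. norm (a x) * norm (b x))" by (rule L2_norm_mult_integrable[OF L2a L2b])
      show "\<bar>Im (cnj (a x) * b x)\<bar> \<le> norm (a x) * norm (b x)" for x
        using abs_Im_le_cmod[of "cnj (a x) * b x"] by (simp add: norm_mult)
    qed
    finally have "(pi * \<beta> * quartic)\<^sup>2 \<le> (LINT x|lborel. norm (a x) * norm (b x))\<^sup>2"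
      using assms quartic_pos by (intro power_mono) auto
    also have "\<dots> \<le> D' * R'" unfolding D'_def R'_def by (rule L2_Cauchy_Schwarz[OF L2a L2b])
    finally show ?thesis .
  qed
  ultimately show thesis by (rule that)
qed

text \<open>For real \<open>u\<close> the gradient is real and the potential term imaginary, so
  there is no cross term and the energy is a sum of squares. The assumption \<open>zero\<close>
  makes \<open>dens\<close> agree with the squared gradient also where \<open>u\<close>
  vanishes.\<close>

lemma energy_real_bound:
  assumes real: "\<And>x. Im (u x) = 0" "\<And>x. Im (g1 x) = 0" "\<And>x. Im (g2 x) = 0"
    and zero: "\<And>x. u x = 0 \<Longrightarrow> g1 x = 0 \<and> g2 x = 0"
  shows "energy \<beta> \<le> (1 + 3 / 2 * \<beta>\<^sup>2) * D"
proof -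
  have ed: "energy_density \<beta> x = dens x + \<beta>\<^sup>2 * (rho x *\<^sub>R ((V 1 x)\<^sup>2 + (V 2 x)\<^sup>2))" for x
  proof -
    have "energy_density \<beta> x = ((Re (g1 x))\<^sup>2 + (Re (g2 x))\<^sup>2) + \<beta>\<^sup>2 * (rho x * ((V 1 x)\<^sup>2 + (V 2 x)\<^sup>2))"
      by (simp add: energy_density_def rho_def cmod_power2 real power_mult_distrib algebra_simps)
    moreover have "dens x = (Re (g1 x))\<^sup>2 + (Re (g2 x))\<^sup>2"
    proof (cases "u x = 0")
      case False
      then have "Re (u x) \<noteq> 0" using real(1)[of x] by (simp add: complex_eq_iff)
      then show ?thesis
        by (simp add: dens_def rho_def d1_def d2_def inner_complex_def cmod_power2 real power_mult_distrib flip: distrib_left)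
    qed (simp add: dens_def rho_def zero)
    ultimately show ?thesis by simp
  qed
  have i: "integrable mu (\<lambda>x. (V 1 x)\<^sup>2 + (V 2 x)\<^sup>2)"
  proof (rule integrable_mu_bounded[where C = "grad_mass\<^sup>2 + grad_mass\<^sup>2"])
    show "\<bar>(V 1 x)\<^sup>2 + (V 2 x)\<^sup>2\<bar> \<le> grad_mass\<^sup>2 + grad_mass\<^sup>2" for x
      using power_mono[OF V_bound abs_ge_zero, of 1 x 2] power_mono[OF V_bound abs_ge_zero, of 2 x 2] by simp
  qed measurable
  then have il: "integrable lborel (\<lambda>x. rho x *\<^sub>R ((V 1 x)\<^sup>2 + (V 2 x)\<^sup>2))"
    by (subst (asm) integrable_mu_iff) auto
  have "energy \<beta> = D + \<beta>\<^sup>2 * (LINT x|lborel. rho x *\<^sub>R ((V 1 x)\<^sup>2 + (V 2 x)\<^sup>2))"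
    unfolding energy_def ed D_def Bochner_Integration.integral_add[OF integrable_dens integrable_mult_right[OF il]]
      integral_mult_right_zero ..
  also have "(LINT x|lborel. rho x *\<^sub>R ((V 1 x)\<^sup>2 + (V 2 x)\<^sup>2)) = (LINT x|mu. (V 1 x)\<^sup>2 + (V 2 x)\<^sup>2)"
    by (rule integral_mu[symmetric]) measurable
  also have "D + \<beta>\<^sup>2 * \<dots> \<le> D + \<beta>\<^sup>2 * (3 / 2 * D)"
    by (intro add_left_mono mult_left_mono potential_energy_bound) simp
  finally show ?thesis by (simp add: algebra_simps)
qed

text \<open>The representative of the gradient of \<open>|u|\<close> is 0 where \<open>u\<close>
  vanishes, by division by 0, which meets the assumption \<open>zero\<close> above. Passing to the
  modulus changes neither \<open>rho\<close> nor \<open>d1\<close> and \<open>d2\<close>, hence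
  neither \<open>D\<close> nor the potential.\<close>

lemma modulus_competitor:
  defines "w \<equiv> \<lambda>x. complex_of_real (norm (u x))"
    and "w1 \<equiv> \<lambda>x. complex_of_real (d1 x / norm (u x))" and "w2 \<equiv> \<lambda>x. complex_of_real (d2 x / norm (u x))"
  shows "normalized_H1_function w w1 w2"
    and "normalized_H1_function.energy w w1 w2 \<beta> \<le> (1 + 3 / 2 * \<beta>\<^sup>2) * D"
    and "normalized_H1_function.quartic w = quartic"
proof -
  have n: "normalized_H1_function w w1 w2"
  proof
    show "weak_deriv 1 w w1" "weak_deriv 2 w w2"
      unfolding w_def w1_def w2_def d1_def d2_def by (rule weak_deriv_norm[OF weak1] weak_deriv_norm[OF weak2])+
    then interpret H: H1_function w w1 w2 by unfold_locales
    show "(LINT x|lborel. H1_function.rho w x) = 1"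
      using normalized unfolding H.rho_def rho_def by (simp add: w_def)
  qed
  then show "normalized_H1_function w w1 w2" .
  interpret W: normalized_H1_function w w1 w2 by (rule n)
  have r: "W.rho = rho" unfolding fun_eq_iff W.rho_def rho_def by (simp add: w_def)
  show "W.quartic = quartic" by (simp add: W.quartic_def quartic_def r)
  have "W.d1 x = d1 x" "W.d2 x = d2 x" for x
    unfolding W.d1_def W.d2_def
    by (cases "u x = 0"; simp add: w_def w1_def w2_def inner_complex_def[of "complex_of_real _"] d1_def d2_def del: of_real_divide)+
  then have "W.D = D" by (simp add: W.D_def D_def W.dens_def dens_def r)
  then show "W.energy \<beta> \<le> (1 + 3 / 2 * \<beta>\<^sup>2) * D"
    using W.energy_real_bound[of \<beta>] by (simp add: w_def w1_def w2_def)
qed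

end

section \<open>Borel representatives of H1 functions\<close>

lemma lebesgue_borel_representative:
  fixes f :: "'a::euclidean_space \<Rightarrow> complex"
  assumes [measurable]: "f \<in> borel_measurable lebesgue"
  obtains f' where "f' \<in> borel_measurable borel" "AE x in lebesgue. f x = f' x"
proof -
  obtain r where r: "r \<in> borel_measurable lborel" "AE x in lborel. Re (f x) = r x"
    using completion_ex_borel_measurable_real[of "\<lambda>x. Re (f x)" lborel] by auto
  obtain i where i: "i \<in> borel_measurable lborel" "AE x in lborel. Im (f x) = i x"
    using completion_ex_borel_measurable_real[of "\<lambda>x. Im (f x)" lborel] by auto
  have [measurable]: "r \<in> borel_measurable borel" "i \<in> borel_measurable borel" using r i by auto
  show thesis
  proof (rule that)
    show "(\<lambda>x. of_real (r x) + \<i> * of_real (i x)) \<in> borel_measurable borel" by measurable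
    have "AE x in lborel. f x = of_real (r x) + \<i> * of_real (i x)"
      using r(2) i(2) by eventually_elim (simp add: complex_eq_iff)
    then show "AE x in lebesgue. f x = of_real (r x) + \<i> * of_real (i x)" by (rule AE_completion)
  qed
qed

lemma borel_imp_lebesgue: "f \<in> borel_measurable borel \<Longrightarrow> f \<in> borel_measurable lebesgue"
  by (rule measurable_completion) simp

lemma integral_lebesgue_representative:
  fixes f f' :: "'a::euclidean_space \<Rightarrow> 'b::{banach, second_countable_topology}"
  assumes "f \<in> borel_measurable lebesgue" "f' \<in> borel_measurable borel" "AE x in lebesgue. f x = f' x"
  shows "(LINT x|lebesgue. f x) = (LINT x|lborel. f' x)" "integrable lebesgue f \<longleftrightarrow> integrable lborel f'"
proof -
  have m: "f' \<in> borel_measurable lebesgue" by (rule borel_imp_lebesgue[OF assms(2)])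
  show "(LINT x|lebesgue. f x) = (LINT x|lborel. f' x)"
    using integral_cong_AE[OF assms(1) m assms(3)] integral_completion[of f' lborel] assms(2) by simp
  show "integrable lebesgue f \<longleftrightarrow> integrable lborel f'"
    using integrable_cong_AE[OF assms(1) m assms(3)] integrable_completion[of f' lborel] assms(2) by simp
qed

lemma weak_deriv_representative:
  assumes G: "has_weak_gradient u G"
    and u: "u \<in> borel_measurable lebesgue" "AE x in lebesgue. u x = u' x" "L2 lborel u'"
    and g: "(\<lambda>x. G x $ j) \<in> borel_measurable lebesgue" "AE x in lebesgue. G x $ j = g x" "L2 lborel g"
  shows "weak_deriv j u' g"
  unfolding weak_deriv_def
proof (intro conjI allI impI u g)
  fix \<phi> assume \<phi>: "test_function \<phi>"
  have m: "\<phi> \<in> borel_measurable borel" "partial_deriv \<phi> j \<in> borel_measurable borel"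
    by (intro test_function_measurable \<phi> test_function_partial_deriv)+
  have b: "u' \<in> borel_measurable borel" "g \<in> borel_measurable borel" using u g by (auto simp: L2_def)
  have "(LINT x|lebesgue. partial_deriv \<phi> j x *\<^sub>R u x) = (LINT x|lborel. partial_deriv \<phi> j x *\<^sub>R u' x)"
  proof (rule integral_lebesgue_representative)
    show "AE x in lebesgue. partial_deriv \<phi> j x *\<^sub>R u x = partial_deriv \<phi> j x *\<^sub>R u' x" using u(2) by eventually_elim simp
  qed (intro borel_measurable_scaleR borel_imp_lebesgue m u b)+
  moreover have "(LINT x|lebesgue. \<phi> x *\<^sub>R G x $ j) = (LINT x|lborel. \<phi> x *\<^sub>R g x)"
  proof (rule integral_lebesgue_representative)
    show "AE x in lebesgue. \<phi> x *\<^sub>R G x $ j = \<phi> x *\<^sub>R g x" using g(2) by eventually_elim simp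
  qed (intro borel_measurable_scaleR borel_imp_lebesgue m g b)+
  ultimately show "(LINT x|lborel. partial_deriv \<phi> j x *\<^sub>R u' x) = - (LINT x|lborel. \<phi> x *\<^sub>R g x)"
    using G \<phi> unfolding has_weak_gradient_def by (metis (no_types, lifting))
qed

lemma norm_power2_complex_plane: "(norm (v::complex^2))\<^sup>2 = (norm (v $ 1))\<^sup>2 + (norm (v $ 2))\<^sup>2"
  by (simp add: norm_vec_def L2_set_def sum_2 real_sqrt_pow2)

text \<open>Replaces the Lebesgue measurable data of \<open>H1\<close> by Borel functions, on which
  the estimates of the locale \<open>H1_function\<close> are available.\<close>

lemma gradient_representative:
  assumes u: "square_integrable u" and G: "square_integrable G" "has_weak_gradient u G"
  obtains u' g1 g2 where "AE x in lebesgue. u x = u' x" "AE x in lebesgue. G x $ 1 = g1 x \<and> G x $ 2 = g2 x"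
    "weak_deriv 1 u' g1" "weak_deriv 2 u' g2"
proof -
  have um: "u \<in> borel_measurable lebesgue" using u by (simp add: square_integrable_def)
  have Gm: "(\<lambda>x. G x $ j) \<in> borel_measurable lebesgue" for j
    using G(1) by (auto simp: square_integrable_def intro: borel_measurable_continuous_on[OF linear_continuous_on[OF bounded_linear_vec_nth]])
  obtain u' where u': "u' \<in> borel_measurable borel" "AE x in lebesgue. u x = u' x"
    using lebesgue_borel_representative[OF um] by blast
  obtain g1 where g1: "g1 \<in> borel_measurable borel" "AE x in lebesgue. G x $ 1 = g1 x"
    using lebesgue_borel_representative[OF Gm] by blast
  obtain g2 where g2: "g2 \<in> borel_measurable borel" "AE x in lebesgue. G x $ 2 = g2 x"
    using lebesgue_borel_representative[OF Gm] by blast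
  have L2: "L2 lborel f'" if "f \<in> borel_measurable lebesgue" "f' \<in> borel_measurable borel" "AE x in lebesgue. f x = f' x"
    "integrable lebesgue (\<lambda>x. (norm (f x))\<^sup>2)" for f f' :: "real^2 \<Rightarrow> complex"
    unfolding L2_def
  proof
    have "AE x in lebesgue. (norm (f x))\<^sup>2 = (norm (f' x))\<^sup>2" using that(3) by eventually_elim simp
    then have "integrable lebesgue (\<lambda>x. (norm (f x))\<^sup>2) \<longleftrightarrow> integrable lborel (\<lambda>x. (norm (f' x))\<^sup>2)"
      using that(1,2) by (intro integral_lebesgue_representative(2)) auto
    then show "integrable lborel (\<lambda>x. (norm (f' x))\<^sup>2)" using that by simp
  qed (use that in simp)
  have Gi: "integrable lebesgue (\<lambda>x. (norm (G x $ j))\<^sup>2)" for j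
  proof (rule Bochner_Integration.integrable_bound)
    show "integrable lebesgue (\<lambda>x. (norm (G x))\<^sup>2)" using G(1) by (simp add: square_integrable_def)
    show "(\<lambda>x. (norm (G x $ j))\<^sup>2) \<in> borel_measurable lebesgue" using Gm[of j] by measurable
    show "AE x in lebesgue. norm ((norm (G x $ j))\<^sup>2) \<le> norm ((norm (G x))\<^sup>2)"
      by (intro AE_I2) (simp add: power_mono Finite_Cartesian_Product.norm_nth_le)
  qed
  have lu: "L2 lborel u'" using L2[OF um u'] u by (simp add: square_integrable_def)
  have l1: "L2 lborel g1" by (rule L2[OF Gm g1 Gi])
  have l2: "L2 lborel g2" by (rule L2[OF Gm g2 Gi])
  show thesis
  proof (rule that[OF u'(2)])
    show "AE x in lebesgue. G x $ 1 = g1 x \<and> G x $ 2 = g2 x" using g1(2) g2(2) by eventually_elim simp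
    show "weak_deriv 1 u' g1" by (rule weak_deriv_representative[OF G(2) um u'(2) lu Gm g1(2) l1])
    show "weak_deriv 2 u' g2" by (rule weak_deriv_representative[OF G(2) um u'(2) lu Gm g2(2) l2])
  qed
qed

lemma weak_derivs_imp_H1:
  assumes w: "weak_deriv 1 u g1" "weak_deriv 2 u g2"
  shows "u \<in> H1"
proof -
  define G :: "real^2 \<Rightarrow> complex^2" where "G x = (\<chi> j. if j = 1 then g1 x else g2 x)" for x
  note l = weak_deriv_L2[OF w(1)] weak_deriv_L2[OF w(2)]
  have m: "u \<in> borel_measurable borel" "g1 \<in> borel_measurable borel" "g2 \<in> borel_measurable borel"
    using l by (auto simp: L2_def)
  have G12: "G x $ 1 = g1 x" "G x $ 2 = g2 x" for x by (simp_all add: G_def)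
  have "square_integrable u"
    using l(1) m(1) integrable_completion[of "\<lambda>x. (norm (u x))\<^sup>2" lborel]
    by (auto simp: square_integrable_def L2_def intro: borel_imp_lebesgue)
  moreover have "square_integrable G"
  proof -
    have Gm: "G \<in> borel_measurable borel"
    proof (rule borel_measurable_euclidean_space[THEN iffD2], rule ballI)
      fix i :: "complex^2" assume "i \<in> Basis"
      have "G x \<bullet> i = g1 x \<bullet> (i $ 1) + g2 x \<bullet> (i $ 2)" for x by (simp add: inner_vec_def sum_2 G12)
      then show "(\<lambda>x. G x \<bullet> i) \<in> borel_measurable borel" using m by simp
    qed
    moreover have "integrable lborel (\<lambda>x. (norm (G x))\<^sup>2)"
      unfolding norm_power2_complex_plane G12 using l by (auto simp: L2_def)
    then have "integrable lebesgue (\<lambda>x. (norm (G x))\<^sup>2)"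
      using integrable_completion[of "\<lambda>x. (norm (G x))\<^sup>2" lborel] Gm by auto
    ultimately show ?thesis by (auto simp: square_integrable_def intro: borel_imp_lebesgue)
  qed
  moreover have "has_weak_gradient u G"
    unfolding has_weak_gradient_def
  proof (intro allI impI)
    fix \<phi> j assume \<phi>: "test_function \<phi>"
    have m\<phi>: "\<phi> \<in> borel_measurable borel" "partial_deriv \<phi> j \<in> borel_measurable borel"
      by (intro test_function_measurable \<phi> test_function_partial_deriv)+
    obtain g where g: "weak_deriv j u g" "\<And>x. G x $ j = g x"
      using w G12 exhaust_2[of j] by metis
    have mg: "g \<in> borel_measurable borel" using weak_deriv_L2[OF g(1)] by (simp add: L2_def)
    have "(LINT x|lebesgue. partial_deriv \<phi> j x *\<^sub>R u x) = (LINT x|lborel. partial_deriv \<phi> j x *\<^sub>R u x)"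
      "(LINT x|lebesgue. \<phi> x *\<^sub>R g x) = (LINT x|lborel. \<phi> x *\<^sub>R g x)"
      using m m\<phi> mg by (auto intro!: integral_completion)
    then show "(LINT x|lebesgue. partial_deriv \<phi> j x *\<^sub>R u x) = - (LINT x|lebesgue. \<phi> x *\<^sub>R G x $ j)"
      using weak_derivD[OF g(1) \<phi>] by (simp add: g(2))
  qed
  ultimately show ?thesis by (auto simp: H1_def)
qed

lemma weak_gradient_H1:
  assumes "u \<in> H1" shows "square_integrable u" "square_integrable (weak_gradient u)" "has_weak_gradient u (weak_gradient u)"
proof -
  show "square_integrable u" using assms by (simp add: H1_def)
  have "\<exists>G. square_integrable G \<and> has_weak_gradient u G" using assms by (simp add: H1_def)
  from someI_ex[OF this] show "square_integrable (weak_gradient u)" "has_weak_gradient u (weak_gradient u)"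
    unfolding weak_gradient_def by auto
qed

text \<open>Each truncated integral ignores changes on null sets, so the limits agree at every
  single \<open>x\<close>, not just almost everywhere.\<close>

lemma magnetic_potential_cong_AE:
  assumes "r \<in> borel_measurable lebesgue" "r' \<in> borel_measurable lebesgue" "AE x in lebesgue. r x = r' x"
  shows "magnetic_potential r x = magnetic_potential r' x"
proof -
  have "(LINT y:{y. \<epsilon> < norm (x - y)}|lebesgue. (r y / (norm (x - y))\<^sup>2) *\<^sub>R perp (x - y)) =
        (LINT y:{y. \<epsilon> < norm (x - y)}|lebesgue. (r' y / (norm (x - y))\<^sup>2) *\<^sub>R perp (x - y))" for \<epsilon>
    unfolding set_lebesgue_integral_def
  proof (rule integral_cong_AE)
    have m: "(\<lambda>y. indicator {y. \<epsilon> < norm (x - y)} y :: real) \<in> borel_measurable lebesgue"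
      "(\<lambda>y. (norm (x - y))\<^sup>2) \<in> borel_measurable lebesgue" "(\<lambda>y. perp (x - y)) \<in> borel_measurable lebesgue"
      by (rule borel_imp_lebesgue, measurable)+
    show "(\<lambda>y. indicator {y. \<epsilon> < norm (x - y)} y *\<^sub>R (r y / (norm (x - y))\<^sup>2) *\<^sub>R perp (x - y)) \<in> borel_measurable lebesgue"
      "(\<lambda>y. indicator {y. \<epsilon> < norm (x - y)} y *\<^sub>R (r' y / (norm (x - y))\<^sup>2) *\<^sub>R perp (x - y)) \<in> borel_measurable lebesgue"
      by (intro borel_measurable_scaleR borel_measurable_divide m assms)+
    show "AE y in lebesgue. indicator {y. \<epsilon> < norm (x - y)} y *\<^sub>R (r y / (norm (x - y))\<^sup>2) *\<^sub>R perp (x - y) =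
        indicator {y. \<epsilon> < norm (x - y)} y *\<^sub>R (r' y / (norm (x - y))\<^sup>2) *\<^sub>R perp (x - y)"
      using assms(3) by eventually_elim simp
  qed
  then show ?thesis unfolding magnetic_potential_def by simp
qed

section \<open>The quotient on the unit sphere of H1\<close>

definition magnetic_quotient :: "real \<Rightarrow> (real^2 \<Rightarrow> complex) \<Rightarrow> ennreal" where
  "magnetic_quotient \<beta> u = (\<integral>\<^sup>+x. ennreal ((norm (magnetic_gradient \<beta> u x))\<^sup>2) \<partial>lebesgue)
       / (\<integral>\<^sup>+x. ennreal ((norm (u x))^4) \<partial>lebesgue)"

definition H1_sphere :: "(real^2 \<Rightarrow> complex) set" where
  "H1_sphere = {u \<in> H1. (LINT x|lebesgue. (norm (u x))\<^sup>2) = 1}"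

text \<open>The gradient picked by \<open>weak_gradient\<close> agrees almost everywhere with
  \<open>(g1, g2)\<close> by uniqueness, and the potential is insensitive to the representative.
  Numerator and denominator are then finite and the latter positive, so the \<open>ennreal\<close>
  quotient is a real one.\<close>

lemma magnetic_quotient_eq:
  assumes u: "u \<in> H1" and ae: "AE x in lebesgue. u x = u' x" and n: "normalized_H1_function u' g1 g2"
  shows "magnetic_quotient \<beta> u = ennreal (normalized_H1_function.energy u' g1 g2 \<beta> / normalized_H1_function.quartic u')"
proof -
  interpret normalized_H1_function u' g1 g2 by (rule n)
  note wg = weak_gradient_H1[OF u]
  obtain v h1 h2 where v: "AE x in lebesgue. u x = v x" "AE x in lebesgue. weak_gradient u x $ 1 = h1 x \<and> weak_gradient u x $ 2 = h2 x"
    "weak_deriv 1 v h1" "weak_deriv 2 v h2" using gradient_representative[OF wg] by blast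
  have um: "u \<in> borel_measurable lebesgue" using wg(1) by (simp add: square_integrable_def)
  have Gm: "(\<lambda>x. weak_gradient u x $ j) \<in> borel_measurable lebesgue" for j
    using wg(2) by (auto simp: square_integrable_def intro: borel_measurable_continuous_on[OF linear_continuous_on[OF bounded_linear_vec_nth]])
  have "weak_deriv 1 u' h1"
    by (rule weak_deriv_representative[OF wg(3) um ae L2_u Gm _ weak_deriv_L2(2)[OF v(3)]]) (use v(2) in eventually_elim, simp)
  from weak_deriv_unique[OF this weak1] have a1: "AE x in lebesgue. h1 x = g1 x" by (rule AE_completion)
  have "weak_deriv 2 u' h2"
    by (rule weak_deriv_representative[OF wg(3) um ae L2_u Gm _ weak_deriv_L2(2)[OF v(4)]]) (use v(2) in eventually_elim, simp)
  from weak_deriv_unique[OF this weak2] have a2: "AE x in lebesgue. h2 x = g2 x" by (rule AE_completion)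
  have mp: "magnetic_potential (\<lambda>y. (norm (u y))\<^sup>2) x = vector [- V 2 x, V 1 x]" for x
  proof -
    have "magnetic_potential (\<lambda>y. (norm (u y))\<^sup>2) x = magnetic_potential rho x"
    proof (rule magnetic_potential_cong_AE)
      show "AE x in lebesgue. (norm (u x))\<^sup>2 = rho x" using ae by eventually_elim (simp add: rho_def)
    qed (use um in \<open>auto intro: borel_imp_lebesgue\<close>)
    then show ?thesis by (simp add: magnetic_potential_eq)
  qed
  have "(\<integral>\<^sup>+x. ennreal ((norm (magnetic_gradient \<beta> u x))\<^sup>2) \<partial>lebesgue) = (\<integral>\<^sup>+x. ennreal (energy_density \<beta> x) \<partial>lebesgue)"
  proof (rule nn_integral_cong_AE)
    show "AE x in lebesgue. ennreal ((norm (magnetic_gradient \<beta> u x))\<^sup>2) = ennreal (energy_density \<beta> x)"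
      using ae v(2) a1 a2
      by eventually_elim (simp add: magnetic_gradient_def mp norm_power2_complex_plane energy_density_def)
  qed
  also have "\<dots> = (\<integral>\<^sup>+x. ennreal (energy_density \<beta> x) \<partial>lborel)" by (rule nn_integral_completion)
  also have "\<dots> = ennreal (energy \<beta>)"
    unfolding energy_def by (intro nn_integral_eq_integral integrable_energy_density) (simp add: energy_density_nonneg)
  finally have num: "(\<integral>\<^sup>+x. ennreal ((norm (magnetic_gradient \<beta> u x))\<^sup>2) \<partial>lebesgue) = ennreal (energy \<beta>)" .
  have "(\<integral>\<^sup>+x. ennreal ((norm (u x))^4) \<partial>lebesgue) = (\<integral>\<^sup>+x. ennreal ((rho x)\<^sup>2) \<partial>lebesgue)"
    by (rule nn_integral_cong_AE) (use ae in eventually_elim, simp add: rho_def)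
  also have "\<dots> = (\<integral>\<^sup>+x. ennreal ((rho x)\<^sup>2) \<partial>lborel)" by (rule nn_integral_completion)
  also have "\<dots> = ennreal quartic"
    unfolding quartic_def by (intro nn_integral_eq_integral integrable_rho2) simp
  finally have den: "(\<integral>\<^sup>+x. ennreal ((norm (u x))^4) \<partial>lebesgue) = ennreal quartic" .
  show ?thesis unfolding magnetic_quotient_def num den by (rule divide_ennreal[OF energy_nonneg quartic_pos])
qed

lemma H1_sphere_representative:
  assumes "u \<in> H1_sphere"
  obtains u' g1 g2 where "AE x in lebesgue. u x = u' x" "normalized_H1_function u' g1 g2"
proof -
  have u: "u \<in> H1" "(LINT x|lebesgue. (norm (u x))\<^sup>2) = 1" using assms by (auto simp: H1_sphere_def)
  note wg = weak_gradient_H1[OF u(1)]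
  obtain u' g1 g2 where r: "AE x in lebesgue. u x = u' x" "weak_deriv 1 u' g1" "weak_deriv 2 u' g2"
    using gradient_representative[OF wg] by blast
  interpret H: H1_function u' g1 g2 using r(2,3) by unfold_locales
  have um: "u \<in> borel_measurable lebesgue" using wg(1) by (simp add: square_integrable_def)
  have "(LINT x|lebesgue. (norm (u x))\<^sup>2) = (LINT x|lborel. H.rho x)"
  proof (rule integral_lebesgue_representative)
    show "AE x in lebesgue. (norm (u x))\<^sup>2 = H.rho x" using r(1) by eventually_elim (simp add: H.rho_def)
  qed (use um in auto)
  then have "normalized_H1_function u' g1 g2" using u(2) by unfold_locales simp
  with r(1) show thesis by (rule that)
qed

lemma normalized_in_H1_sphere:
  assumes "normalized_H1_function u g1 g2" shows "u \<in> H1_sphere"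
proof -
  interpret normalized_H1_function u g1 g2 by (rule assms)
  have "u \<in> H1" by (rule weak_derivs_imp_H1[OF weak1 weak2])
  moreover have "(LINT x|lebesgue. (norm (u x))\<^sup>2) = 1"
    using normalized integral_completion[of rho lborel] by (simp add: rho_def[abs_def])
  ultimately show ?thesis by (simp add: H1_sphere_def)
qed

text \<open>Over an empty set the infimum would be \<open>top\<close>, which \<open>enn2real\<close>
  sends to 0. The witness is a normalised bump.\<close>

lemma H1_sphere_nonempty: "H1_sphere \<noteq> {}"
proof -
  define c where "c = 1 / sqrt (LINT x|lborel. (plane_bump 1 x)\<^sup>2)"
  define \<phi> where "\<phi> x = c * plane_bump 1 x" for x
  have t: "test_function \<phi>" unfolding \<phi>_def[abs_def] by (rule test_function_scale[OF test_function_plane_bump])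
  have Lof: "L2 lborel (\<lambda>x. complex_of_real (\<psi> x))" if "test_function \<psi>" for \<psi>
    by (rule L2_bound[OF test_function_L2[OF that], where C = 1]) (use test_function_measurable[OF that] in auto)
  have w: "weak_deriv j (\<lambda>x. complex_of_real (\<phi> x)) (\<lambda>x. complex_of_real (partial_deriv \<phi> j x))" for j
  proof (rule smooth_weak_deriv)
    fix x t
    show "((\<lambda>t. complex_of_real (\<phi> (x + t *\<^sub>R axis j 1))) has_vector_derivative complex_of_real (partial_deriv \<phi> j (x + t *\<^sub>R axis j 1))) (at t)"
      by (intro has_vector_derivative_of_real) (simp add: has_real_derivative_iff_has_vector_derivative test_function_directional[OF t])
  qed (intro Lof t test_function_partial_deriv continuous_intros test_function_continuous)+
  interpret H: H1_function "\<lambda>x. complex_of_real (\<phi> x)" "\<lambda>x. complex_of_real (partial_deriv \<phi> 1 x)" "\<lambda>x. complex_of_real (partial_deriv \<phi> 2 x)"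
    using w by unfold_locales
  have i2: "integrable lborel (\<lambda>x. (plane_bump 1 x)\<^sup>2)"
    using L2_integrable[OF test_function_L2[OF test_function_plane_bump]] by simp
  have "(LINT x|lborel. (plane_bump 1 x)\<^sup>2) \<noteq> 0"
  proof
    assume "(LINT x|lborel. (plane_bump 1 x)\<^sup>2) = 0"
    then have "AE x in lborel. (plane_bump 1 x)\<^sup>2 = 0" using integral_nonneg_eq_0_iff_AE[OF i2] by simp
    then have "AE x in lborel. plane_bump 1 x = 0" by simp
    then have "(LINT x|lborel. plane_bump 1 x) = 0" by (rule integral_eq_zero_AE)
    then show False using plane_bump_integral_pos[of 1] by simp
  qed
  moreover have "0 \<le> (LINT x|lborel. (plane_bump 1 x)\<^sup>2)" by simp
  ultimately have pos: "0 < (LINT x|lborel. (plane_bump 1 x)\<^sup>2)" by linarith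
  have "(LINT x|lborel. H.rho x) = c\<^sup>2 * (LINT x|lborel. (plane_bump 1 x)\<^sup>2)"
    unfolding H.rho_def by (simp add: \<phi>_def norm_mult power_mult_distrib)
  also have "\<dots> = 1" using pos by (simp add: c_def power_divide)
  finally have "normalized_H1_function (\<lambda>x. complex_of_real (\<phi> x)) (\<lambda>x. complex_of_real (partial_deriv \<phi> 1 x)) (\<lambda>x. complex_of_real (partial_deriv \<phi> 2 x))"
    by unfold_locales
  from normalized_in_H1_sphere[OF this] show ?thesis by blast
qed

lemma gamma_star_INF: "gamma_star \<beta> = enn2real (INF u\<in>H1_sphere. magnetic_quotient \<beta> u)"
  by (simp add: gamma_star_def H1_sphere_def magnetic_quotient_def)

lemma magnetic_quotient_finite: "u \<in> H1_sphere \<Longrightarrow> magnetic_quotient \<beta> u < \<infinity>"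
proof -
  assume u: "u \<in> H1_sphere"
  obtain u' g1 g2 where r: "AE x in lebesgue. u x = u' x" "normalized_H1_function u' g1 g2"
    using H1_sphere_representative[OF u] by blast
  have "u \<in> H1" using u by (simp add: H1_sphere_def)
  then show ?thesis by (subst magnetic_quotient_eq[OF _ r]) auto
qed

lemma gamma_star_nonneg: "0 \<le> gamma_star \<beta>"
  by (simp add: gamma_star_def)

lemma gamma_star_le:
  assumes "u \<in> H1_sphere" "magnetic_quotient \<beta> u = ennreal c" "0 \<le> c"
  shows "gamma_star \<beta> \<le> c"
  unfolding gamma_star_INF using assms by (intro enn2real_leI) (auto intro: INF_lower2)

text \<open>\<open>enn2real\<close> is monotone only below \<open>top\<close>, hence the recourse to
  the finite quotient of some admissible \<open>u\<close>.\<close>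

lemma gamma_star_ge:
  assumes "\<And>u. u \<in> H1_sphere \<Longrightarrow> ennreal c \<le> magnetic_quotient \<beta> u"
  shows "c \<le> gamma_star \<beta>"
proof (cases "0 \<le> c")
  case True
  obtain u where u: "u \<in> H1_sphere" using H1_sphere_nonempty by blast
  have "(INF u\<in>H1_sphere. magnetic_quotient \<beta> u) \<le> magnetic_quotient \<beta> u" by (rule INF_lower[OF u])
  also have "\<dots> < top" using magnetic_quotient_finite[OF u] by simp
  finally have "enn2real (ennreal c) \<le> enn2real (INF u\<in>H1_sphere. magnetic_quotient \<beta> u)"
    by (intro enn2real_mono INF_greatest assms)
  then show ?thesis using True by (simp add: gamma_star_INF)
next
  case False
  then show ?thesis using gamma_star_nonneg[of \<beta>] by linarith
qed

context normalized_H1_function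
begin

text \<open>Serves both bounds: at \<open>\<beta> = 0\<close> it bounds \<open>D\<close> from below
  by \<open>gamma_star 0\<close> times \<open>quartic\<close>, and for general
  \<open>\<beta>\<close> it carries the upper bound.\<close>

lemma gamma_star_le_modulus: "gamma_star \<beta> \<le> (1 + 3 / 2 * \<beta>\<^sup>2) * (D / quartic)"
proof -
  let ?w = "\<lambda>x. complex_of_real (norm (u x))" and ?w1 = "\<lambda>x. complex_of_real (d1 x / norm (u x))"
    and ?w2 = "\<lambda>x. complex_of_real (d2 x / norm (u x))"
  note w = modulus_competitor
  interpret W: normalized_H1_function ?w ?w1 ?w2 by (rule w(1))
  have s: "?w \<in> H1_sphere" by (rule normalized_in_H1_sphere[OF w(1)])
  then have "?w \<in> H1" by (simp add: H1_sphere_def)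
  then have "magnetic_quotient \<beta> ?w = ennreal (W.energy \<beta> / W.quartic)"
    by (rule magnetic_quotient_eq[OF _ _ W.normalized_H1_function_axioms]) simp
  then have "gamma_star \<beta> \<le> W.energy \<beta> / W.quartic"
    by (rule gamma_star_le[OF s]) (intro divide_nonneg_pos W.energy_nonneg W.quartic_pos)
  also have "\<dots> \<le> ((1 + 3 / 2 * \<beta>\<^sup>2) * D) / quartic"
    unfolding w(3) using quartic_pos by (intro divide_right_mono w(2)) simp
  finally show ?thesis by simp
qed

end

theorem proposition3p24:
  fixes \<beta> :: real
  assumes "\<beta> \<ge> 0"
  shows "gamma_star 0 + pi\<^sup>2 / gamma_star \<beta> * \<beta>\<^sup>2 \<le> gamma_star \<beta>
       \<and> gamma_star \<beta> \<le> gamma_star 0 + 3 * gamma_star 0 / 2 * \<beta>\<^sup>2"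
proof
  define c where "c = (pi * \<beta>)\<^sup>2"
  have c0: "0 \<le> c" by (simp add: c_def)
  define g where "g = gamma_star 0"
  have g0: "0 \<le> g" by (simp add: g_def gamma_star_nonneg)
  \<comment> \<open>The larger root of \<open>t * (t - g) = c\<close>, a number independent of the
    trial function.\<close>
  define m where "m = (g + sqrt (g\<^sup>2 + 4 * c)) / 2"
  have s: "(sqrt (g\<^sup>2 + 4 * c))\<^sup>2 = g\<^sup>2 + 4 * c" using c0 by simp
  have mg: "g \<le> m"
    unfolding m_def using real_le_rsqrt[of g "g\<^sup>2 + 4 * c"] c0 by simp
  have mm: "m * (m - g) = c"
    using s unfolding m_def by (simp add: power2_eq_square field_simps)
  have "m \<le> gamma_star \<beta>"
  proof (rule gamma_star_ge)
    fix u assume u: "u \<in> H1_sphere"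
    obtain u' g1 g2 where r: "AE x in lebesgue. u x = u' x" "normalized_H1_function u' g1 g2"
      using H1_sphere_representative[OF u] by blast
    interpret normalized_H1_function u' g1 g2 by (rule r(2))
    obtain D' R' where DR: "energy \<beta> = D' + R'" "D \<le> D'" "0 \<le> R'" "(pi * \<beta> * quartic)\<^sup>2 \<le> D' * R'"
      using energy_splitting[OF assms] by blast
    define d e where "d = D' / quartic" and "e = energy \<beta> / quartic"
    have "g \<le> D / quartic" using gamma_star_le_modulus[of 0] by (simp add: g_def)
    also have "\<dots> \<le> d" unfolding d_def using DR(2) quartic_pos by (intro divide_right_mono) auto
    finally have gd: "g \<le> d" .
    have ed: "e - d = R' / quartic" by (simp add: e_def d_def DR(1) add_divide_distrib)
    moreover have "0 \<le> R' / quartic" using DR(3) quartic_pos by simp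
    ultimately have de: "d \<le> e" by linarith
    have "c \<le> d * (e - d)"
    proof -
      have "c * quartic\<^sup>2 \<le> D' * R'" using DR(4) by (simp add: c_def power_mult_distrib)
      then have "c \<le> D' * R' / quartic\<^sup>2" using quartic_pos by (simp add: le_divide_eq)
      then show ?thesis unfolding ed by (simp add: d_def power2_eq_square)
    qed
    \<comment> \<open>Both factors grow, as \<open>g \<le> d \<le> e\<close>.\<close>
    also have "\<dots> \<le> e * (e - g)" using gd de g0 by (intro mult_mono) auto
    finally have "c \<le> e * (e - g)" .
    have "m \<le> e"
    \<comment> \<open>\<open>t * (t - g)\<close> is strictly increasing for
      \<open>t \<ge> g\<close>, and \<open>m\<close> attains the value \<open>c\<close>.\<close>
    proof (rule ccontr)
      assume "\<not> m \<le> e"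
      then have "e < m" by simp
      moreover have "0 \<le> e" "0 \<le> e - g" using gd de g0 by linarith+
      ultimately have "e * (e - g) < m * (m - g)" by (intro mult_strict_mono) auto
      then show False using \<open>c \<le> e * (e - g)\<close> mm by simp
    qed
    moreover have uH: "u \<in> H1" using u by (simp add: H1_sphere_def)
    ultimately show "ennreal m \<le> magnetic_quotient \<beta> u"
      unfolding magnetic_quotient_eq[OF uH r] e_def by (intro ennreal_leI)
  qed
  show "gamma_star 0 + pi\<^sup>2 / gamma_star \<beta> * \<beta>\<^sup>2 \<le> gamma_star \<beta>"
  \<comment> \<open>Here \<open>pi^2 / 0 = 0\<close>, and the claim reduces to
    \<open>g \<le> 0\<close>, which \<open>g \<le> m \<le> gamma_star \<beta>\<close> gives.\<close>
  proof (cases "gamma_star \<beta> = 0")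
    case True
    then show ?thesis using mg \<open>m \<le> gamma_star \<beta>\<close> by (simp add: g_def)
  next
    case False
    then have p: "0 < gamma_star \<beta>" using gamma_star_nonneg[of \<beta>] by simp
    have "c \<le> gamma_star \<beta> * (gamma_star \<beta> - g)"
      unfolding mm[symmetric] using \<open>m \<le> gamma_star \<beta>\<close> mg g0 p by (intro mult_mono) auto
    then have "c / gamma_star \<beta> \<le> gamma_star \<beta> - g" using p by (simp add: divide_le_eq mult.commute)
    then show ?thesis by (simp add: c_def g_def power_mult_distrib)
  qed
  have pos: "0 < 1 + 3 / 2 * \<beta>\<^sup>2" by (simp add: add_pos_nonneg)
  \<comment> \<open>Dividing turns the upper bound into a lower bound for
    \<open>gamma_star 0\<close>, so it suffices to bound each quotient at \<open>\<beta> = 0\<close>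
    from below.\<close>
  have "gamma_star \<beta> / (1 + 3 / 2 * \<beta>\<^sup>2) \<le> gamma_star 0"
  proof (rule gamma_star_ge)
    fix u assume u: "u \<in> H1_sphere"
    obtain u' g1 g2 where r: "AE x in lebesgue. u x = u' x" "normalized_H1_function u' g1 g2"
      using H1_sphere_representative[OF u] by blast
    interpret normalized_H1_function u' g1 g2 by (rule r(2))
    \<comment> \<open>At \<open>\<beta> = 0\<close> the splitting says that passing to the modulus
      does not raise the kinetic energy.\<close>
    obtain D' R' where "energy 0 = D' + R'" "D \<le> D'" "0 \<le> R'"
      using energy_splitting[OF order_refl] by blast
    then have "D / quartic \<le> energy 0 / quartic" using quartic_pos by (intro divide_right_mono) auto
    moreover have "gamma_star \<beta> / (1 + 3 / 2 * \<beta>\<^sup>2) \<le> D / quartic"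
      using gamma_star_le_modulus[of \<beta>] pos by (simp add: divide_le_eq mult.commute)
    moreover have uH: "u \<in> H1" using u by (simp add: H1_sphere_def)
    ultimately show "ennreal (gamma_star \<beta> / (1 + 3 / 2 * \<beta>\<^sup>2)) \<le> magnetic_quotient 0 u"
      unfolding magnetic_quotient_eq[OF uH r] by (intro ennreal_leI) linarith
  qed
  then show "gamma_star \<beta> \<le> gamma_star 0 + 3 * gamma_star 0 / 2 * \<beta>\<^sup>2"
    using pos by (simp add: divide_le_eq algebra_simps)
qed

end
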